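(* Let $0<\epsilon<1$ and let $W(t)=(W^1(t),\dots,W^6(t))$ be standard Brownian motion on $\mathbb{R}^6$ (started at $0$). Then, with probability 1, there exists a compactly supported $C^{2-\epsilon}$ function $f:\mathbb{R}^6\to\mathbb{R}$ (depending on the path) such that the system $$dy^i=dW^i,\quad i=1,\dots,5,\qquad dy^6=f(y)\,dW^6$$ has infinitely many solutions, on some interval $[0,T]$ with $T>0$ and in the pathwise sense defined in the context, satisfying the initial condition $y(0)=0$.
   Context: A function is $C^{2-\epsilon}$ ($0<\epsilon<1$) if its first derivatives exist and satisfy locally a Hölder condition of exponent $1-\epsilon$. The Itô iterated integrals $A^{rj}(s,t)=\int_s^t(W^r(u)-W^r(s))\,dW^j(u)$, $1\le r,j\le 6$, are used, taken in a version for which, with probability 1, for all $s\le t\le u$, $A^{rj}(s,u)=A^{rj}(s,t)+A^{rj}(t,u)+(W^r(t)-W^r(s))(W^j(u)-W^j(t))$, and for every $p>2$ and every bounded interval there is a constant $c$ with $|W(t)-W(s)|\le c(t-s)^{1/p}$ and $|A^{rj}(s,t)|\le c(t-s)^{2/p}$ on that interval. Solution (for a fixed path) of a system $dy^i=\sum_j f^i_j(y)\,dW^j$, $i=1,\dots,n$: $y:[0,T]\to\mathbb{R}^n$ is a solution on $[0,T]$ with initial value $y_0$ if $y(0)=y_0$ and there exist a continuous increasing function $\tilde\omega$ on $[0,T]$ and a non-negative function $\theta$ on $[0,\infty)$ with $\theta(\delta)=o(\delta)$ as $\delta\to0$ such that for all $i$ and all $0\le s<t\le T$ $$\Big|y^i(t)-y^i(s)-\sum_j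 f^i_j(y(s))(W^j(t)-W^j(s))-\sum_{h,r,j}f^h_r(y(s))\,\partial_hf^i_j(y(s))\,A^{rj}(s,t)\Big|\le\theta(\tilde\omega(t)-\tilde\omega(s)).$$ In the present system $n=d=6$, $f^i_i=1$ for $i\le5$, $f^6_6=f$, and all other $f^i_j$ are $0$. *)

theory Defs
  imports "HOL-Probability.Probability" "HOL-Library.Landau_Symbols"
begin

section \<open>Brownian motion\<close>

text \<open>Time runs over the nonnegative reals; \<^term>\<open>W t\<close> is unconstrained for \<^term>\<open>t < 0\<close>.
  The increment over an interval of length \<^term>\<open>t - s\<close> is centred Gaussian with covariance
  matrix \<^term>\<open>t - s\<close> times the identity.\<close>

locale standard_brownian_motion = prob_space M
  for M :: "'a measure" and W :: "real \<Rightarrow> 'a \<Rightarrow> real ^ 'd::finite" +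
  assumes measurable_at: "\<And>t. 0 \<le> t \<Longrightarrow> W t \<in> borel_measurable M"
    and started_at_0: "AE \<omega> in M. W 0 \<omega> = 0"
    and indep_increments: "\<And>(n::nat) (\<tau>::nat \<Rightarrow> real).
      0 \<le> \<tau> 0 \<Longrightarrow> (\<And>k. k < n \<Longrightarrow> \<tau> k \<le> \<tau> (Suc k)) \<Longrightarrow>
      indep_vars (\<lambda>_. borel) (\<lambda>k \<omega>. W (\<tau> (Suc k)) \<omega> - W (\<tau> k) \<omega>) {..<n}"
    and normal_increments: "\<And>s t. 0 \<le> s \<Longrightarrow> s < t \<Longrightarrow>
      distributed M lborel (\<lambda>\<omega>. W t \<omega> - W s \<omega>)
        (\<lambda>x. ennreal (\<Prod>i\<in>UNIV. normal_density 0 (sqrt (t - s)) (x $ i)))"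
    and continuous_paths: "AE \<omega> in M. continuous_on {0..} (\<lambda>t. W t \<omega>)"

definition natural_filtration ::
  "'a measure \<Rightarrow> (real \<Rightarrow> 'a \<Rightarrow> 'b::topological_space) \<Rightarrow> real \<Rightarrow> 'a measure" where
  "natural_filtration M W t = (SUP u\<in>{0..t}. vimage_algebra (space M) (W u) borel)"


section \<open>The It\^o integral\<close>

text \<open>A simple integrand on \<open>[s,t]\<close> is \<open>\<Sum>k<n. H k * 1_{(\<tau> k, \<tau> (Suc k)]}\<close> with partition points
  \<open>s = \<tau> 0 \<le> \<dots> \<le> \<tau> n = t\<close> and bounded, \<open>F (\<tau> k)\<close>-measurable coefficients \<open>H k\<close>.\<close>

definition simple_integrand ::
  "(real \<Rightarrow> 'a measure) \<Rightarrow> real \<Rightarrow> real \<Rightarrow> nat \<Rightarrow> (nat \<Rightarrow> real) \<Rightarrow> (nat \<Rightarrow> 'a \<Rightarrow> real) \<Rightarrow> bool" where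
  "simple_integrand F s t n \<tau> H \<longleftrightarrow>
     \<tau> 0 = s \<and> \<tau> n = t \<and> (\<forall>k<n. \<tau> k \<le> \<tau> (Suc k)) \<and>
     (\<forall>k<n. H k \<in> borel_measurable (F (\<tau> k)) \<and> (\<exists>C. \<forall>\<omega>\<in>space (F (\<tau> k)). \<bar>H k \<omega>\<bar> \<le> C))"

definition simple_process ::
  "nat \<Rightarrow> (nat \<Rightarrow> real) \<Rightarrow> (nat \<Rightarrow> 'a \<Rightarrow> real) \<Rightarrow> real \<Rightarrow> 'a \<Rightarrow> real" where
  "simple_process n \<tau> H u \<omega> = (\<Sum>k<n. H k \<omega> * indicat_real {\<tau> k<..\<tau> (Suc k)} u)"

definition simple_ito_sum ::
  "(real \<Rightarrow> 'a \<Rightarrow> real) \<Rightarrow> nat \<Rightarrow> (nat \<Rightarrow> real) \<Rightarrow> (nat \<Rightarrow> 'a \<Rightarrow> real) \<Rightarrow> 'a \<Rightarrow> real" where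
  "simple_ito_sum B n \<tau> H \<omega> = (\<Sum>k<n. H k \<omega> * (B (\<tau> (Suc k)) \<omega> - B (\<tau> k) \<omega>))"

text \<open>\<open>Y\<close> is a version of \<open>\<integral>_s^t X dB\<close>: simple integrands converge to \<open>X\<close> in mean square on
  \<open>[s,t] \<times> \<Omega>\<close> and their elementary integrals converge to \<open>Y\<close> in mean square. This determines \<open>Y\<close>
  almost surely.\<close>

definition is_ito_integral ::
  "'a measure \<Rightarrow> (real \<Rightarrow> 'a measure) \<Rightarrow> (real \<Rightarrow> 'a \<Rightarrow> real) \<Rightarrow> (real \<Rightarrow> 'a \<Rightarrow> real) \<Rightarrow>
   real \<Rightarrow> real \<Rightarrow> ('a \<Rightarrow> real) \<Rightarrow> bool" where
  "is_ito_integral M F B X s t Y \<longleftrightarrow>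
     Y \<in> borel_measurable M \<and>
     (\<exists>n \<tau> H.
        (\<forall>m. simple_integrand F s t (n m) (\<tau> m) (H m)) \<and>
        (\<lambda>m::nat. \<integral>\<^sup>+ \<omega>. (\<integral>\<^sup>+ u\<in>{s..t}.
            ennreal ((simple_process (n m) (\<tau> m) (H m) u \<omega> - X u \<omega>)\<^sup>2) \<partial>lborel) \<partial>M)
          \<longlonglongrightarrow> 0 \<and>
        (\<lambda>m. \<integral>\<^sup>+ \<omega>. ennreal ((simple_ito_sum B (n m) (\<tau> m) (H m) \<omega> - Y \<omega>)\<^sup>2) \<partial>M)
          \<longlonglongrightarrow> 0)"

text \<open>\<open>A r j s t\<close> plays the role of \<open>\<integral>_s^t (W^r(u) - W^r(s)) dW^j(u)\<close>.\<close>

definition iterated_ito_version ::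
  "'a measure \<Rightarrow> (real \<Rightarrow> 'a \<Rightarrow> real ^ 'd::finite) \<Rightarrow>
   ('d \<Rightarrow> 'd \<Rightarrow> real \<Rightarrow> real \<Rightarrow> 'a \<Rightarrow> real) \<Rightarrow> bool" where
  "iterated_ito_version M W A \<longleftrightarrow>
     (\<forall>r j s t. 0 \<le> s \<and> s \<le> t \<longrightarrow>
        is_ito_integral M (natural_filtration M W) (\<lambda>u \<omega>. W u \<omega> $ j)
          (\<lambda>u \<omega>. W u \<omega> $ r - W s \<omega> $ r) s t (A r j s t)) \<and>
     (AE \<omega> in M.
        (\<forall>r j s t u. 0 \<le> s \<and> s \<le> t \<and> t \<le> u \<longrightarrow>
           A r j s u \<omega> = A r j s t \<omega> + A r j t u \<omega>
             + (W t \<omega> $ r - W s \<omega> $ r) * (W u \<omega> $ j - W t \<omega> $ j)) \<and>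
        (\<forall>p>2. \<forall>a\<ge>0. \<forall>b. \<exists>c. \<forall>s t. a \<le> s \<and> s \<le> t \<and> t \<le> b \<longrightarrow>
           norm (W t \<omega> - W s \<omega>) \<le> c * (t - s) powr (1 / p) \<and>
           (\<forall>r j. \<bar>A r j s t \<omega>\<bar> \<le> c * (t - s) powr (2 / p))))"


section \<open>Regularity\<close>

definition partial_deriv :: "'n::finite \<Rightarrow> (real ^ 'n \<Rightarrow> real) \<Rightarrow> real ^ 'n \<Rightarrow> real" where
  "partial_deriv h f x = deriv (\<lambda>t. f (x + t *\<^sub>R axis h 1)) 0"

definition locally_holder ::
  "real \<Rightarrow> ('a::metric_space \<Rightarrow> 'b::metric_space) \<Rightarrow> bool" where
  "locally_holder \<alpha> g \<longleftrightarrow>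
     (\<forall>x. \<exists>\<delta>>0. \<exists>C. \<forall>y\<in>ball x \<delta>. \<forall>z\<in>ball x \<delta>. dist (g y) (g z) \<le> C * dist y z powr \<alpha>)"

definition C_2_minus :: "real \<Rightarrow> (real ^ 'n::finite \<Rightarrow> real) \<Rightarrow> bool" where
  "C_2_minus \<epsilon> f \<longleftrightarrow>
     (\<forall>h. (\<forall>x. (\<lambda>t. f (x + t *\<^sub>R axis h 1)) field_differentiable at 0) \<and>
          locally_holder (1 - \<epsilon>) (partial_deriv h f))"


section \<open>Pathwise solutions\<close>

text \<open>\<open>w\<close> is a fixed driving path and \<open>a\<close> its fixed array of iterated integrals; \<open>F i j\<close> is the
  coefficient of \<open>dw^j\<close> in the equation for \<open>y^i\<close>. The control \<open>v\<close> is strictly increasing, so that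
  the value \<open>\<theta> 0\<close>, about which \<open>\<theta>(\<delta>) = o(\<delta>)\<close> says nothing, is never used.\<close>

definition is_path_solution ::
  "(real \<Rightarrow> real ^ 'd::finite) \<Rightarrow> ('d \<Rightarrow> 'd \<Rightarrow> real \<Rightarrow> real \<Rightarrow> real) \<Rightarrow>
   ('n::finite \<Rightarrow> 'd \<Rightarrow> real ^ 'n \<Rightarrow> real) \<Rightarrow> real \<Rightarrow> real ^ 'n \<Rightarrow> (real \<Rightarrow> real ^ 'n) \<Rightarrow> bool" where
  "is_path_solution w a F T y0 y \<longleftrightarrow>
     y 0 = y0 \<and>
     (\<exists>v \<theta> :: real \<Rightarrow> real.
        continuous_on {0..T} v \<and> strict_mono_on {0..T} v \<and>
        (\<forall>\<delta>\<ge>0. 0 \<le> \<theta> \<delta>) \<and> \<theta> \<in> o[at_right 0](\<lambda>\<delta>. \<delta>) \<and>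
        (\<forall>i s t. 0 \<le> s \<and> s < t \<and> t \<le> T \<longrightarrow>
           \<bar>y t $ i - y s $ i - (\<Sum>j\<in>UNIV. F i j (y s) * (w t $ j - w s $ j))
             - (\<Sum>h\<in>UNIV. \<Sum>r\<in>UNIV. \<Sum>j\<in>UNIV.
                  F h r (y s) * partial_deriv h (F i j) (y s) * a r j s t)\<bar>
           \<le> \<theta> (v t - v s)))"

text \<open>In the index type \<^typ>\<open>6\<close> the numerals \<open>1, \<dots>, 6\<close> name the six distinct elements
  (with \<open>6 = 0\<close>), so the coordinates keep their usual labels.\<close>

definition last_coord_system :: "(real ^ 6 \<Rightarrow> real) \<Rightarrow> 6 \<Rightarrow> 6 \<Rightarrow> real ^ 6 \<Rightarrow> real" where
  "last_coord_system f i j = (\<lambda>x. if i \<noteq> j then 0 else if i = 6 then f x else 1)"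

end

theory Submission
  imports Defs
begin

text \<open>
  The solutions are \<open>y = (W\<^sup>1, \<dots>, W\<^sup>5, Y)\<close> with \<open>Y = \<integral>u dW\<^sup>6\<close> for a Lipschitz function \<open>u\<close> of
  time, and \<open>f\<close> is chosen afterwards with \<open>f = u\<close> and \<open>\<nabla>f = 0\<close> along \<open>y\<close>. Then the second-order
  terms \<open>A\<close> disappear and \<open>Y t - Y s - u s (W\<^sup>6 t - W\<^sup>6 s) = \<integral>_s^t u' r (W\<^sup>6 t - W\<^sup>6 r) dr\<close> is
  \<open>O((t - s)\<^sup>1\<^sup>+\<^sup>q)\<close>. By Whitney's theorem such an \<open>f\<close> exists if \<open>u\<close>, as a function of the point \<open>y\<close>,
  is Hoelder of an exponent \<open>\<alpha>\<close> slightly below \<open>2\<close>.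

  Along one path this holds when \<open>u' = 0\<close> off the set \<open>K\<close> of times that lie in no interval \<open>(s, t)\<close>
  with \<open>W\<close> unusually close at \<open>s\<close> and \<open>t\<close> in the first five coordinates: either \<open>u s = u t\<close>, or
  \<open>|u t - u s| \<le> t - s \<le> |y t - y s|^\<alpha>\<close>. In five dimensions \<open>K\<close> has almost full measure near a given
  time. Relative to the solution \<open>Y = 0\<close> the condition is \<open>|u| \<le> Y^\<alpha>\<close>, and \<open>Y\<close> can grow from \<open>0\<close>
  under it: let \<open>u\<close> be a bump on each of many small cells, with the sign of the increment of \<open>W\<^sup>6\<close> over
  the cell. Infinitely many solutions arise by branching off from \<open>0\<close> at the times \<open>1 - 2^-m\<close>, each
  branch staying well below the final heights of the earlier ones.
\<close>

section \<open>Whitney extension of jets with vanishing gradient\<close>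

text \<open>The first five coordinates act as a clock: apart from unusually close pairs they tell
  the time, which turns a function of time into a function of position. Both halves of the argument
  have exponent 2 as their threshold. Closeness means \<open>(t - s) powr (1/2 + \<delta>)\<close>,
  and such pairs are rare only because \<delta> > 0, that is
  \<open>\<alpha> = 1 / (1/2 + \<delta>) < 2\<close>. In the climb, one bump of height about
  \<open>h\<close> on a cell of length \<open>h\<close> gains only about
  \<open>h powr (3/2)\<close>, far too little for
  \<open>\<bar>u\<bar> \<le> Y powr \<alpha>\<close>. With signs adapted to each cell, however,
  gains add up like absolute increments of the sixth coordinate: about \<open>1/h\<close> cells give
  a height of order \<open>sqrt h\<close>, so \<open>u\<close> is comparable with the square of
  \<open>Y\<close>. Every loss (shorter bumps, small increments, bad cells, shrinking windows) costs
  a fixed power of \<open>2 powr (- n)\<close> not depending on \<open>A\<close>, while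
  \<open>h = (1/2) ^ (2 * A * n)\<close>; hence a large \<open>A\<close> reaches any \<alpha> < 2. A
  climb from 0 has no first cell: windows accumulate at its start, and each uses the height won in
  the windows before it.\<close>

definition ramp :: "real \<Rightarrow> real" where
  "ramp x = 2 * (max 0 x)\<^sup>2 - 4 * (max 0 (x - 1/2))\<^sup>2 + 2 * (max 0 (x - 1))\<^sup>2"

definition ramp' :: "real \<Rightarrow> real" where
  "ramp' x = 4 * max 0 x - 8 * max 0 (x - 1/2) + 4 * max 0 (x - 1)"

text \<open>\<open>ramp\<close> is the piecewise quadratic C^1 step from 0 to 1 across [0, 1] with
  knots 0, 1/2 and 1, in truncated powers. The bump built from it lives on [-1, 1] and has a
  Lipschitz derivative, which is all the smoothness that a derivative of Hoelder exponent below 1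
  requires.\<close>

definition bump :: "real \<Rightarrow> real" where
  "bump x = ramp (x + 1) - ramp x"

definition bump' :: "real \<Rightarrow> real" where
  "bump' x = ramp' (x + 1) - ramp' x"

lemma has_real_derivative_pos_part_square:
  "((\<lambda>x::real. (max 0 x)\<^sup>2) has_real_derivative 2 * max 0 x) (at x)"
proof -
  consider "x > 0" | "x < 0" | "x = 0" by linarith
  then show ?thesis
  proof cases
    case 1
    have "((\<lambda>x::real. x\<^sup>2) has_real_derivative 2 * max 0 x) (at x)"
      using 1 by (auto intro!: derivative_eq_intros)
    moreover have "\<forall>\<^sub>F y in nhds x. (max 0 y)\<^sup>2 = y\<^sup>2"
      using eventually_nhds_in_open[of "{0<..}" x] 1 by (auto elim!: eventually_mono)
    ultimately show ?thesis by (subst DERIV_cong_ev[OF refl _ refl]) auto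
  next
    case 2
    have "((\<lambda>x::real. 0) has_real_derivative 2 * max 0 x) (at x)"
      using 2 by (auto intro!: derivative_eq_intros)
    moreover have "\<forall>\<^sub>F y in nhds x. (max 0 y)\<^sup>2 = 0"
      using eventually_nhds_in_open[of "{..<0}" x] 2 by (auto elim!: eventually_mono)
    ultimately show ?thesis by (subst DERIV_cong_ev[OF refl _ refl]) auto
  next
    case 3
    have "((\<lambda>h::real. (max 0 h)\<^sup>2 / h) \<longlongrightarrow> 0) (at 0)"
    proof (rule Lim_null_comparison)
      show "\<forall>\<^sub>F h in at 0. norm ((max 0 h)\<^sup>2 / h) \<le> \<bar>h::real\<bar>"
        by (intro always_eventually) (auto simp: max_def power2_eq_square)
      show "((\<lambda>h::real. \<bar>h\<bar>) \<longlongrightarrow> 0) (at 0)"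
        by (rule tendsto_eq_intros refl | simp)+
    qed
    then show ?thesis using 3 by (simp add: DERIV_def)
  qed
qed

lemma ramp_deriv: "(ramp has_real_derivative ramp' x) (at x)"
proof -
  note D = DERIV_chain2[OF has_real_derivative_pos_part_square]
  show ?thesis
    unfolding ramp_def[abs_def] ramp'_def
    by (rule derivative_eq_intros D refl | simp)+
qed

lemma ramp_eq_0: "x \<le> 0 \<Longrightarrow> ramp x = 0" and ramp'_eq_0: "x \<le> 0 \<Longrightarrow> ramp' x = 0"
  by (auto simp: ramp_def ramp'_def max_def)

lemma ramp_eq_1: "x \<ge> 1 \<Longrightarrow> ramp x = 1" and ramp'_eq_0': "x \<ge> 1 \<Longrightarrow> ramp' x = 0"
  by (auto simp: ramp_def ramp'_def max_def power2_eq_square algebra_simps)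

lemma ramp_bounds: "0 \<le> ramp x \<and> ramp x \<le> 1"
proof -
  consider "x \<le> 0" | "1 \<le> x" | "0 \<le> x" "x \<le> 1/2" | "1/2 \<le> x" "x \<le> 1" by linarith
  then show ?thesis
  proof cases
    case 3
    then have "ramp x = 2 * x\<^sup>2" by (auto simp: ramp_def max_def)
    moreover have "x\<^sup>2 \<le> (1/2)\<^sup>2" using 3 by (intro power_mono) auto
    ultimately show ?thesis by (auto simp: power2_eq_square)
  next
    case 4
    then have "ramp x = 1 - 2 * (1 - x)\<^sup>2"
      by (auto simp: ramp_def max_def power2_eq_square algebra_simps)
    moreover have "(1 - x)\<^sup>2 \<le> (1/2)\<^sup>2" using 4 by (intro power_mono) auto
    moreover have "0 \<le> (1 - x)\<^sup>2" by simp
    ultimately show ?thesis unfolding power2_eq_square by linarith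
  qed (auto simp: ramp_eq_0 ramp_eq_1)
qed

lemma ramp'_bounds: "0 \<le> ramp' x \<and> ramp' x \<le> 2"
  by (auto simp: ramp'_def max_def)

lemma ramp'_lipschitz: "\<bar>ramp' x - ramp' y\<bar> \<le> 16 * \<bar>x - y\<bar>"
  by (auto simp: ramp'_def max_def abs_if)

lemma bump_deriv: "(bump has_real_derivative bump' x) (at x)"
proof -
  have "((\<lambda>x. ramp (x + 1)) has_real_derivative ramp' (x + 1) * 1) (at x)"
    by (rule DERIV_chain2[OF ramp_deriv]) (auto intro!: derivative_eq_intros)
  then show ?thesis
    unfolding bump_def[abs_def] bump'_def by (intro DERIV_diff ramp_deriv) simp
qed

lemma bump_eq_0: "1 \<le> \<bar>x\<bar> \<Longrightarrow> bump x = 0" and bump'_eq_0: "1 \<le> \<bar>x\<bar> \<Longrightarrow> bump' x = 0"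
  by (cases "x \<ge> 0"; auto simp: bump_def bump'_def ramp_eq_0 ramp_eq_1 ramp'_eq_0 ramp'_eq_0')+

lemma bump_abs_le: "\<bar>bump x\<bar> \<le> 1"
  using ramp_bounds[of x] ramp_bounds[of "x + 1"] by (auto simp: bump_def)

lemma bump'_abs_le: "\<bar>bump' x\<bar> \<le> 2"
  using ramp'_bounds[of x] ramp'_bounds[of "x + 1"] by (auto simp: bump'_def)

lemma bump'_lipschitz: "\<bar>bump' x - bump' y\<bar> \<le> 32 * \<bar>x - y\<bar>"
  using ramp'_lipschitz[of x y] ramp'_lipschitz[of "x + 1" "y + 1"] by (auto simp: bump'_def)

lemma lipschitz_of_deriv_bound:
  fixes f :: "real \<Rightarrow> real"
  assumes "\<And>x. (f has_real_derivative f' x) (at x)" "\<And>x. \<bar>f' x\<bar> \<le> C"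
  shows "\<bar>f x - f y\<bar> \<le> C * \<bar>x - y\<bar>"
  using field_differentiable_bound[of UNIV f f' C x y] assms by auto

lemma bump_lipschitz: "\<bar>bump x - bump y\<bar> \<le> 2 * \<bar>x - y\<bar>"
  by (rule lipschitz_of_deriv_bound[OF bump_deriv bump'_abs_le])

text \<open>The ramps telescope, because \<open>bump (x - k) = ramp (x - k + 1) - ramp (x - k)\<close>.\<close>

lemma bump_partition_of_unity: "(\<Sum>k\<in>{\<lfloor>x\<rfloor>, \<lfloor>x\<rfloor> + 1}. bump (x - of_int k)) = 1"
proof -
  have "(\<Sum>k\<in>{\<lfloor>x\<rfloor>, \<lfloor>x\<rfloor> + 1}. bump (x - of_int k)) =
      ramp (x - of_int \<lfloor>x\<rfloor> + 1) - ramp (x - of_int \<lfloor>x\<rfloor> - 1)"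
    by (simp add: bump_def algebra_simps)
  also have "\<dots> = 1"
    by (subst ramp_eq_1, linarith, subst ramp_eq_0, linarith, simp)
  finally show ?thesis .
qed

text \<open>Telescoping between two lattice scales produces products of a fine bump with a coarse
  one, since each of the two sums in the difference is multiplied by the other partition of unity.
  Here \<open>s\<close> is measured in units of the finer scale, hence \<open>s / 2\<close>.\<close>

definition bump2 :: "int \<Rightarrow> int \<Rightarrow> real \<Rightarrow> real" where
  "bump2 z w s = bump (s - of_int z) * bump (s / 2 - of_int w)"

definition bump2' :: "int \<Rightarrow> int \<Rightarrow> real \<Rightarrow> real" where
  "bump2' z w s = bump' (s - of_int z) * bump (s / 2 - of_int w)
     + bump (s - of_int z) * bump' (s / 2 - of_int w) / 2"

lemma bump2_deriv: "(bump2 z w has_real_derivative bump2' z w s) (at s)"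
proof -
  have 1: "((\<lambda>s. bump (s - of_int z)) has_real_derivative bump' (s - of_int z) * 1) (at s)"
    by (rule DERIV_chain2[OF bump_deriv]) (auto intro!: derivative_eq_intros)
  have 2: "((\<lambda>s. bump (s / 2 - of_int w)) has_real_derivative bump' (s / 2 - of_int w) * (1/2)) (at s)"
    by (rule DERIV_chain2[OF bump_deriv]) (auto intro!: derivative_eq_intros)
  show ?thesis
    unfolding bump2_def[abs_def] bump2'_def using DERIV_mult[OF 1 2] by (simp add: algebra_simps)
qed

lemma bump2_abs_le: "\<bar>bump2 z w s\<bar> \<le> 1"
  unfolding bump2_def abs_mult using mult_mono[OF bump_abs_le bump_abs_le] by simp

lemma bump2'_abs_le: "\<bar>bump2' z w s\<bar> \<le> 3"
proof -
  have "\<bar>bump' (s - of_int z) * bump (s / 2 - of_int w)\<bar> \<le> 2 * 1"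
    unfolding abs_mult by (intro mult_mono bump_abs_le bump'_abs_le) auto
  moreover have "\<bar>bump (s - of_int z) * bump' (s / 2 - of_int w)\<bar> \<le> 1 * 2"
    unfolding abs_mult by (intro mult_mono bump_abs_le bump'_abs_le) auto
  ultimately show ?thesis unfolding bump2'_def by linarith
qed

lemma bump2_lipschitz: "\<bar>bump2 z w s - bump2 z w t\<bar> \<le> 3 * \<bar>s - t\<bar>"
  by (rule lipschitz_of_deriv_bound[OF bump2_deriv bump2'_abs_le])

lemma abs_mult_diff_le:
  fixes a b c d :: real
  assumes "\<bar>a - c\<bar> \<le> A" "\<bar>b\<bar> \<le> B" "\<bar>c\<bar> \<le> C" "\<bar>b - d\<bar> \<le> D"
  shows "\<bar>a * b - c * d\<bar> \<le> A * B + C * D"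
proof -
  have "a * b - c * d = (a - c) * b + c * (b - d)" by (simp add: algebra_simps)
  moreover have "\<bar>(a - c) * b\<bar> \<le> A * B" "\<bar>c * (b - d)\<bar> \<le> C * D"
    unfolding abs_mult using assms by (auto intro!: mult_mono)
  ultimately show ?thesis by linarith
qed

lemma bump2'_lipschitz: "\<bar>bump2' z w s - bump2' z w t\<bar> \<le> 64 * \<bar>s - t\<bar>"
proof -
  have half: "\<bar>s / 2 - t / 2\<bar> = \<bar>s - t\<bar> / 2" by (simp add: abs_if field_simps)
  have "\<bar>bump' (s - of_int z) * bump (s / 2 - of_int w)
      - bump' (t - of_int z) * bump (t / 2 - of_int w)\<bar> \<le> (32 * \<bar>s - t\<bar>) * 1 + 2 * \<bar>s - t\<bar>"
    using bump'_lipschitz[of "s - of_int z" "t - of_int z"]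
      bump_lipschitz[of "s / 2 - of_int w" "t / 2 - of_int w"]
    by (intro abs_mult_diff_le bump_abs_le bump'_abs_le) (auto simp: half)
  moreover have "\<bar>bump (s - of_int z) * bump' (s / 2 - of_int w)
      - bump (t - of_int z) * bump' (t / 2 - of_int w)\<bar> \<le> (2 * \<bar>s - t\<bar>) * 2 + 1 * (16 * \<bar>s - t\<bar>)"
    using bump_lipschitz[of "s - of_int z" "t - of_int z"]
      bump'_lipschitz[of "s / 2 - of_int w" "t / 2 - of_int w"]
    by (intro abs_mult_diff_le bump_abs_le bump'_abs_le) (auto simp: half)
  ultimately show ?thesis unfolding bump2'_def by linarith
qed

lemma bump2_eq_0:
  assumes "1 \<le> \<bar>s - of_int z\<bar> \<or> 1 \<le> \<bar>s / 2 - of_int w\<bar>"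
  shows "bump2 z w s = 0" "bump2' z w s = 0"
  using assms by (auto simp: bump2_def bump2'_def bump_eq_0 bump'_eq_0)

lemma abs_sum_le_of_support:
  fixes g :: "'a \<Rightarrow> real"
  assumes "finite S" "finite T" "real (card T) \<le> N" "0 \<le> M"
    and "\<And>s. s \<in> S \<Longrightarrow> s \<notin> T \<Longrightarrow> g s = 0" "\<And>s. s \<in> S \<Longrightarrow> \<bar>g s\<bar> \<le> M"
  shows "\<bar>\<Sum>s\<in>S. g s\<bar> \<le> N * M"
proof -
  have "(\<Sum>s\<in>S. g s) = (\<Sum>s\<in>S \<inter> T. g s)"
    using assms by (intro sum.mono_neutral_right) auto
  also have "\<bar>\<dots>\<bar> \<le> (\<Sum>s\<in>S \<inter> T. \<bar>g s\<bar>)" by (rule sum_abs)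
  also have "\<dots> \<le> (\<Sum>s\<in>S \<inter> T. M)" using assms by (intro sum_mono) auto
  also have "\<dots> = real (card (S \<inter> T)) * M" by simp
  also have "\<dots> \<le> real (card T) * M"
    using assms by (intro mult_right_mono) (auto intro: card_mono)
  also have "\<dots> \<le> N * M" using assms by (intro mult_right_mono)
  finally show ?thesis .
qed

lemma le_powr_interpolate:
  fixes x a b \<tau> :: real
  assumes "0 \<le> x" "x \<le> a" "x \<le> b" "0 \<le> \<tau>" "\<tau> \<le> 1"
  shows "x \<le> a powr (1 - \<tau>) * b powr \<tau>"
proof (cases "x = 0")
  case False
  then have "x = x powr (1 - \<tau>) * x powr \<tau>" using assms by (simp add: powr_add[symmetric])
  also have "\<dots> \<le> a powr (1 - \<tau>) * b powr \<tau>"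
    using assms by (intro mult_mono powr_mono2) auto
  finally show ?thesis .
qed auto

section \<open>Dyadic lattices and their partitions of unity\<close>

lemma finite_lattice_box:
  "finite {z :: 'n::finite \<Rightarrow> int. \<forall>k. z k \<in> A k}" if "\<And>k. finite (A k)"
proof -
  have "{z. \<forall>k. z k \<in> A k} = Pi\<^sub>E UNIV A" by auto
  then show ?thesis using that by (simp add: finite_PiE)
qed

text \<open>The corners of the mesh cell containing \<open>x\<close>, the only lattice points whose
  bump can be nonzero there. The form \<open>Pi\<^sub>E UNIV\<close> is what exchanging product and
  sum and counting the elements require.\<close>

definition lattice_nbrs :: "nat \<Rightarrow> real ^ 'n \<Rightarrow> ('n::finite \<Rightarrow> int) set" where
  "lattice_nbrs n x = Pi\<^sub>E UNIV (\<lambda>k. {\<lfloor>2 ^ n * x $ k\<rfloor>, \<lfloor>2 ^ n * x $ k\<rfloor> + 1})"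

lemma finite_lattice_nbrs [simp]: "finite (lattice_nbrs n x)"
  by (simp add: lattice_nbrs_def finite_PiE)

lemma card_lattice_nbrs: "card (lattice_nbrs n (x :: real ^ 'n)) = 2 ^ CARD('n::finite)"
  by (simp add: lattice_nbrs_def card_PiE numeral_2_eq_2)

lemma lattice_nbrs_iff:
  "z \<in> lattice_nbrs n x \<longleftrightarrow> (\<forall>k. z k = \<lfloor>2 ^ n * x $ k\<rfloor> \<or> z k = \<lfloor>2 ^ n * x $ k\<rfloor> + 1)"
  by (auto simp: lattice_nbrs_def PiE_iff)

lemma lattice_nbrs_dist: "z \<in> lattice_nbrs n x \<Longrightarrow> \<bar>2 ^ n * x $ k - of_int (z k)\<bar> \<le> 1"
  unfolding lattice_nbrs_iff by (drule spec[of _ k]) (auto simp: abs_if; linarith)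

lemma not_lattice_nbrs: "z \<notin> lattice_nbrs n x \<Longrightarrow> \<exists>k. 1 \<le> \<bar>2 ^ n * x $ k - of_int (z k)\<bar>"
proof -
  assume "z \<notin> lattice_nbrs n x"
  then obtain k where k: "z k \<noteq> \<lfloor>2 ^ n * x $ k\<rfloor>" "z k \<noteq> \<lfloor>2 ^ n * x $ k\<rfloor> + 1"
    by (auto simp: lattice_nbrs_iff)
  then consider "z k \<le> \<lfloor>2 ^ n * x $ k\<rfloor> - 1" | "z k \<ge> \<lfloor>2 ^ n * x $ k\<rfloor> + 2" by linarith
  then have "1 \<le> \<bar>2 ^ n * x $ k - of_int (z k)\<bar>"
  proof cases
    case 1
    then have "real_of_int (z k) \<le> 2 ^ n * x $ k - 1" by linarith
    then show ?thesis by linarith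
  next
    case 2
    then have "real_of_int (z k) \<ge> 2 ^ n * x $ k + 1" by linarith
    then show ?thesis by linarith
  qed
  then show ?thesis by blast
qed

definition lattice_bump :: "nat \<Rightarrow> ('n::finite \<Rightarrow> int) \<Rightarrow> real ^ 'n \<Rightarrow> real" where
  "lattice_bump n z x = (\<Prod>k\<in>UNIV. bump (2 ^ n * x $ k - of_int (z k)))"

lemma lattice_bump_partition_of_unity: "(\<Sum>z\<in>lattice_nbrs n x. lattice_bump n z x) = 1"
proof -
  have "(\<Sum>z\<in>lattice_nbrs n x. lattice_bump n z x)
      = (\<Prod>k\<in>UNIV. \<Sum>j\<in>{\<lfloor>2 ^ n * x $ k\<rfloor>, \<lfloor>2 ^ n * x $ k\<rfloor> + 1}. bump (2 ^ n * x $ k - of_int j))"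
    unfolding lattice_nbrs_def lattice_bump_def by (rule prod_sum_PiE[symmetric]) auto
  also have "\<dots> = 1" by (simp only: bump_partition_of_unity prod.neutral_const)
  finally show ?thesis .
qed

lemma abs_prod_le_1:
  fixes f :: "'a \<Rightarrow> real"
  assumes "\<And>k. k \<in> A \<Longrightarrow> \<bar>f k\<bar> \<le> 1"
  shows "\<bar>\<Prod>k\<in>A. f k\<bar> \<le> 1"
  unfolding abs_prod by (rule prod_le_1) (use assms in auto)

lemma lattice_bump_abs_le: "\<bar>lattice_bump n z x\<bar> \<le> 1"
  unfolding lattice_bump_def by (intro abs_prod_le_1 bump_abs_le)

definition atom :: "nat \<Rightarrow> ('n::finite \<Rightarrow> int) \<times> ('n \<Rightarrow> int) \<Rightarrow> real ^ 'n \<Rightarrow> real" where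
  "atom n s x = (\<Prod>k\<in>UNIV. bump2 (fst s k) (snd s k) (2 ^ Suc n * x $ k))"

definition atom' :: "nat \<Rightarrow> ('n::finite \<Rightarrow> int) \<times> ('n \<Rightarrow> int) \<Rightarrow> 'n \<Rightarrow> real ^ 'n \<Rightarrow> real" where
  "atom' n s h x = 2 ^ Suc n * bump2' (fst s h) (snd s h) (2 ^ Suc n * x $ h)
     * (\<Prod>k\<in>UNIV - {h}. bump2 (fst s k) (snd s k) (2 ^ Suc n * x $ k))"

definition atom_nbrs :: "nat \<Rightarrow> real ^ 'n \<Rightarrow> (('n::finite \<Rightarrow> int) \<times> ('n \<Rightarrow> int)) set" where
  "atom_nbrs n x = lattice_nbrs (Suc n) x \<times> lattice_nbrs n x"

lemma atom_eq: "atom n (z, w) x = lattice_bump (Suc n) z x * lattice_bump n w x"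
  by (simp add: atom_def lattice_bump_def bump2_def prod.distrib[symmetric])

lemma finite_atom_nbrs [simp]: "finite (atom_nbrs n x)"
  by (simp add: atom_nbrs_def)

lemma card_atom_nbrs: "card (atom_nbrs n (x :: real ^ 'n)) = 4 ^ CARD('n::finite)"
  by (simp add: atom_nbrs_def card_cartesian_product card_lattice_nbrs power_mult_distrib[symmetric])

lemma not_atom_nbrs:
  assumes "s \<notin> atom_nbrs n x"
  shows "\<exists>k. bump2 (fst s k) (snd s k) (2 ^ Suc n * x $ k) = 0
    \<and> bump2' (fst s k) (snd s k) (2 ^ Suc n * x $ k) = 0"
proof -
  have "fst s \<notin> lattice_nbrs (Suc n) x \<or> snd s \<notin> lattice_nbrs n x"
    using assms by (cases s) (auto simp: atom_nbrs_def)
  then obtain k where "1 \<le> \<bar>2 ^ Suc n * x $ k - of_int (fst s k)\<bar>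
      \<or> 1 \<le> \<bar>(2 ^ Suc n * x $ k) / 2 - of_int (snd s k)\<bar>"
    using not_lattice_nbrs[of "fst s" "Suc n" x] not_lattice_nbrs[of "snd s" n x] by auto
  then show ?thesis using bump2_eq_0 by blast
qed

lemma atom_eq_0: "s \<notin> atom_nbrs n x \<Longrightarrow> atom n s x = 0"
  using not_atom_nbrs[of s n x] unfolding atom_def by (intro prod_zero) auto

lemma atom'_eq_0:
  assumes "s \<notin> atom_nbrs n x"
  shows "atom' n s h x = 0"
proof -
  obtain k where k: "bump2 (fst s k) (snd s k) (2 ^ Suc n * x $ k) = 0"
    "bump2' (fst s k) (snd s k) (2 ^ Suc n * x $ k) = 0"
    using not_atom_nbrs[OF assms] by blast
  show ?thesis
  proof (cases "k = h")
    case False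
    then have "(\<Prod>k\<in>UNIV - {h}. bump2 (fst s k) (snd s k) (2 ^ Suc n * x $ k)) = 0"
      using k by (intro prod_zero) auto
    then show ?thesis by (simp only: atom'_def mult_zero_right)
  qed (use k in \<open>simp add: atom'_def\<close>)
qed

lemma atom_abs_le: "\<bar>atom n s x\<bar> \<le> 1"
  unfolding atom_def by (intro abs_prod_le_1 bump2_abs_le)

lemma atom'_abs_le: "\<bar>atom' n s h x\<bar> \<le> 6 * 2 ^ n"
proof -
  have "\<bar>atom' n s h x\<bar> \<le> (2 ^ Suc n * 3) * 1"
    unfolding atom'_def abs_mult
    by (intro mult_mono bump2'_abs_le abs_prod_le_1 bump2_abs_le) auto
  then show ?thesis by simp
qed

lemma atom'_lipschitz:
  fixes x y :: "real ^ 'n"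
  shows "\<bar>atom' n s h x - atom' n s h y\<bar> \<le> (256 + 36 * CARD('n::finite)) * 4 ^ n * dist x y"
proof -
  define \<phi> where "\<phi> k x = bump2 (fst s k) (snd s k) (2 ^ Suc n * x $ k)" for k and x :: "real ^ 'n"
  define \<phi>' where "\<phi>' x = bump2' (fst s h) (snd s h) (2 ^ Suc n * x $ h)" for x :: "real ^ 'n"
  have d: "\<bar>x $ k - y $ k\<bar> \<le> dist x y" for k
    using component_le_norm_cart[of "x - y" k] by (simp add: dist_norm)
  have d': "\<bar>2 ^ Suc n * x $ k - 2 ^ Suc n * y $ k\<bar> \<le> 2 ^ Suc n * dist x y" for k
  proof -
    have "\<bar>2 ^ Suc n * x $ k - 2 ^ Suc n * y $ k\<bar> = 2 ^ Suc n * \<bar>x $ k - y $ k\<bar>"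
      by (simp only: right_diff_distrib[symmetric] abs_mult) simp
    then show ?thesis using d[of k] by simp
  qed
  have "\<bar>(\<Prod>k\<in>UNIV - {h}. \<phi> k x) - (\<Prod>k\<in>UNIV - {h}. \<phi> k y)\<bar>
      \<le> (\<Sum>k\<in>UNIV - {h}. \<bar>\<phi> k x - \<phi> k y\<bar>)"
    using norm_prod_diff[of "UNIV - {h}" "\<lambda>k. \<phi> k x" "\<lambda>k. \<phi> k y"] bump2_abs_le
    by (auto simp: \<phi>_def)
  also have "\<dots> \<le> (\<Sum>k\<in>UNIV - {h}. 3 * (2 ^ Suc n * dist x y))"
    unfolding \<phi>_def by (intro sum_mono order.trans[OF bump2_lipschitz] mult_left_mono d') auto
  also have "\<dots> \<le> (\<Sum>k\<in>(UNIV::'n set). 3 * (2 ^ Suc n * dist x y))"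
    by (intro sum_mono2) auto
  also have "\<dots> = CARD('n) * (3 * (2 ^ Suc n * dist x y))" by simp
  finally have prod: "\<bar>(\<Prod>k\<in>UNIV - {h}. \<phi> k x) - (\<Prod>k\<in>UNIV - {h}. \<phi> k y)\<bar>
      \<le> CARD('n) * (3 * (2 ^ Suc n * dist x y))" .
  \<comment> \<open>Once \<open>2 ^ Suc n\<close> is multiplied in front, \<open>64\<close> becomes
    \<open>2 * 64 * 2 = 256\<close> and \<open>3 * 3\<close> becomes \<open>2 * 9 * 2 = 36\<close>,
    each times \<open>4 ^ n\<close>.\<close>
  have "\<bar>\<phi>' x * (\<Prod>k\<in>UNIV - {h}. \<phi> k x) - \<phi>' y * (\<Prod>k\<in>UNIV - {h}. \<phi> k y)\<bar>
      \<le> (64 * (2 ^ Suc n * dist x y)) * 1 + 3 * (CARD('n) * (3 * (2 ^ Suc n * dist x y)))"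
  proof (rule abs_mult_diff_le)
    show "\<bar>\<phi>' x - \<phi>' y\<bar> \<le> 64 * (2 ^ Suc n * dist x y)"
      unfolding \<phi>'_def by (intro order.trans[OF bump2'_lipschitz] mult_left_mono d') auto
    show "\<bar>prod (\<lambda>k. \<phi> k x) (UNIV - {h})\<bar> \<le> 1"
      unfolding \<phi>_def by (intro abs_prod_le_1 bump2_abs_le)
    show "\<bar>\<phi>' y\<bar> \<le> 3" unfolding \<phi>'_def by (rule bump2'_abs_le)
  qed (rule prod)
  then have "2 ^ Suc n * \<bar>\<phi>' x * (\<Prod>k\<in>UNIV - {h}. \<phi> k x) - \<phi>' y * (\<Prod>k\<in>UNIV - {h}. \<phi> k y)\<bar>
      \<le> 2 ^ Suc n * ((64 * (2 ^ Suc n * dist x y)) * 1 + 3 * (CARD('n) * (3 * (2 ^ Suc n * dist x y))))"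
    by (intro mult_left_mono) auto
  also have "\<dots> = (256 + 36 * CARD('n)) * 4 ^ n * dist x y"
  proof -
    have "(4::real) ^ n = 2 ^ n * 2 ^ n" by (simp add: power_mult_distrib[symmetric])
    then show ?thesis by (simp add: algebra_simps)
  qed
  also have "2 ^ Suc n * \<bar>\<phi>' x * (\<Prod>k\<in>UNIV - {h}. \<phi> k x) - \<phi>' y * (\<Prod>k\<in>UNIV - {h}. \<phi> k y)\<bar>
      = \<bar>atom' n s h x - atom' n s h y\<bar>"
  proof -
    have "atom' n s h x - atom' n s h y =
        2 ^ Suc n * (\<phi>' x * (\<Prod>k\<in>UNIV - {h}. \<phi> k x) - \<phi>' y * (\<Prod>k\<in>UNIV - {h}. \<phi> k y))"
      unfolding atom'_def \<phi>_def \<phi>'_def by (simp only: right_diff_distrib mult.assoc)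
    then show ?thesis by (simp add: abs_mult)
  qed
  finally show ?thesis .
qed

lemma atom_partial:
  "((\<lambda>t. atom n s (x + t *\<^sub>R axis h 1)) has_real_derivative atom' n s h (x + t *\<^sub>R axis h 1)) (at t)"
proof -
  define P where "P = (\<Prod>k\<in>UNIV - {h}. bump2 (fst s k) (snd s k) (2 ^ Suc n * x $ k))"
  have eq: "(\<Prod>k\<in>UNIV - {h}. bump2 (fst s k) (snd s k) (2 ^ Suc n * (x + t *\<^sub>R axis h 1) $ k)) = P" for t
    unfolding P_def by (intro prod.cong) (auto simp: axis_def)
  have f: "(\<lambda>t. atom n s (x + t *\<^sub>R axis h 1))
      = (\<lambda>t. bump2 (fst s h) (snd s h) (2 ^ Suc n * (x $ h + t)) * P)"
    unfolding atom_def by (subst prod.remove[of _ h]) (auto simp: P_def axis_def)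
  have f': "atom' n s h (x + t *\<^sub>R axis h 1)
      = (bump2' (fst s h) (snd s h) (2 ^ Suc n * (x $ h + t)) * 2 ^ Suc n) * P"
    unfolding atom'_def eq by (simp add: axis_def)
  show ?thesis unfolding f f'
    by (intro DERIV_cmult_right DERIV_chain2[OF bump2_deriv]) (auto intro!: derivative_eq_intros)
qed

section \<open>Extension of a flat jet by a series over dyadic scales\<close>

lemma dist_le_cart:
  fixes x y :: "real ^ 'n::finite" and e :: real
  assumes "\<And>k. \<bar>x $ k - y $ k\<bar> \<le> e"
  shows "dist x y \<le> CARD('n) * e"
proof -
  have "dist x y \<le> (\<Sum>k\<in>UNIV. \<bar>(x - y) $ k\<bar>)"
    unfolding dist_norm by (rule norm_le_l1_cart)
  also have "\<dots> \<le> (\<Sum>k\<in>(UNIV :: 'n set). e)" using assms by (intro sum_mono) auto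
  finally show ?thesis by simp
qed

lemma powr_divide_two_power:
  assumes "0 \<le> (x::real)"
  shows "(x / 2 ^ n) powr a = x powr a * (2 powr (-a)) ^ n"
proof -
  have "(2 ^ n :: real) powr a = 2 powr (n * a)" by (simp add: powr_realpow[symmetric] powr_powr)
  moreover have "(2 powr (- a) :: real) ^ n = 2 powr (- (n * a))" by (simp add: powr_power mult.commute)
  moreover have "(x / 2 ^ n) powr a = x powr a / (2 ^ n) powr a" using assms by (simp add: powr_divide)
  ultimately show ?thesis by (simp add: powr_minus divide_inverse del: powr_power)
qed

lemma abs_two_power_mult: "\<bar>2 ^ n * x\<bar> = 2 ^ n * \<bar>x :: real\<bar>"
  by (simp add: abs_mult)

text \<open>With all gradients zero and \<alpha> > 1, Whitney's compatibility conditions reduce to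
  \<open>F_holder\<close>. The points \<open>p i\<close> may coincide: at distance 0 the Hoelder
  bound gives \<open>F i = F j\<close>. This matters because the solutions share an initial
  piece.\<close>

locale flat_jet =
  fixes I :: "'i set" and p :: "'i \<Rightarrow> real ^ 'n::finite" and F :: "'i \<Rightarrow> real"
    and \<alpha> C R B :: real
  assumes \<alpha>: "1 < \<alpha>" "\<alpha> < 2" and C: "0 \<le> C" and B: "0 \<le> B"
    and p_bounded: "i \<in> I \<Longrightarrow> norm (p i) \<le> R"
    and F_bounded: "i \<in> I \<Longrightarrow> \<bar>F i\<bar> \<le> B"
    and F_holder: "i \<in> I \<Longrightarrow> j \<in> I \<Longrightarrow> \<bar>F i - F j\<bar> \<le> C * dist (p i) (p j) powr \<alpha>"
begin

definition r :: real where "r = 2 powr (- \<alpha>)"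

text \<open>\<open>2 * r < 1\<close> restates \<alpha> > 1 and makes the differentiated series
  converge; \<open>1 < 4 * r\<close> restates \<alpha> < 2 and says that the Lipschitz bounds for
  its terms grow.\<close>

lemma r: "0 < r" "2 * r < 1" "1 < 4 * r" "r < 1"
proof -
  have "2 * r = 2 powr (1 - \<alpha>)" by (simp add: r_def powr_diff powr_minus_divide)
  then show 1: "2 * r < 1" using \<alpha> powr_less_mono[of "1 - \<alpha>" 0 2] by simp
  have "4 * r = 2 powr 2 * 2 powr (-\<alpha>)" by (simp add: r_def)
  also have "\<dots> = 2 powr (2 - \<alpha>)" by (subst powr_add[symmetric]) simp
  finally show "1 < 4 * r" using \<alpha> powr_less_mono[of 0 "2 - \<alpha>" 2] by simp
  show "0 < r" by (simp add: r_def)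
  then show "r < 1" using 1 by linarith
qed

lemma F_diff_le:
  fixes e :: real
  assumes "i \<in> I" "j \<in> I" "0 \<le> e" "\<And>k. \<bar>p i $ k - p j $ k\<bar> \<le> e / 2 ^ n"
  shows "\<bar>F i - F j\<bar> \<le> C * (CARD('n) * e) powr \<alpha> * r ^ n"
proof -
  have "dist (p i) (p j) \<le> (CARD('n) * e) / 2 ^ n"
    using dist_le_cart[OF assms(4)] by simp
  then have "dist (p i) (p j) powr \<alpha> \<le> ((CARD('n) * e) / 2 ^ n) powr \<alpha>"
    using \<alpha> by (intro powr_mono2) auto
  also have "\<dots> = (CARD('n) * e) powr \<alpha> * r ^ n"
    unfolding r_def by (rule powr_divide_two_power) (use assms in auto)
  finally show ?thesis
    using F_holder[OF assms(1,2)] C mult_left_mono[of _ _ C] by (fastforce simp: mult.assoc)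
qed

text \<open>Radius 3 leaves room for the two unit errors that occur near the data, from
  \<open>p i\<close> to \<open>x\<close> and from \<open>x\<close> to a corner \<open>z\<close> of
  its mesh cell.\<close>

definition near :: "nat \<Rightarrow> ('n \<Rightarrow> int) \<Rightarrow> 'i set" where
  "near n z = {i \<in> I. \<forall>k. \<bar>2 ^ n * p i $ k - of_int (z k)\<bar> \<le> 3}"

definition rep :: "nat \<Rightarrow> ('n \<Rightarrow> int) \<Rightarrow> 'i" where
  "rep n z = (SOME i. i \<in> near n z)"

text \<open>Value 0 at level 0 lets the telescoping sum of the first \<open>n\<close> differences be
  the level-\<open>n\<close> approximation itself. The price is the summand \<open>B\<close> in
  \<open>K\<close>.\<close>

definition c :: "nat \<Rightarrow> ('n \<Rightarrow> int) \<Rightarrow> real" where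
  "c n z = (if n = 0 then 0 else F (rep n z))"

text \<open>Only pairs with data nearby at both scales are kept, since otherwise \<open>rep\<close>
  is arbitrary and the coefficient is not controlled. Overlapping bumps satisfy
  \<open>\<bar>z k - 2 * w k\<bar> \<le> 1 + 2\<close>, the coarse error being doubled.\<close>

definition S :: "nat \<Rightarrow> (('n \<Rightarrow> int) \<times> ('n \<Rightarrow> int)) set" where
  "S n = {(z, w). near (Suc n) z \<noteq> {} \<and> near n w \<noteq> {} \<and> (\<forall>k. \<bar>z k - 2 * w k\<bar> \<le> 3)}"

definition coef :: "nat \<Rightarrow> (('n \<Rightarrow> int) \<times> ('n \<Rightarrow> int)) \<Rightarrow> real" where
  "coef n s = c (Suc n) (fst s) - c n (snd s)"

text \<open>In place of Whitney cubes, the extension is a sum over scales: \<open>b n\<close> passes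
  from the approximation at level \<open>n\<close> to that at level \<open>Suc n\<close>, cut off
  away from the data.\<close>

definition b :: "nat \<Rightarrow> real ^ 'n \<Rightarrow> real" where
  "b n x = (\<Sum>s\<in>S n. coef n s * atom n s x)"

definition b' :: "nat \<Rightarrow> 'n \<Rightarrow> real ^ 'n \<Rightarrow> real" where
  "b' n h x = (\<Sum>s\<in>S n. coef n s * atom' n s h x)"

lemma rep_near: "near n z \<noteq> {} \<Longrightarrow> rep n z \<in> near n z"
  unfolding rep_def by (rule someI_ex) blast

lemma finite_near: "finite {z. near n z \<noteq> {}}"
proof (rule finite_subset)
  define m where "m = \<lceil>2 ^ n * R + 3\<rceil>"
  show "{z. near n z \<noteq> {}} \<subseteq> {z. \<forall>k. z k \<in> {- m..m}}"
  proof (intro subsetI CollectI allI)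
    fix z k assume "z \<in> {z. near n z \<noteq> {}}"
    then obtain i where "i \<in> near n z" by blast
    then have i: "i \<in> I" "\<bar>2 ^ n * p i $ k - of_int (z k)\<bar> \<le> 3" by (auto simp: near_def)
    have "\<bar>p i $ k\<bar> \<le> R" using component_le_norm_cart[of "p i" k] p_bounded[OF i(1)] by simp
    then have "\<bar>2 ^ n * p i $ k\<bar> \<le> 2 ^ n * R" by (simp add: abs_mult)
    then have "\<bar>real_of_int (z k)\<bar> \<le> 2 ^ n * R + 3" using i(2) by linarith
    also have "\<dots> \<le> of_int m" unfolding m_def by (rule le_of_int_ceiling)
    finally show "z k \<in> {- m..m}" by (simp add: abs_le_iff)
  qed
qed (rule finite_lattice_box, simp)

lemma finite_S: "finite (S n)"
  by (rule finite_subset[OF _ finite_cartesian_product[OF finite_near[of "Suc n"] finite_near[of n]]])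
    (auto simp: S_def)

definition K :: real where "K = B + C * (real CARD('n) * 6) powr \<alpha>"

lemma K: "0 \<le> K" using B C by (simp add: K_def)

lemma coef_le:
  assumes "s \<in> S n"
  shows "\<bar>coef n s\<bar> \<le> K * r ^ n"
proof -
  obtain z w where s: "s = (z, w)" by force
  define i where "i = rep (Suc n) z"
  define j where "j = rep n w"
  have zw: "\<bar>real_of_int (z k) - 2 * real_of_int (w k)\<bar> \<le> 3" for k
  proof -
    have "\<bar>z k - 2 * w k\<bar> \<le> 3" using assms by (auto simp: s S_def)
    then have "real_of_int \<bar>z k - 2 * w k\<bar> \<le> real_of_int 3" by (simp only: of_int_le_iff)
    then show ?thesis by simp
  qed
  have i: "i \<in> I" "\<And>k. \<bar>2 ^ Suc n * p i $ k - of_int (z k)\<bar> \<le> 3"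
    and j: "j \<in> I" "\<And>k. \<bar>2 ^ n * p j $ k - of_int (w k)\<bar> \<le> 3"
    using rep_near[of "Suc n" z] rep_near[of n w] assms
    by (auto simp: s S_def i_def j_def near_def)
  show ?thesis
  proof (cases n)
    case 0
    have "\<bar>coef n s\<bar> \<le> B" using F_bounded[OF i(1)] by (simp add: coef_def c_def s 0 i_def)
    then show ?thesis using C by (simp add: 0 K_def add_increasing2)
  next
    case (Suc m)
    have "\<bar>F i - F j\<bar> \<le> C * (real CARD('n) * 6) powr \<alpha> * r ^ n"
    proof (rule F_diff_le)
      fix k
      \<comment> \<open>In fine units \<open>12 = 3 + 3 + 6\<close>: from \<open>p i\<close> to
        \<open>z\<close>, from \<open>z\<close> to \<open>2 * w\<close>, and from
        \<open>2 * w\<close> to \<open>p j\<close>.\<close>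
      have "\<bar>2 ^ Suc n * (p i $ k - p j $ k)\<bar> \<le> 12"
        using i(2)[of k] j(2)[of k] zw[of k] by (simp add: algebra_simps abs_le_iff)
      then have "2 ^ Suc n * \<bar>p i $ k - p j $ k\<bar> \<le> 12" by (simp only: abs_two_power_mult)
      then show "\<bar>p i $ k - p j $ k\<bar> \<le> 6 / 2 ^ n" by (simp add: field_simps)
    qed (use i j in auto)
    also have "\<dots> \<le> K * r ^ n" using r B by (intro mult_right_mono) (auto simp: K_def)
    finally show ?thesis by (simp add: coef_def c_def s Suc i_def j_def)
  qed
qed

definition N :: real where "N = 2 * 4 ^ CARD('n)"

lemma abs_atom_sum_le:
  assumes "\<And>s. s \<in> S n \<Longrightarrow> s \<notin> atom_nbrs n x \<Longrightarrow> s \<notin> atom_nbrs n y \<Longrightarrow> g s = 0"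
    and "\<And>s. s \<in> S n \<Longrightarrow> \<bar>g s\<bar> \<le> M" "0 \<le> M"
  shows "\<bar>\<Sum>s\<in>S n. coef n s * g s\<bar> \<le> N * (K * r ^ n * M)"
proof (rule abs_sum_le_of_support)
  show "finite (atom_nbrs n x \<union> atom_nbrs n y)" by simp
  have "card (atom_nbrs n x \<union> atom_nbrs n y) \<le> 2 * 4 ^ CARD('n)"
    using card_Un_le[of "atom_nbrs n x" "atom_nbrs n y"] by (simp add: card_atom_nbrs)
  then have "real (card (atom_nbrs n x \<union> atom_nbrs n y)) \<le> real (2 * 4 ^ CARD('n))"
    by (simp only: of_nat_le_iff)
  then show "real (card (atom_nbrs n x \<union> atom_nbrs n y)) \<le> N"
    by (simp add: N_def)
  show "\<bar>coef n s * g s\<bar> \<le> K * r ^ n * M" if "s \<in> S n" for s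
    unfolding abs_mult using K r coef_le[OF that] assms(2)[OF that] by (intro mult_mono) auto
  show "0 \<le> K * r ^ n * M" using K r assms by auto
qed (use assms finite_S in auto)

lemma N: "0 \<le> N" by (simp add: N_def)

lemma b_abs_le: "\<bar>b n x\<bar> \<le> N * K * r ^ n"
  using abs_atom_sum_le[of n x x "\<lambda>s. atom n s x" 1] atom_abs_le[of n _ x]
  by (simp add: b_def atom_eq_0 mult.assoc)

lemma b'_abs_le: "\<bar>b' n h x\<bar> \<le> 6 * N * K * (2 * r) ^ n"
  using abs_atom_sum_le[of n x x "\<lambda>s. atom' n s h x" "6 * 2 ^ n"] atom'_abs_le[of n _ h x]
  by (simp add: b'_def atom'_eq_0 power_mult_distrib mult_ac)

definition L :: real where "L = 256 + 36 * CARD('n)"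

lemma b'_lipschitz: "\<bar>b' n h x - b' n h y\<bar> \<le> L * N * K * (4 * r) ^ n * dist x y"
proof -
  have "b' n h x - b' n h y = (\<Sum>s\<in>S n. coef n s * (atom' n s h x - atom' n s h y))"
    by (simp add: b'_def sum_subtractf right_diff_distrib)
  also have "\<bar>\<dots>\<bar> \<le> N * (K * r ^ n * (L * 4 ^ n * dist x y))"
    using atom'_lipschitz[of n _ h x y]
    by (intro abs_atom_sum_le[of n x y]) (auto simp: atom'_eq_0 L_def)
  finally show ?thesis by (simp add: power_mult_distrib mult_ac)
qed

lemma b_partial:
  "((\<lambda>t. b n (x + t *\<^sub>R axis h 1)) has_real_derivative b' n h (x + t *\<^sub>R axis h 1)) (at t)"
  unfolding b_def b'_def by (intro DERIV_sum DERIV_cmult atom_partial)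

definition f :: "real ^ 'n \<Rightarrow> real" where "f x = (\<Sum>n. b n x)"

lemma summable_b: "summable (\<lambda>n. b n x)"
  by (rule summable_comparison_test'[of "\<lambda>n. N * K * r ^ n"])
    (use r b_abs_le in \<open>auto intro!: summable_mult summable_geometric\<close>)

lemma summable_b'_bound: "summable (\<lambda>n. 6 * N * K * (2 * r) ^ n)"
  by (intro summable_mult summable_geometric) (use r in auto)

lemma summable_b': "summable (\<lambda>n. b' n h x)"
  by (rule summable_comparison_test'[OF summable_b'_bound]) (simp only: real_norm_def b'_abs_le)

lemma f_partial: "((\<lambda>t. f (x + t *\<^sub>R axis h 1)) has_real_derivative (\<Sum>n. b' n h x)) (at 0)"
proof -
  have "uniformly_convergent_on UNIV (\<lambda>n t. \<Sum>i<n. b' i h (x + t *\<^sub>R axis h 1))"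
    by (rule Weierstrass_m_test'[OF _ summable_b'_bound]) (simp only: real_norm_def b'_abs_le)
  from has_field_derivative_series'(2)[OF convex_UNIV _ this, of "\<lambda>n t. b n (x + t *\<^sub>R axis h 1)" 0 0]
  show ?thesis using b_partial summable_b by (simp add: f_def)
qed

lemma partial_deriv_f: "partial_deriv h f x = (\<Sum>n. b' n h x)"
  unfolding partial_deriv_def by (rule DERIV_imp_deriv[OF f_partial])

text \<open>Interpolating between the sup and the Lipschitz bound of each term costs an arbitrarily small
  part of the exponent but makes the series of differences summable without splitting it.\<close>

lemma holder_partial_deriv_f:
  assumes "0 < \<tau>" "\<tau> < \<alpha> - 1"
  shows "\<exists>H. \<forall>x y. \<bar>partial_deriv h f x - partial_deriv h f y\<bar> \<le> H * dist x y powr \<tau>"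
proof (intro exI allI)
  fix x y
  define D where "D = (12 + L) * N * K"
  define q where "q = (2 * r) powr (1 - \<tau>) * (4 * r) powr \<tau>"
  have D_eq: "D = 12 * N * K + L * N * K" by (simp add: D_def algebra_simps)
  have NK: "0 \<le> 12 * N * K" "0 \<le> L * N * K" using N K by (simp_all add: L_def)
  have D: "0 \<le> D" using NK D_eq by linarith
  have "q = (2 powr (1 - \<alpha>)) powr (1 - \<tau>) * (2 powr (2 - \<alpha>)) powr \<tau>"
  proof -
    have "2 * r = 2 powr (1 - \<alpha>)" by (simp add: r_def powr_diff powr_minus_divide)
    moreover have "4 * r = 2 powr (2 - \<alpha>)" by (simp add: r_def powr_diff powr_minus_divide)
    ultimately show ?thesis by (simp add: q_def)
  qed
  also have "\<dots> = 2 powr ((1 - \<alpha>) * (1 - \<tau>) + (2 - \<alpha>) * \<tau>)"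
    by (simp add: powr_powr powr_add)
  \<comment> \<open>The exponent is negative because \<open>\<tau> < \<alpha> - 1\<close>; this is
    the loss in the Hoelder exponent.\<close>
  also have "(1 - \<alpha>) * (1 - \<tau>) + (2 - \<alpha>) * \<tau> = \<tau> - (\<alpha> - 1)" by (simp add: algebra_simps)
  finally have q: "0 < q" "q < 1" using assms powr_less_mono[of "\<tau> - (\<alpha> - 1)" 0 2] by auto
  have term_le: "\<bar>b' n h x - b' n h y\<bar> \<le> D * dist x y powr \<tau> * q ^ n" for n
  proof -
    have "\<bar>b' n h x - b' n h y\<bar> \<le> 12 * N * K * (2 * r) ^ n"
      using b'_abs_le[of n h x] b'_abs_le[of n h y] by linarith
    also have "\<dots> \<le> D * (2 * r) ^ n"
      using NK D_eq r by (intro mult_right_mono) auto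
    finally have 1: "\<bar>b' n h x - b' n h y\<bar> \<le> D * (2 * r) ^ n" .
    have "\<bar>b' n h x - b' n h y\<bar> \<le> L * N * K * (4 * r) ^ n * dist x y" by (rule b'_lipschitz)
    also have "\<dots> \<le> D * (4 * r) ^ n * dist x y"
      using NK D_eq r by (intro mult_right_mono) auto
    finally have 2: "\<bar>b' n h x - b' n h y\<bar> \<le> D * ((4 * r) ^ n * dist x y)" by (simp add: mult.assoc)
    have "\<bar>b' n h x - b' n h y\<bar>
        \<le> (D * (2 * r) ^ n) powr (1 - \<tau>) * (D * ((4 * r) ^ n * dist x y)) powr \<tau>"
      using 1 2 assms \<alpha> by (intro le_powr_interpolate) auto
    also have "\<dots> = (D powr (1 - \<tau>) * D powr \<tau>) * dist x y powr \<tau>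
        * (((2 * r) ^ n) powr (1 - \<tau>) * ((4 * r) ^ n) powr \<tau>)"
      using D r by (simp add: powr_mult)
    also have "D powr (1 - \<tau>) * D powr \<tau> = D"
      using D by (cases "D = 0") (auto simp: powr_add[symmetric])
    also have "((2 * r) ^ n) powr (1 - \<tau>) * ((4 * r) ^ n) powr \<tau> = q ^ n"
    proof -
      have *: "(x ^ n) powr a = (x powr a) ^ n" if "0 < x" for x a :: real
        using that by (simp add: powr_realpow[symmetric] powr_powr mult.commute)
      have "((2 * r) ^ n) powr (1 - \<tau>) = ((2 * r) powr (1 - \<tau>)) ^ n"
        "((4 * r) ^ n) powr \<tau> = ((4 * r) powr \<tau>) ^ n" by (rule *; use r in simp)+
      then show ?thesis by (simp only: q_def power_mult_distrib[symmetric])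
    qed
    finally show ?thesis .
  qed
  have "\<bar>partial_deriv h f x - partial_deriv h f y\<bar> = \<bar>\<Sum>n. b' n h x - b' n h y\<bar>"
    by (simp add: partial_deriv_f suminf_diff[OF summable_b' summable_b'])
  also have "\<dots> \<le> (\<Sum>n. D * dist x y powr \<tau> * q ^ n)"
  proof -
    have s: "summable (\<lambda>n. D * dist x y powr \<tau> * q ^ n)"
      using q by (intro summable_mult summable_geometric) auto
    then have s': "summable (\<lambda>n. \<bar>b' n h x - b' n h y\<bar>)"
      using term_le by (intro summable_comparison_test'[OF s]) auto
    have "\<bar>\<Sum>n. b' n h x - b' n h y\<bar> \<le> (\<Sum>n. \<bar>b' n h x - b' n h y\<bar>)"
      by (rule summable_rabs[OF s'])
    also have "\<dots> \<le> (\<Sum>n. D * dist x y powr \<tau> * q ^ n)"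
      by (rule suminf_le[OF term_le s' s])
    finally show ?thesis .
  qed
  also have "\<dots> = D * dist x y powr \<tau> * (1 / (1 - q))"
    using q by (subst suminf_mult) (auto intro!: summable_geometric simp: suminf_geometric)
  finally show "\<bar>partial_deriv h f x - partial_deriv h f y\<bar>
      \<le> ((12 + L) * N * K * (1 / (1 - (2 * r) powr (1 - \<tau>) * (4 * r) powr \<tau>))) * dist x y powr \<tau>"
    by (simp add: D_def q_def mult_ac)
qed

lemma b_nonzero_bounded:
  assumes "b n x \<noteq> 0"
  shows "\<bar>x $ k\<bar> \<le> R + 4"
proof -
  obtain s where s: "s \<in> S n" "atom n s x \<noteq> 0"
    using assms unfolding b_def by (force elim: sum.not_neutral_contains_not_neutral)
  then have "fst s \<in> lattice_nbrs (Suc n) x"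
    using atom_eq_0 by (fastforce simp: atom_nbrs_def mem_Times_iff)
  then have 1: "\<bar>2 ^ Suc n * x $ k - of_int (fst s k)\<bar> \<le> 1" by (rule lattice_nbrs_dist)
  obtain i where "i \<in> near (Suc n) (fst s)" using s by (auto simp: S_def)
  then have i: "i \<in> I" "\<bar>2 ^ Suc n * p i $ k - of_int (fst s k)\<bar> \<le> 3" by (auto simp: near_def)
  have "\<bar>2 ^ Suc n * (x $ k - p i $ k)\<bar> \<le> 4"
    using 1 i(2) unfolding right_diff_distrib by linarith
  then have "2 ^ Suc n * \<bar>x $ k - p i $ k\<bar> \<le> 4" by (simp only: abs_two_power_mult)
  moreover have "1 * \<bar>x $ k - p i $ k\<bar> \<le> 2 ^ Suc n * \<bar>x $ k - p i $ k\<bar>"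
    by (intro mult_right_mono one_le_power) auto
  ultimately have "\<bar>x $ k - p i $ k\<bar> \<le> 4" by (simp only: mult_1_left)
  moreover have "\<bar>p i $ k\<bar> \<le> R" using component_le_norm_cart[of "p i" k] p_bounded[OF i(1)] by simp
  ultimately show ?thesis by linarith
qed

lemma compact_support_f: "compact (closure {x. f x \<noteq> 0})"
proof -
  have "{x. f x \<noteq> 0} \<subseteq> cball 0 (CARD('n) * (R + 4))"
  proof
    fix x assume "x \<in> {x. f x \<noteq> 0}"
    then obtain n where "b n x \<noteq> 0" by (force simp: f_def)
    then have "dist 0 x \<le> CARD('n) * (R + 4)"
      by (intro dist_le_cart) (auto dest: b_nonzero_bounded)
    then show "x \<in> cball 0 (CARD('n) * (R + 4))" by simp
  qed
  then show ?thesis using bounded_subset[OF bounded_cball] by (simp add: bounded_closure compact_closure)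
qed

text \<open>Near the data all the lattice points that matter are \<open>near\<close>, so the partial sums telescope.\<close>

lemma sum_b_telescope:
  assumes "i \<in> I" "\<And>k. 2 ^ n * \<bar>x $ k - p i $ k\<bar> \<le> 1"
  shows "(\<Sum>m<n. b m x) = (\<Sum>z\<in>lattice_nbrs n x. c n z * lattice_bump n z x)"
  using assms(2)
proof (induction n)
  case 0
  then show ?case by (simp add: c_def)
next
  case (Suc n)
  have le: "2 ^ n * \<bar>x $ k - p i $ k\<bar> \<le> 1" for k
  proof -
    have "2 ^ n * \<bar>x $ k - p i $ k\<bar> \<le> 2 ^ Suc n * \<bar>x $ k - p i $ k\<bar>"
      by (intro mult_right_mono) auto
    then show ?thesis using Suc.prems[of k] by linarith
  qed
  have nr: "i \<in> near m z" if "z \<in> lattice_nbrs m x" "\<And>k. 2 ^ m * \<bar>x $ k - p i $ k\<bar> \<le> 1" for m z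
  proof -
    have "\<bar>2 ^ m * p i $ k - of_int (z k)\<bar> \<le> 3" for k
    proof -
      have "\<bar>2 ^ m * (x $ k - p i $ k)\<bar> \<le> 1" using that(2)[of k] by (simp add: abs_mult)
      then show ?thesis using lattice_nbrs_dist[OF that(1), of k]
        unfolding right_diff_distrib by linarith
    qed
    then show ?thesis using assms(1) by (simp add: near_def)
  qed
  let ?T = "lattice_nbrs (Suc n) x" and ?U = "lattice_nbrs n x"
  have sub: "atom_nbrs n x \<subseteq> S n"
  proof
    fix s assume s: "s \<in> atom_nbrs n x"
    then obtain z w where zw: "s = (z, w)" "z \<in> ?T" "w \<in> ?U" by (auto simp: atom_nbrs_def)
    have "\<bar>z k - 2 * w k\<bar> \<le> 3" for k
    proof -
      have "\<bar>2 ^ Suc n * x $ k - of_int (z k)\<bar> \<le> 1" "\<bar>2 ^ n * x $ k - of_int (w k)\<bar> \<le> 1"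
        using zw lattice_nbrs_dist by blast+
      then have "\<bar>real_of_int (z k - 2 * w k)\<bar> \<le> 3" by simp
      then show ?thesis by linarith
    qed
    moreover have "near (Suc n) z \<noteq> {}" "near n w \<noteq> {}"
      using nr[OF zw(2) Suc.prems] nr[OF zw(3) le] by auto
    ultimately show "s \<in> S n" by (simp add: zw S_def)
  qed
  have "b n x = (\<Sum>s\<in>atom_nbrs n x. coef n s * atom n s x)"
    unfolding b_def using sub finite_S by (intro sum.mono_neutral_right) (auto simp: atom_eq_0)
  also have "\<dots> = (\<Sum>z\<in>?T. \<Sum>w\<in>?U. (c (Suc n) z - c n w) * (lattice_bump (Suc n) z x * lattice_bump n w x))"
    unfolding atom_nbrs_def sum.cartesian_product by (intro sum.cong) (auto simp: coef_def atom_eq)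
  also have "\<dots> = (\<Sum>z\<in>?T. \<Sum>w\<in>?U. c (Suc n) z * lattice_bump (Suc n) z x * lattice_bump n w x)
      - (\<Sum>z\<in>?T. \<Sum>w\<in>?U. lattice_bump (Suc n) z x * (c n w * lattice_bump n w x))"
    by (simp add: sum_subtractf[symmetric] algebra_simps)
  also have "\<dots> = (\<Sum>z\<in>?T. c (Suc n) z * lattice_bump (Suc n) z x) * (\<Sum>w\<in>?U. lattice_bump n w x)
      - (\<Sum>z\<in>?T. lattice_bump (Suc n) z x) * (\<Sum>w\<in>?U. c n w * lattice_bump n w x)"
    by (simp only: sum_product)
  also have "\<dots> = (\<Sum>z\<in>?T. c (Suc n) z * lattice_bump (Suc n) z x) - (\<Sum>w\<in>?U. c n w * lattice_bump n w x)"
    by (simp only: lattice_bump_partition_of_unity mult_1_right mult_1_left)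
  finally show ?case using Suc.IH[OF le] by simp
qed

text \<open>Near \<open>p i\<close> the first \<open>n\<close> terms add up to a combination of
  values \<open>F (rep n z)\<close> with weights of sum 1, each value within order
  \<open>r ^ n\<close> of \<open>F i\<close>; the tail is geometric of the same order.\<close>

lemma f_near_data:
  "\<exists>H. \<forall>i\<in>I. \<forall>n\<ge>1. \<forall>x. (\<forall>k. 2 ^ n * \<bar>x $ k - p i $ k\<bar> \<le> 1) \<longrightarrow> \<bar>f x - F i\<bar> \<le> H * r ^ n"
proof (intro exI ballI allI impI)
  fix i n x assume i: "i \<in> I" and n: "(1::nat) \<le> n" and x: "\<forall>k. 2 ^ n * \<bar>x $ k - p i $ k\<bar> \<le> 1"
  let ?T = "lattice_nbrs n x"
  define M where "M = C * (real CARD('n) * 5) powr \<alpha>"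
  have M: "0 \<le> M" using C by (simp add: M_def)
  have cz: "\<bar>c n z - F i\<bar> \<le> M * r ^ n" if z: "z \<in> ?T" for z
  proof -
    have zx: "\<bar>2 ^ n * x $ k - of_int (z k)\<bar> \<le> 1" for k using lattice_nbrs_dist[OF z] .
    have xi: "\<bar>2 ^ n * x $ k - 2 ^ n * p i $ k\<bar> \<le> 1" for k
      using x unfolding right_diff_distrib[symmetric] abs_mult by simp
    have "\<bar>2 ^ n * p i $ k - of_int (z k)\<bar> \<le> 3" for k using zx[of k] xi[of k] by linarith
    then have "near n z \<noteq> {}" using i by (auto simp: near_def)
    then have "rep n z \<in> near n z" by (rule rep_near)
    then have j: "rep n z \<in> I" "\<And>k. \<bar>2 ^ n * p (rep n z) $ k - of_int (z k)\<bar> \<le> 3"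
      by (auto simp: near_def)
    have "\<bar>F (rep n z) - F i\<bar> \<le> M * r ^ n"
      unfolding M_def
    proof (rule F_diff_le)
      fix k
      have "\<bar>2 ^ n * (p (rep n z) $ k - p i $ k)\<bar> \<le> 5"
        using j(2)[of k] zx[of k] xi[of k] unfolding right_diff_distrib by linarith
      then have "2 ^ n * \<bar>p (rep n z) $ k - p i $ k\<bar> \<le> 5" by (simp only: abs_two_power_mult)
      then show "\<bar>p (rep n z) $ k - p i $ k\<bar> \<le> 5 / 2 ^ n" by (simp add: field_simps)
    qed (use i j in auto)
    then show ?thesis using n by (simp add: c_def)
  qed
  have "(\<Sum>m<n. b m x) - F i = (\<Sum>z\<in>?T. (c n z - F i) * lattice_bump n z x)"
    using lattice_bump_partition_of_unity[of n x] x
    by (subst sum_b_telescope[OF i]) (auto simp: left_diff_distrib sum_subtractf sum_distrib_left[symmetric])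
  also have "\<bar>\<dots>\<bar> \<le> 2 ^ CARD('n) * (M * r ^ n)"
  proof (rule abs_sum_le_of_support[OF finite_lattice_nbrs finite_lattice_nbrs])
    fix z assume "z \<in> ?T"
    then show "\<bar>(c n z - F i) * lattice_bump n z x\<bar> \<le> M * r ^ n"
      unfolding abs_mult using mult_mono[OF cz lattice_bump_abs_le[of n z x]] M r by simp
  qed (use M r in \<open>auto simp: card_lattice_nbrs\<close>)
  finally have head: "\<bar>(\<Sum>m<n. b m x) - F i\<bar> \<le> 2 ^ CARD('n) * (M * r ^ n)" .
  have "f x = (\<Sum>m. b (m + n) x) + (\<Sum>m<n. b m x)"
    unfolding f_def by (rule suminf_split_initial_segment[OF summable_b])
  moreover have "\<bar>\<Sum>m. b (m + n) x\<bar> \<le> (\<Sum>m. N * K * r ^ n * r ^ m)"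
  proof -
    have s: "summable (\<lambda>m. N * K * r ^ n * r ^ m)" using r by (intro summable_mult summable_geometric) auto
    have le: "\<bar>b (m + n) x\<bar> \<le> N * K * r ^ n * r ^ m" for m
      using b_abs_le[of "m + n" x] by (simp add: power_add mult_ac)
    have s': "summable (\<lambda>m. \<bar>b (m + n) x\<bar>)" using le by (intro summable_comparison_test'[OF s]) auto
    show ?thesis using summable_rabs[OF s'] suminf_le[OF le s' s] by linarith
  qed
  moreover have "(\<Sum>m. N * K * r ^ n * r ^ m) = N * K * r ^ n * (1 / (1 - r))"
    using r by (subst suminf_mult) (auto intro!: summable_geometric simp: suminf_geometric)
  ultimately have "\<bar>f x - F i\<bar> \<le> 2 ^ CARD('n) * (M * r ^ n) + N * K * r ^ n * (1 / (1 - r))"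
    using head by linarith
  then show "\<bar>f x - F i\<bar> \<le> (2 ^ CARD('n) * (C * (real CARD('n) * 5) powr \<alpha>) + N * K * (1 / (1 - r))) * r ^ n"
    by (simp add: M_def algebra_simps)
qed

text \<open>An error of order \<open>r ^ n\<close> at distance \<open>2 powr (- n)\<close> with
  \<open>2 * r < 1\<close> is of smaller order than the distance. Since the partial derivative is
  already known to exist, the sequence \<open>(1/2) ^ n\<close> suffices to evaluate it.\<close>

lemma
  assumes i: "i \<in> I"
  shows f_data: "f (p i) = F i" and partial_deriv_f_data: "partial_deriv h f (p i) = 0"
proof -
  obtain H where H: "\<And>n x. 1 \<le> n \<Longrightarrow> (\<And>k. 2 ^ n * \<bar>x $ k - p i $ k\<bar> \<le> 1) \<Longrightarrow> \<bar>f x - F i\<bar> \<le> H * r ^ n"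
    using f_near_data i by meson
  have "(\<lambda>n. H * r ^ n) \<longlonglongrightarrow> H * 0" using r by (intro tendsto_intros LIMSEQ_power_zero) auto
  then have "\<bar>f (p i) - F i\<bar> \<le> H * 0"
    by (rule Lim_bounded2[where N=1]) (use H in auto)
  then show f0: "f (p i) = F i" by simp
  define D where "D = partial_deriv h f (p i)"
  have "((\<lambda>t. f (p i + t *\<^sub>R axis h 1)) has_real_derivative D) (at 0)"
    using f_partial[of "p i" h] by (simp add: D_def partial_deriv_f)
  then have lim: "((\<lambda>t. (f (p i + t *\<^sub>R axis h 1) - F i) / t) \<longlongrightarrow> D) (at 0)"
    by (simp add: DERIV_def f0)
  have "filterlim (\<lambda>n. (1/2::real) ^ n) (at 0) sequentially"
    by (rule filterlim_atI) (auto intro!: LIMSEQ_power_zero)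
  from filterlim_compose[OF lim this]
  have 1: "(\<lambda>n. (f (p i + (1/2) ^ n *\<^sub>R axis h 1) - F i) / (1/2) ^ n) \<longlonglongrightarrow> D" .
  have "(\<lambda>n. (f (p i + (1/2) ^ n *\<^sub>R axis h 1) - F i) / (1/2) ^ n) \<longlonglongrightarrow> 0"
  proof (rule Lim_null_comparison)
    show "\<forall>\<^sub>F n in sequentially. norm ((f (p i + (1/2) ^ n *\<^sub>R axis h 1) - F i) / (1/2) ^ n)
        \<le> H * (2 * r) ^ n"
    proof (rule eventually_sequentiallyI[of 1])
      fix n :: nat assume "1 \<le> n"
      then have "\<bar>f (p i + (1/2) ^ n *\<^sub>R axis h 1) - F i\<bar> \<le> H * r ^ n"
        by (intro H) (auto simp: axis_def power_mult_distrib[symmetric])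
      then have "\<bar>f (p i + (1/2) ^ n *\<^sub>R axis h 1) - F i\<bar> * 2 ^ n \<le> H * r ^ n * 2 ^ n"
        by (intro mult_right_mono) auto
      then show "norm ((f (p i + (1/2) ^ n *\<^sub>R axis h 1) - F i) / (1/2) ^ n) \<le> H * (2 * r) ^ n"
        by (simp add: power_mult_distrib power_one_over abs_mult mult_ac)
    qed
    have "(\<lambda>n. H * (2 * r) ^ n) \<longlonglongrightarrow> H * 0" using r by (intro tendsto_intros LIMSEQ_power_zero) auto
    then show "(\<lambda>n. H * (2 * r) ^ n) \<longlonglongrightarrow> 0" by simp
  qed
  then show "partial_deriv h f (p i) = 0" using LIMSEQ_unique[OF 1] by (simp add: D_def)
qed

end

text \<open>The margin \<open>2 - \<epsilon> < \<alpha>\<close> is strict because the derivatives of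
  the series are Hoelder for exponents below \<open>\<alpha> - 1\<close>.\<close>

lemma whitney_flat_extension:
  fixes p :: "'i \<Rightarrow> real ^ 'n::finite" and F :: "'i \<Rightarrow> real"
  assumes "0 < \<epsilon>" "2 - \<epsilon> < \<alpha>" "\<epsilon> < 1" "\<alpha> < 2" "0 \<le> C"
    and "\<And>i. i \<in> I \<Longrightarrow> norm (p i) \<le> R" "\<And>i. i \<in> I \<Longrightarrow> \<bar>F i\<bar> \<le> B"
    and "\<And>i j. i \<in> I \<Longrightarrow> j \<in> I \<Longrightarrow> \<bar>F i - F j\<bar> \<le> C * dist (p i) (p j) powr \<alpha>"
  obtains f where "compact (closure {x. f x \<noteq> 0})" "C_2_minus \<epsilon> f"
    "\<And>i. i \<in> I \<Longrightarrow> f (p i) = F i" "\<And>i h. i \<in> I \<Longrightarrow> partial_deriv h f (p i) = 0"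
proof -
  \<comment> \<open>\<open>max 0 B\<close> because an empty \<open>I\<close> would not force
    \<open>B\<close> to be nonnegative.\<close>
  interpret flat_jet I p F \<alpha> C R "max 0 B"
    using assms by unfold_locales (auto simp: le_max_iff_disj)
  have "C_2_minus \<epsilon> f"
    unfolding C_2_minus_def
  proof safe
    fix h x show "(\<lambda>t. f (x + t *\<^sub>R axis h 1)) field_differentiable at 0"
      using f_partial[of x h] by (auto simp: field_differentiable_def)
  next
    fix h
    obtain H where "\<forall>x y. \<bar>partial_deriv h f x - partial_deriv h f y\<bar> \<le> H * dist x y powr (1 - \<epsilon>)"
      using holder_partial_deriv_f[of "1 - \<epsilon>" h] assms by auto
    then show "locally_holder (1 - \<epsilon>) (partial_deriv h f)"
      unfolding locally_holder_def dist_real_def by (meson zero_less_one)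
  qed
  then show ?thesis using that compact_support_f f_data partial_deriv_f_data by blast
qed

section \<open>Climbing away from zero\<close>

lemma integrable_on_of_bounded_measurable:
  fixes f :: "real \<Rightarrow> real"
  assumes "f \<in> borel_measurable borel" "\<And>r. r \<in> {a..b} \<Longrightarrow> \<bar>f r\<bar> \<le> M"
  shows "f integrable_on {a..b}"
proof -
  have "set_integrable lborel {a..b} f"
    unfolding set_integrable_def
  proof (rule integrableI_bounded_set[where A="{a..b}" and B=M])
    show "(\<lambda>x. indicat_real {a..b} x *\<^sub>R f x) \<in> borel_measurable lborel" using assms by measurable
  qed (use assms in \<open>auto simp: emeasure_lborel_Icc_eq split: split_indicator\<close>)
  then show ?thesis by (rule set_borel_integral_eq_integral(1))
qed

lemma integral_indicator_Int:
  fixes A :: "real set"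
  assumes [measurable]: "A \<in> sets borel" and A: "A \<subseteq> {a..b}"
  shows "integral {a..b} (indicat_real A) = measure lborel A"
proof -
  have "emeasure lborel A \<le> emeasure lborel {a..b}" using assms by (intro emeasure_mono) auto
  then have "A \<in> fmeasurable lborel"
    by (intro fmeasurableI) (auto simp: emeasure_lborel_Icc_eq top.not_eq_extremum le_less_trans)
  then have "(indicat_real A has_integral measure lborel A) UNIV"
    using has_integral_integral_real[of "indicat_real A"] by (auto simp: fmeasurable_def)
  then have "((\<lambda>x. if x \<in> {a..b} then indicat_real A x else 0) has_integral measure lborel A) UNIV"
    by (rule has_integral_eq[rotated]) (use A in \<open>auto split: split_indicator\<close>)
  then show ?thesis by (simp only: has_integral_restrict_UNIV integral_unique)
qed

text \<open>The climb is deterministic. \<open>B\<close> will be the sixth coordinate frozen outside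
  [0, 1], whence the bounds on the whole line, and \<open>K\<close> the set of times at which
  \<open>u\<close> may change.\<close>

locale climbing =
  fixes B :: "real \<Rightarrow> real" and c q :: real and K :: "real set"
  assumes B_holder: "\<bar>B t - B s\<bar> \<le> c * \<bar>t - s\<bar> powr q"
    and B_osc: "\<bar>B t - B s\<bar> \<le> c"
    and q: "0 < q" and K [measurable]: "K \<in> sets borel"
begin

lemma c: "0 \<le> c" using B_osc[of 0 0] by simp

lemma B_continuous: "continuous_on UNIV B"
proof (rule continuous_at_imp_continuous_on, rule ballI)
  fix s
  have "((\<lambda>t. c * \<bar>t - s\<bar> powr q) \<longlongrightarrow> c * \<bar>s - s\<bar> powr q) (at s)"
    using q by (intro tendsto_mult tendsto_const tendsto_powr' tendsto_rabs tendsto_diff tendsto_ident_at) auto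
  then have "((\<lambda>t. c * \<bar>t - s\<bar> powr q) \<longlongrightarrow> 0) (at s)" by simp
  then have "((\<lambda>t. B t - B s) \<longlongrightarrow> 0) (at s)"
    by (rule Lim_null_comparison[rotated]) (simp add: B_holder)
  then show "isCont B s" unfolding isCont_def by (rule LIM_zero_cancel)
qed

lemma B_measurable [measurable]: "B \<in> borel_measurable borel"
  by (rule borel_measurable_continuous_onI[OF B_continuous])

text \<open>\<open>g\<close> is the derivative of \<open>u\<close>. One inequality expresses both
  that \<open>u\<close> has Lipschitz constant 1 and that it changes only on
  \<open>K\<close>.\<close>

definition adm :: "(real \<Rightarrow> real) \<Rightarrow> bool" where
  "adm g \<longleftrightarrow> g \<in> borel_measurable borel \<and> (\<forall>r. \<bar>g r\<bar> \<le> indicat_real K r)"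

definition U :: "(real \<Rightarrow> real) \<Rightarrow> real \<Rightarrow> real \<Rightarrow> real" where
  "U g a b = integral {a..b} g"

text \<open>\<open>Y g a b\<close> is \<open>\<integral>_a^b U g a dB\<close>, integrated by parts.\<close>

definition Y :: "(real \<Rightarrow> real) \<Rightarrow> real \<Rightarrow> real \<Rightarrow> real" where
  "Y g a b = integral {a..b} (\<lambda>r. g r * (B b - B r))"

lemma adm_measurable: "adm g \<Longrightarrow> g \<in> borel_measurable borel"
  and adm_indicator: "adm g \<Longrightarrow> \<bar>g r\<bar> \<le> indicat_real K r"
  by (auto simp: adm_def)

lemma adm_le_1: "adm g \<Longrightarrow> \<bar>g r\<bar> \<le> 1"
  using adm_indicator[of g r] by (auto split: split_indicator_asm)

lemma adm_0: "adm (\<lambda>r. 0)" by (simp add: adm_def)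

lemma adm_integrable: "adm g \<Longrightarrow> g integrable_on {a..b}"
  by (rule integrable_on_of_bounded_measurable[where M=1]) (auto simp: adm_measurable adm_le_1)

lemma adm_integrable_mult: "adm g \<Longrightarrow> (\<lambda>r. g r * (B t - B r)) integrable_on {a..b}"
proof (rule integrable_on_of_bounded_measurable[where M=c])
  assume g: "adm g"
  note [measurable] = adm_measurable[OF g]
  show "(\<lambda>r. g r * (B t - B r)) \<in> borel_measurable borel" by measurable
  show "\<bar>g r * (B t - B r)\<bar> \<le> c" for r
    unfolding abs_mult using mult_mono[OF adm_le_1[OF g, of r] B_osc[of t r]] by simp
qed

lemma U_add: "adm g \<Longrightarrow> a \<le> b \<Longrightarrow> b \<le> d \<Longrightarrow> U g a d = U g a b + U g b d"
  unfolding U_def by (rule Henstock_Kurzweil_Integration.integral_combine[symmetric]) (auto intro: adm_integrable)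

text \<open>Split \<open>B d - B r\<close> at \<open>b\<close> on the first interval. The middle
  term is the first-order term of the equation, so \<open>Y g b d\<close> is the remainder to be
  bounded in the definition of a solution.\<close>

lemma Y_add:
  assumes g: "adm g" and "a \<le> b" "b \<le> d"
  shows "Y g a d = Y g a b + U g a b * (B d - B b) + Y g b d"
proof -
  have "Y g a d = integral {a..b} (\<lambda>r. g r * (B d - B r)) + Y g b d"
    unfolding Y_def using assms by (intro Henstock_Kurzweil_Integration.integral_combine[symmetric] adm_integrable_mult) auto
  also have "integral {a..b} (\<lambda>r. g r * (B d - B r))
      = integral {a..b} (\<lambda>r. g r * (B b - B r) + g r * (B d - B b))"
    by (simp add: algebra_simps)
  also have "\<dots> = Y g a b + U g a b * (B d - B b)"
    unfolding Y_def U_def using g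
    by (simp add: integral_add[OF adm_integrable_mult integrable_on_mult_left[OF adm_integrable]])
  finally show ?thesis .
qed

lemma U_abs_le: "adm g \<Longrightarrow> a \<le> b \<Longrightarrow> \<bar>U g a b\<bar> \<le> b - a"
  using integral_norm_bound_integral[of g "{a..b}" "\<lambda>_. 1"] adm_integrable adm_le_1
  by (auto simp: U_def)

lemma Y_abs_le_bound:
  assumes g: "adm g" and "a \<le> b" "\<And>r. r \<in> {a..b} \<Longrightarrow> \<bar>B b - B r\<bar> \<le> M"
  shows "\<bar>Y g a b\<bar> \<le> M * (b - a)"
proof -
  have "norm (integral {a..b} (\<lambda>r. g r * (B b - B r))) \<le> integral {a..b} (\<lambda>_. M)"
  proof (rule integral_norm_bound_integral)
    fix r assume "r \<in> {a..b}"
    then show "norm (g r * (B b - B r)) \<le> M"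
      using mult_mono[OF adm_le_1[OF g, of r] assms(3), of r] by (auto simp: abs_mult)
  qed (auto intro: adm_integrable_mult g)
  then show ?thesis using assms by (simp add: Y_def mult.commute)
qed

lemma Y_abs_le: "adm g \<Longrightarrow> a \<le> b \<Longrightarrow> \<bar>Y g a b\<bar> \<le> c * (b - a)"
  by (rule Y_abs_le_bound) (auto simp: B_osc)

lemma Y_abs_le_powr:
  assumes "adm g" "a \<le> b"
  shows "\<bar>Y g a b\<bar> \<le> c * (b - a) powr (1 + q)"
proof -
  have "\<bar>Y g a b\<bar> \<le> (c * (b - a) powr q) * (b - a)"
  proof (rule Y_abs_le_bound[OF assms])
    fix r assume r: "r \<in> {a..b}"
    have "c * \<bar>b - r\<bar> powr q \<le> c * (b - a) powr q"
      using r q c by (intro mult_left_mono powr_mono2) auto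
    then show "\<bar>B b - B r\<bar> \<le> c * (b - a) powr q" using B_holder[of b r] by linarith
  qed
  also have "\<dots> = c * (b - a) powr (1 + q)" using assms by (simp add: powr_add)
  finally show ?thesis .
qed

lemma UY_cong:
  assumes "\<And>r. a < r \<Longrightarrow> r \<le> b \<Longrightarrow> g r = g' r"
  shows "U g a b = U g' a b" "Y g a b = Y g' a b"
  unfolding U_def Y_def by (rule integral_spike[of "{a}"]; use assms in force)+

lemma UY_eq_0:
  assumes "\<And>r. a < r \<Longrightarrow> r \<le> b \<Longrightarrow> g r = 0"
  shows "U g a b = 0" "Y g a b = 0"
  using UY_cong[of a b g "\<lambda>_. 0"] assms by (simp_all add: U_def Y_def)

lemma U_eq_0_of_disjoint:
  assumes g: "adm g" and K: "K \<inter> {a<..<b} = {}"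
  shows "U g a b = 0"
proof -
  have "U g a b = integral {a..b} (\<lambda>_. 0)"
    unfolding U_def
  proof (rule integral_spike[of "{a, b}"])
    fix r assume "r \<in> {a..b} - {a, b}"
    then have "r \<notin> K" using K by auto
    then show "0 = g r" using adm_indicator[OF g, of r] by simp
  qed auto
  then show ?thesis by simp
qed

section \<open>Gains on single cells and on blocks of cells\<close>

definition good_cell :: "real \<Rightarrow> real \<Rightarrow> real \<Rightarrow> real \<Rightarrow> bool" where
  "good_cell a h l D \<longleftrightarrow> l / 2 \<le> measure lborel (K \<inter> {a..a + l})
     \<and> l / 2 \<le> measure lborel (K \<inter> {a + h - l..a + h}) \<and> D \<le> \<bar>B (a + h) - B a\<bar>"

text \<open>On a good cell \<open>U g\<close> rises to height \<open>\<plusminus>l/2\<close> at the left end, stays there, and returns to \<open>0\<close>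
  at the right end; the sign is that of the increment of \<open>B\<close>.\<close>

lemma climb_cell:
  assumes l: "0 < l" "2 * l < h" and D: "4 * c * l powr q \<le> D" "0 < D" and good: "good_cell a h l D"
  obtains g where "adm g" "U g a (a + h) = 0" "l * D / 4 \<le> Y g a (a + h)"
    "\<And>t. a \<le> t \<Longrightarrow> t \<le> a + h \<Longrightarrow> \<bar>U g a t\<bar> \<le> l \<and> \<bar>Y g a t\<bar> \<le> c * l"
proof -
  define K1 where "K1 = K \<inter> {a..a + l}"
  define K2 where "K2 = K \<inter> {a + h - l..a + h}"
  have K12 [measurable]: "K1 \<in> sets borel" "K2 \<in> sets borel" by (auto simp: K1_def K2_def)
  define m1 where "m1 = measure lborel K1"
  define m2 where "m2 = measure lborel K2"
  have m: "l / 2 \<le> m1" "l / 2 \<le> m2" using good by (auto simp: good_cell_def m1_def m2_def K1_def K2_def)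
  then have m0: "0 < m1" "0 < m2" using l by auto
  have int: "integral {a..a + h} (indicat_real K1) = m1" "integral {a..a + h} (indicat_real K2) = m2"
    unfolding m1_def m2_def by (rule integral_indicator_Int; use l in \<open>auto simp: K1_def K2_def\<close>)+
  have indint: "(indicat_real K1) integrable_on {u..v}" "(indicat_real K2) integrable_on {u..v}" for u v
    by (rule integrable_on_of_bounded_measurable[where M=1]; auto)+
  define \<sigma> where "\<sigma> = sgn (B (a + h) - B a)"
  \<comment> \<open>Dividing by \<open>m1\<close> and \<open>m2\<close> gives both parts the same
    integral \<open>l / 2\<close> up to sign, so \<open>U g\<close> returns exactly to 0;
    \<open>m1\<close> and \<open>m2\<close> being at least \<open>l / 2\<close> keeps
    \<open>\<bar>g\<bar> \<le> 1\<close>.\<close>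
  define g where "g r = \<sigma> * (l / 2) * (indicat_real K1 r / m1 - indicat_real K2 r / m2)" for r
  define H where "H r = (l / 2) * (indicat_real K1 r / m1 + indicat_real K2 r / m2)" for r
  define e where "e = c * l powr q"
  have dB: "\<sigma> * (B (a + h) - B a) = \<bar>B (a + h) - B a\<bar>"
    by (auto simp: \<sigma>_def sgn_if)
  have \<sigma>: "\<bar>\<sigma>\<bar> \<le> 1" by (auto simp: \<sigma>_def sgn_if)
  have disj: "r \<notin> K1 \<or> r \<notin> K2" for r using l by (auto simp: K1_def K2_def)
  have gH: "\<bar>g r\<bar> \<le> H r" for r
  proof -
    have "\<bar>\<sigma>\<bar> * H r \<le> 1 * H r" using \<sigma> l m0 by (intro mult_right_mono) (auto simp: H_def)
    moreover have "\<bar>g r\<bar> = \<bar>\<sigma>\<bar> * H r"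
      using disj[of r] l m0 by (auto simp: g_def H_def abs_mult split: split_indicator)
    ultimately show ?thesis by simp
  qed
  have HK: "H r \<le> indicat_real K r" for r
    using disj[of r] l m m0 by (auto simp: H_def K1_def K2_def field_simps split: split_indicator)
  have "g \<in> borel_measurable borel" unfolding g_def by measurable
  then have adm: "adm g"
    unfolding adm_def using order.trans[OF gH HK] by blast
  have Hint: "H integrable_on {u..v}" for u v
    unfolding H_def by (intro integrable_on_mult_right integrable_add integrable_on_divide indint)
  have H0: "0 \<le> H r" for r using l m0 by (simp add: H_def)
  have HI: "integral {a..a + h} H = l"
    unfolding H_def using m0 indint
    by (simp add: integral_mult_right integral_add integrable_on_divide int)
  have partial: "integral {a..t} H \<le> l" if "a \<le> t" "t \<le> a + h" for t
    using integral_subset_le[of "{a..t}" "{a..a + h}" H] that Hint H0 HI by auto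
  have Ut: "\<bar>U g a t\<bar> \<le> l" if "a \<le> t" "t \<le> a + h" for t
    using integral_norm_bound_integral[OF adm_integrable[OF adm] Hint, of a t] gH partial[OF that]
    by (fastforce simp: U_def)
  have Yt: "\<bar>Y g a t\<bar> \<le> c * l" if "a \<le> t" "t \<le> a + h" for t
  proof -
    have "norm (Y g a t) \<le> integral {a..t} (\<lambda>r. c * H r)"
      unfolding Y_def
    proof (rule integral_norm_bound_integral[OF adm_integrable_mult[OF adm]])
      fix r
      have "\<bar>g r\<bar> * \<bar>B t - B r\<bar> \<le> H r * c" using gH B_osc H0 by (intro mult_mono) auto
      then show "norm (g r * (B t - B r)) \<le> c * H r" by (simp add: abs_mult mult.commute)
    qed (intro integrable_on_mult_right Hint)
    also have "\<dots> = c * integral {a..t} H" by simp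
    also have "\<dots> \<le> c * l" using c partial[OF that] by (intro mult_left_mono)
    finally show ?thesis by simp
  qed
  have "integral {a..a + h} g = 0"
    unfolding g_def using m0 indint
    by (simp add: integral_mult_right integral_diff integrable_on_divide int)
  then have U0: "U g a (a + h) = 0" by (simp add: U_def)
  \<comment> \<open>On \<open>K1\<close> the path is within \<open>e\<close> of \<open>B a\<close>,
    so the rise earns at least \<open>D - e\<close>; on \<open>K2\<close> it is within
    \<open>e\<close> of \<open>B (a + h)\<close>, so the return costs at most \<open>e\<close>. As
    \<open>e \<le> D / 4\<close>, at least half of \<open>D\<close> remains.\<close>
  have lower: "(l / 2) * (indicat_real K1 r / m1 * (D - e) - indicat_real K2 r / m2 * e)
      \<le> g r * (B (a + h) - B r)" for r
  proof -
    have close: "\<bar>B u - B v\<bar> \<le> e" if "\<bar>u - v\<bar> \<le> l" for u v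
      unfolding e_def using B_holder[of u v] powr_mono2[of q "\<bar>u - v\<bar>" l] that q c
        mult_left_mono[of "\<bar>u - v\<bar> powr q" "l powr q" c] by auto
    consider "r \<in> K1" "r \<notin> K2" | "r \<notin> K1" "r \<in> K2" | "r \<notin> K1" "r \<notin> K2" using disj by blast
    then show ?thesis
    proof cases
      case 1
      then have "\<bar>B a - B r\<bar> \<le> e" by (intro close) (auto simp: K1_def)
      then have "\<bar>\<sigma> * (B a - B r)\<bar> \<le> 1 * e" unfolding abs_mult using \<sigma> by (intro mult_mono) auto
      moreover have "\<sigma> * (B (a + h) - B r) = \<bar>B (a + h) - B a\<bar> + \<sigma> * (B a - B r)"
        unfolding dB[symmetric] by (simp add: algebra_simps)
      ultimately have "D - e \<le> \<sigma> * (B (a + h) - B r)" using good by (auto simp: good_cell_def)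
      then have "(l / 2 / m1) * (D - e) \<le> (l / 2 / m1) * (\<sigma> * (B (a + h) - B r))"
        using l m0 by (intro mult_left_mono) auto
      then show ?thesis using 1 by (simp add: g_def mult_ac)
    next
      case 2
      then have "\<bar>B (a + h) - B r\<bar> \<le> e" by (intro close) (auto simp: K2_def)
      then have "\<bar>\<sigma> * (B (a + h) - B r)\<bar> \<le> 1 * e" unfolding abs_mult using \<sigma> by (intro mult_mono) auto
      then have "\<sigma> * (B (a + h) - B r) \<le> e" by linarith
      then have "(l / 2 / m2) * (\<sigma> * (B (a + h) - B r)) \<le> (l / 2 / m2) * e"
        using l m0 by (intro mult_left_mono) auto
      then show ?thesis using 2 by (simp add: g_def mult_ac)
    next
      case 3
      then show ?thesis by (simp add: g_def)
    qed
  qed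
  have "integral {a..a + h} (\<lambda>r. (l / 2) * (indicat_real K1 r / m1 * (D - e) - indicat_real K2 r / m2 * e))
      \<le> Y g a (a + h)"
    unfolding Y_def using lower
    by (intro integral_le integrable_on_mult_right integrable_diff integrable_on_mult_left
        integrable_on_divide indint adm_integrable_mult[OF adm]) auto
  also have "integral {a..a + h} (\<lambda>r. (l / 2) * (indicat_real K1 r / m1 * (D - e) - indicat_real K2 r / m2 * e))
      = (l / 2) * (D - e - e)"
    using m0 indint by (simp add: integral_diff integrable_on_mult_left integrable_on_divide int)
  finally have "(l / 2) * (D - e - e) \<le> Y g a (a + h)" .
  moreover have "(l / 2) * (D / 2) \<le> (l / 2) * (D - e - e)"
    using D l by (intro mult_left_mono) (auto simp: e_def)
  moreover have "l * D / 4 = (l / 2) * (D / 2)" by simp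
  ultimately have "l * D / 4 \<le> Y g a (a + h)" by linarith
  then show thesis by (rule that[OF adm U0]) (simp_all add: Ut Yt)
qed

lemma adm_glue: "adm g \<Longrightarrow> adm g' \<Longrightarrow> adm (\<lambda>r. if r \<le> e then g r else g' r)"
  unfolding adm_def by auto

lemma UY_glue:
  shows "t \<le> e \<Longrightarrow> U (\<lambda>r. if r \<le> e then g r else g' r) a t = U g a t"
    "t \<le> e \<Longrightarrow> Y (\<lambda>r. if r \<le> e then g r else g' r) a t = Y g a t"
    "U (\<lambda>r. if r \<le> e then g r else g' r) e t = U g' e t"
    "Y (\<lambda>r. if r \<le> e then g r else g' r) e t = Y g' e t"
  by (rule UY_cong; simp)+

text \<open>Because \<open>U g\<close> is 0 at every cell boundary, the cross term of
  \<open>Y_add\<close> vanishes and gains add; a cell that is not good gets slope 0. Past gains are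
  nonnegative, so \<open>Y\<close> can dip below 0 only through the current cell, by at most
  \<open>c * l\<close>.\<close>

lemma climb_block:
  fixes N :: nat and a h l D :: real
  assumes l: "0 < l" "2 * l < h" and D: "4 * c * l powr q \<le> D" "0 < D"
  shows "\<exists>g. adm g \<and> U g a (a + N * h) = 0
    \<and> card {k. k < N \<and> good_cell (a + k * h) h l D} * (l * D / 4) \<le> Y g a (a + N * h)
    \<and> (\<forall>t. a \<le> t \<and> t \<le> a + N * h \<longrightarrow> \<bar>U g a t\<bar> \<le> l \<and> - (c * l) \<le> Y g a t)"
proof (induction N)
  case 0
  have "U (\<lambda>r. 0) a a = 0 \<and> Y (\<lambda>r. 0) a a = 0" by (simp add: U_def Y_def)
  then show ?case using adm_0 c l by (intro exI[of _ "\<lambda>r. 0"]) (auto simp: antisym_conv)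
next
  case (Suc N)
  define e where "e = a + N * h"
  have e': "a + real (Suc N) * h = e + h" by (simp add: e_def algebra_simps)
  from Suc.IH[folded e_def] obtain g where IH: "adm g \<and> U g a e = 0
    \<and> card {k. k < N \<and> good_cell (a + k * h) h l D} * (l * D / 4) \<le> Y g a e
    \<and> (\<forall>t. a \<le> t \<and> t \<le> e \<longrightarrow> \<bar>U g a t\<bar> \<le> l \<and> - (c * l) \<le> Y g a t)" ..
  then have g: "adm g" "U g a e = 0"
    "card {k. k < N \<and> good_cell (a + k * h) h l D} * (l * D / 4) \<le> Y g a e"
    and g4: "\<And>t. a \<le> t \<Longrightarrow> t \<le> e \<Longrightarrow> \<bar>U g a t\<bar> \<le> l \<and> - (c * l) \<le> Y g a t"
    by auto
  obtain g' where g': "adm g'" "U g' e (e + h) = 0"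
    "(if good_cell e h l D then l * D / 4 else 0) \<le> Y g' e (e + h)"
    "\<And>t. e \<le> t \<Longrightarrow> t \<le> e + h \<Longrightarrow> \<bar>U g' e t\<bar> \<le> l \<and> \<bar>Y g' e t\<bar> \<le> c * l"
  proof (cases "good_cell e h l D")
    case True
    from climb_cell[OF l D True] obtain g' where "adm g'" "U g' e (e + h) = 0"
      "l * D / 4 \<le> Y g' e (e + h)"
      "\<And>t. e \<le> t \<Longrightarrow> t \<le> e + h \<Longrightarrow> \<bar>U g' e t\<bar> \<le> l \<and> \<bar>Y g' e t\<bar> \<le> c * l" by metis
    then show ?thesis using that[of g'] True by simp
  next
    case False
    show ?thesis using that[OF adm_0] False c l by (simp add: U_def Y_def)
  qed
  define g2 where "g2 = (\<lambda>r. if r \<le> e then g r else g' r)"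
  have adm2: "adm g2" unfolding g2_def using g g' by (intro adm_glue)
  have ae: "a \<le> e" using l by (simp add: e_def)
  have gain: "0 \<le> card {k. k < N \<and> good_cell (a + k * h) h l D} * (l * D / 4)" using l D by simp
  have Ue: "U g2 a t = U g' e t" and Ye: "Y g2 a t = Y g a e + Y g' e t" if "e \<le> t" for t
    using U_add[OF adm2 ae that] Y_add[OF adm2 ae that] g(2) by (simp_all add: g2_def UY_glue)
  have "{k. k < Suc N \<and> good_cell (a + k * h) h l D} = {k. k < N \<and> good_cell (a + k * h) h l D}
      \<union> (if good_cell e h l D then {N} else {})"
    by (auto simp: less_Suc_eq e_def)
  then have "card {k. k < Suc N \<and> good_cell (a + k * h) h l D} =
      card {k. k < N \<and> good_cell (a + k * h) h l D} + (if good_cell e h l D then 1 else 0)"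
    by (simp add: card_insert_if)
  then have "card {k. k < Suc N \<and> good_cell (a + k * h) h l D} * (l * D / 4)
      = card {k. k < N \<and> good_cell (a + k * h) h l D} * (l * D / 4)
        + (if good_cell e h l D then l * D / 4 else 0)"
    by (simp add: algebra_simps)
  also have "\<dots> \<le> Y g2 a (e + h)" using g(3) g'(3) l Ye[of "e + h"] by linarith
  finally have 1: "card {k. k < Suc N \<and> good_cell (a + k * h) h l D} * (l * D / 4) \<le> Y g2 a (e + h)" .
  have 2: "\<bar>U g2 a t\<bar> \<le> l \<and> - (c * l) \<le> Y g2 a t" if t: "a \<le> t" "t \<le> e + h" for t
  proof (cases "t \<le> e")
    case True
    then show ?thesis using g4[OF t(1)] by (simp add: g2_def UY_glue)
  next
    case False
    then have "e \<le> t" by simp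
    then show ?thesis using g'(4)[of t] t g(3) gain Ue[of t] Ye[of t] by linarith
  qed
  have 3: "U g2 a (e + h) = 0" using Ue[of "e + h"] g'(2) l by simp
  show ?case unfolding e' using adm2 1 2 3 by blast
qed

end

section \<open>Windows accumulating at the start of a climb\<close>

context climbing
begin

text \<open>Larger \<open>n\<close> means earlier windows. In window \<open>n\<close> the height
  \<open>G (Suc n)\<close> won in the preceding window is already available, up to the dip
  \<open>c * l n\<close>; hypothesis \<open>dom\<close> says that this dominates
  \<open>\<bar>U\<bar> \<le> l n\<close>.\<close>

lemma climb_window:
  fixes s \<alpha> :: real and l G :: "nat \<Rightarrow> real" and n0 :: nat
  defines "e \<equiv> \<lambda>n. s + (1/2) ^ n"
  assumes n0: "1 \<le> n0"
    and block: "\<And>n. n0 \<le> n \<Longrightarrow> \<exists>g. adm g \<and> U g (e (Suc n)) (e n) = 0 \<and> G n \<le> Y g (e (Suc n)) (e n)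
      \<and> (\<forall>t. e (Suc n) \<le> t \<and> t \<le> e n \<longrightarrow> \<bar>U g (e (Suc n)) t\<bar> \<le> l n \<and> - (c * l n) \<le> Y g (e (Suc n)) t)"
    and G: "\<And>n. n0 \<le> n \<Longrightarrow> 0 < G n"
    and dom: "\<And>n. n0 \<le> n \<Longrightarrow> 0 \<le> G (Suc n) - c * l n \<and> l n \<le> (G (Suc n) - c * l n) powr \<alpha>"
    and \<alpha>: "0 < \<alpha>"
  shows "\<exists>g. adm g \<and> (\<forall>r. r \<le> s \<or> e n0 < r \<longrightarrow> g r = 0) \<and> U g s (e n0) = 0 \<and> 0 < Y g s (e n0)
    \<and> (\<forall>t. s \<le> t \<and> t \<le> e n0 \<longrightarrow> 0 \<le> Y g s t \<and> \<bar>U g s t\<bar> \<le> Y g s t powr \<alpha>)"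
proof -
  obtain gg where gg: "\<And>n. n0 \<le> n \<Longrightarrow> adm (gg n) \<and> U (gg n) (e (Suc n)) (e n) = 0
      \<and> G n \<le> Y (gg n) (e (Suc n)) (e n)
      \<and> (\<forall>t. e (Suc n) \<le> t \<and> t \<le> e n \<longrightarrow> \<bar>U (gg n) (e (Suc n)) t\<bar> \<le> l n
           \<and> - (c * l n) \<le> Y (gg n) (e (Suc n)) t)"
    using block by metis
  define g0 where "g0 n = (if n0 \<le> n then gg n else (\<lambda>r. 0))" for n
  have g0: "adm (g0 n)" for n using gg adm_0 by (simp add: g0_def)
  note [measurable] = adm_measurable[OF g0]
  \<comment> \<open>\<open>m r\<close> is the window containing \<open>r\<close>. For
    \<open>r > e n0\<close> it is less than \<open>n0\<close>, where \<open>g0\<close> is 0; this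
    rests on \<open>1 \<le> n0\<close>.\<close>
  define m where "m r = (LEAST n. e (Suc n) < r)" for r
  define g where "g r = (if s < r then g0 (m r) r else 0)" for r
  have e_anti: "e n \<le> e k" if "k \<le> n" for n k
    unfolding e_def using that by (simp add: power_decreasing)
  have e_gt: "s < e n" for n by (simp add: e_def)
  have m_eq: "m r = n" if "e (Suc n) < r" "r \<le> e n" for r n
    unfolding m_def
  proof (rule Least_equality)
    fix k assume k: "e (Suc k) < r"
    show "n \<le> k"
    proof (rule ccontr)
      assume "\<not> n \<le> k"
      then show False using e_anti[of "Suc k" n] k that by simp
    qed
  qed (use that in simp)
  have [measurable]: "m \<in> measurable borel (count_space UNIV)"
    unfolding m_def[abs_def] by measurable
  have "(\<lambda>r. g0 (m r) r) \<in> borel_measurable borel"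
    by (rule measurable_compose_countable[where g=m and f="\<lambda>n. g0 n"]) measurable
  then have "g \<in> borel_measurable borel" unfolding g_def[abs_def] by measurable
  moreover have "\<bar>g r\<bar> \<le> indicat_real K r" for r
    using adm_indicator[OF g0] by (simp add: g_def)
  ultimately have g: "adm g" by (simp add: adm_def)
  have supp: "g r = 0" if "r \<le> s \<or> e n0 < r" for r
  proof (cases "r \<le> s")
    case False
    then have r: "e n0 < r" using that by simp
    obtain k where k: "n0 = Suc k" using n0 by (cases n0) auto
    have "m r \<le> k" unfolding m_def by (rule Least_le) (use r k in simp)
    then show ?thesis using k by (simp add: g_def g0_def)
  qed (simp add: g_def)
  have g_gg: "g r = gg n r" if "n0 \<le> n" "e (Suc n) < r" "r \<le> e n" for n r
    using m_eq[OF that(2,3)] that e_gt[of "Suc n"] by (simp add: g_def g0_def)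
  have UY: "U g (e (Suc n)) t = U (gg n) (e (Suc n)) t" "Y g (e (Suc n)) t = Y (gg n) (e (Suc n)) t"
    if "n0 \<le> n" "t \<le> e n" for n t
    by (rule UY_cong; use g_gg[OF that(1)] that in force)+
  have e_lim: "(\<lambda>k. M * (1/2) ^ (n + k)) \<longlonglongrightarrow> 0" for M :: real and n :: nat
  proof -
    have "(\<lambda>k. (1/2 :: real) ^ (k + n)) \<longlonglongrightarrow> 0"
      by (rule LIMSEQ_ignore_initial_segment) (rule LIMSEQ_power_zero, simp)
    from tendsto_mult_left[OF this, of M] show ?thesis by (simp add: add.commute)
  qed
  have se: "s \<le> e (Suc n)" "e (Suc n) \<le> e n" for n using e_gt[of "Suc n"] e_anti[of n "Suc n"] by auto
  \<comment> \<open>Infinitely many windows lie before \<open>e n\<close>, so the values at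
    \<open>e n\<close> come from a limit at \<open>s\<close>: \<open>U\<close> is the same at all
    \<open>e n\<close>, \<open>Y\<close> is monotone along them, and both are bounded by a multiple
    of the distance to \<open>s\<close>.\<close>
  have U_step: "U g s (e n) = U g s (e (n + k))" if "n0 \<le> n" for n k
  proof (induction k)
    case (Suc k)
    have "U g s (e (n + k)) = U g s (e (Suc (n + k))) + U g (e (Suc (n + k))) (e (n + k))"
      by (rule U_add[OF g se])
    also have "U g (e (Suc (n + k))) (e (n + k)) = 0"
      using UY(1)[of "n + k" "e (n + k)"] gg[of "n + k"] that by simp
    finally show ?case using Suc by simp
  qed simp
  have U_e: "U g s (e n) = 0" if "n0 \<le> n" for n
  proof -
    have "\<bar>U g s (e n)\<bar> \<le> 1 * (1/2) ^ (n + k)" for k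
      using U_abs_le[OF g, of s "e (n + k)"] e_gt[of "n + k"] U_step[OF that, of k] by (simp add: e_def)
    then have "\<bar>U g s (e n)\<bar> \<le> 0" by (intro Lim_bounded2[OF e_lim[of 1 n]]) auto
    then show ?thesis by simp
  qed
  have Y_step: "Y g s t = Y g s (e (Suc n)) + Y (gg n) (e (Suc n)) t"
    and U_t: "U g s t = U (gg n) (e (Suc n)) t"
    if "n0 \<le> n" "e (Suc n) \<le> t" "t \<le> e n" for n t
    using Y_add[OF g se(1) that(2)] U_add[OF g se(1) that(2)] U_e[of "Suc n"] UY[OF that(1,3)] that(1)
    by auto
  have Y_G: "Y g s (e (Suc n)) + G n \<le> Y g s (e n)" if "n0 \<le> n" for n
    using Y_step[OF that se(2) order.refl] gg[OF that] by simp
  have Y_mono: "Y g s (e (n + k)) \<le> Y g s (e n)" if "n0 \<le> n" for n k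
  proof (induction k)
    case (Suc k)
    then show ?case using Y_G[of "n + k"] G[of "n + k"] that by simp
  qed simp
  have Y_nonneg: "0 \<le> Y g s (e n)" if "n0 \<le> n" for n
  proof -
    have "- Y g s (e n) \<le> c * (1/2) ^ (n + k)" for k
      using Y_abs_le[OF g, of s "e (n + k)"] e_gt[of "n + k"] Y_mono[OF that, of k] by (simp add: e_def)
    then have "- Y g s (e n) \<le> 0" by (intro Lim_bounded2[OF e_lim[of c n]]) auto
    then show ?thesis by simp
  qed
  have main: "0 \<le> Y g s t \<and> \<bar>U g s t\<bar> \<le> Y g s t powr \<alpha>" if t: "s \<le> t" "t \<le> e n0" for t
  proof (cases "t = s")
    case True
    then show ?thesis by (simp add: U_def Y_def)
  next
    case False
    then have "s < t" using t by simp
    then obtain k where k: "(1/2) ^ k < t - s" using real_arch_pow_inv[of "t - s" "1/2"] by auto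
    define n where "n = (LEAST n. e n < t)"
    have "e k < t" using k by (simp add: e_def)
    then have n: "e n < t" "\<And>j. e j < t \<Longrightarrow> n \<le> j"
      unfolding n_def by (auto intro: LeastI Least_le)
    have "n0 < n" using e_anti[of n n0] n(1) t(2) by (cases "n0 < n") auto
    then obtain j where j: "n = Suc j" "n0 \<le> j" by (cases n) auto
    have tj: "t \<le> e j" using n(2)[of j] j by fastforce
    have le: "e (Suc j) \<le> t" using n(1) j by simp
    have YG: "G (Suc j) - c * l j \<le> Y g s t"
      using Y_step[OF j(2) le tj] Y_G[of "Suc j"] Y_nonneg[of "Suc (Suc j)"] gg[OF j(2)] le tj j(2)
      by fastforce
    have "\<bar>U g s t\<bar> \<le> l j" using U_t[OF j(2) le tj] gg[OF j(2)] le tj by simp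
    also have "\<dots> \<le> (G (Suc j) - c * l j) powr \<alpha>" using dom[OF j(2)] by simp
    also have "\<dots> \<le> Y g s t powr \<alpha>" using dom[OF j(2)] YG \<alpha> by (intro powr_mono2) auto
    finally show ?thesis using YG dom[OF j(2)] by linarith
  qed
  have "0 < Y g s (e n0)" using Y_G[of n0] G[of n0] Y_nonneg[of "Suc n0"] by simp
  then show ?thesis using g supp U_e[of n0] main by blast
qed

text \<open>All quantities are counted from time 0, although the climb takes place in
  \<open>[s, e]\<close>. The last bound is what allows a branch to be kept low by choosing
  \<open>e\<close> close to \<open>s\<close>.\<close>

definition branch :: "real \<Rightarrow> real \<Rightarrow> real \<Rightarrow> real \<Rightarrow> (real \<Rightarrow> real) \<Rightarrow> bool" where
  "branch \<alpha> s e H g \<longleftrightarrow> adm g \<and> 0 < H \<and> (\<forall>t\<ge>0.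
     (t \<le> s \<longrightarrow> U g 0 t = 0 \<and> Y g 0 t = 0) \<and> (e \<le> t \<longrightarrow> U g 0 t = 0 \<and> Y g 0 t = H) \<and>
     0 \<le> Y g 0 t \<and> \<bar>U g 0 t\<bar> \<le> Y g 0 t powr \<alpha> \<and> Y g 0 t \<le> c * (e - s))"

definition climbable :: "real \<Rightarrow> real \<Rightarrow> bool" where
  "climbable \<alpha> s \<longleftrightarrow> (\<forall>\<delta>>0. \<exists>e H g. s < e \<and> e \<le> s + \<delta> \<and> branch \<alpha> s e H g)"

lemma climbableI:
  fixes s \<alpha> :: real and l G :: "nat \<Rightarrow> real"
  defines "e \<equiv> \<lambda>n. s + (1/2) ^ n"
  assumes block: "\<And>n. n1 \<le> n \<Longrightarrow> \<exists>g. adm g \<and> U g (e (Suc n)) (e n) = 0 \<and> G n \<le> Y g (e (Suc n)) (e n)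
      \<and> (\<forall>t. e (Suc n) \<le> t \<and> t \<le> e n \<longrightarrow> \<bar>U g (e (Suc n)) t\<bar> \<le> l n \<and> - (c * l n) \<le> Y g (e (Suc n)) t)"
    and G: "\<And>n. n1 \<le> n \<Longrightarrow> 0 < G n"
    and dom: "\<And>n. n1 \<le> n \<Longrightarrow> 0 \<le> G (Suc n) - c * l n \<and> l n \<le> (G (Suc n) - c * l n) powr \<alpha>"
    and \<alpha>: "0 < \<alpha>" and s: "0 \<le> s"
  shows "climbable \<alpha> s"
  unfolding climbable_def
proof (intro allI impI)
  fix \<delta> :: real assume "0 < \<delta>"
  then obtain k where k: "(1/2) ^ k < \<delta>" using real_arch_pow_inv[of \<delta> "1/2"] by auto
  define n0 where "n0 = max 1 (max n1 k)"
  have "(1/2::real) ^ n0 \<le> (1/2) ^ k" by (intro power_decreasing) (auto simp: n0_def)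
  then have "(1/2) ^ n0 \<le> \<delta>" using k by linarith
  then have e\<delta>: "s < e n0" "e n0 \<le> s + \<delta>" by (simp_all add: e_def)
  have n0: "1 \<le> n0" and n1: "n1 \<le> n" if "n0 \<le> n" for n using that by (auto simp: n0_def)
  from climb_window[OF n0[OF order.refl] block[unfolded e_def, OF n1] G[OF n1] dom[OF n1] \<alpha>, folded e_def]
  obtain g where g: "adm g \<and> (\<forall>r. r \<le> s \<or> e n0 < r \<longrightarrow> g r = 0) \<and> U g s (e n0) = 0 \<and> 0 < Y g s (e n0)
    \<and> (\<forall>t. s \<le> t \<and> t \<le> e n0 \<longrightarrow> 0 \<le> Y g s t \<and> \<bar>U g s t\<bar> \<le> Y g s t powr \<alpha>)"
    unfolding e_def ..
  then have supp: "\<And>r. r \<le> s \<or> e n0 < r \<Longrightarrow> g r = 0"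
    and Ue: "U g s (e n0) = 0" and Ye: "0 < Y g s (e n0)"
    and main: "\<And>t. s \<le> t \<Longrightarrow> t \<le> e n0 \<Longrightarrow> 0 \<le> Y g s t \<and> \<bar>U g s t\<bar> \<le> Y g s t powr \<alpha>"
    by auto
  from g have g: "adm g" ..
  have before: "U g 0 t = 0 \<and> Y g 0 t = 0" if "t \<le> s" for t
    using UY_eq_0[of 0 t g] supp that by auto
  have during: "U g 0 t = U g s t \<and> Y g 0 t = Y g s t" if "s \<le> t" for t
    using U_add[OF g s that] Y_add[OF g s that] before[of s] by simp
  have after: "U g s t = 0 \<and> Y g s t = Y g s (e n0)" if "e n0 \<le> t" for t
    using U_add[OF g _ that, of s] Y_add[OF g _ that, of s] UY_eq_0[of "e n0" t g] supp e\<delta> Ue by auto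
  have "branch \<alpha> s (e n0) (Y g s (e n0)) g"
    unfolding branch_def
  proof (intro conjI allI impI g Ye)
    fix t :: real assume t: "0 \<le> t"
    consider "t \<le> s" | "s \<le> t" "t \<le> e n0" | "s \<le> t" "e n0 \<le> t" by linarith
    then have "0 \<le> Y g 0 t \<and> \<bar>U g 0 t\<bar> \<le> Y g 0 t powr \<alpha> \<and> Y g 0 t \<le> c * (e n0 - s)"
    proof cases
      case 1
      then show ?thesis using before[of t] c e\<delta> by simp
    next
      case 2
      have "Y g s t \<le> c * (t - s)" using Y_abs_le[OF g 2(1)] by simp
      also have "\<dots> \<le> c * (e n0 - s)" using 2 c by (intro mult_left_mono) auto
      finally show ?thesis using during[OF 2(1)] main[OF 2] by simp
    next
      case 3
      have "Y g s (e n0) \<le> c * (e n0 - s)" using Y_abs_le[OF g, of s "e n0"] e\<delta> by simp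
      then show ?thesis using during[OF 3(1)] after[OF 3(2)] Ye by simp
    qed
    then show "0 \<le> Y g 0 t" "\<bar>U g 0 t\<bar> \<le> Y g 0 t powr \<alpha>" "Y g 0 t \<le> c * (e n0 - s)" by auto
  next
    fix t assume "t \<le> s" then show "U g 0 t = 0" "Y g 0 t = 0" using before by auto
  next
    fix t assume "e n0 \<le> t"
    then show "U g 0 t = 0" "Y g 0 t = Y g s (e n0)" using during[of t] after[of t] e\<delta> by auto
  qed
  then show "\<exists>e H g. s < e \<and> e \<le> s + \<delta> \<and> branch \<alpha> s e H g" using e\<delta> by blast
qed

text \<open>Dependent choice: once \<open>H m\<close> is known, the next branch is made so short
  that it stays below \<open>H m / 2\<close>. Final heights therefore decrease, and the bound passes
  to all later branches. Half the height keeps the gap to a finished branch at least as large as the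
  later branch is high.\<close>

lemma branches:
  fixes \<sigma> :: "nat \<Rightarrow> real"
  assumes climb: "\<And>m. climbable \<alpha> (\<sigma> m)" and \<sigma>: "\<And>m. \<sigma> m < \<sigma> (Suc m)"
  obtains e H g where "\<And>m. \<sigma> m < e m" "\<And>m. e m < \<sigma> (Suc m)" "\<And>m. branch \<alpha> (\<sigma> m) (e m) (H m) (g m)"
    "\<And>l m t. l < m \<Longrightarrow> 0 \<le> t \<Longrightarrow> Y (g m) 0 t \<le> H l / 2"
proof -
  define P where "P m x \<longleftrightarrow> \<sigma> m < fst x \<and> fst x < \<sigma> (Suc m)
    \<and> branch \<alpha> (\<sigma> m) (fst x) (fst (snd x)) (snd (snd x))" for m and x :: "real \<times> real \<times> (real \<Rightarrow> real)"
  define Q where "Q m x y \<longleftrightarrow> (\<forall>t\<ge>0. Y (snd (snd y)) 0 t \<le> fst (snd x) / 2)"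
    for m :: nat and x y :: "real \<times> real \<times> (real \<Rightarrow> real)"
  have ex: "\<exists>x. P m x \<and> (\<forall>t\<ge>0. Y (snd (snd x)) 0 t \<le> h)" if h: "0 < h" for m h
  proof -
    \<comment> \<open>The divisor \<open>c + 1\<close> covers the case \<open>c = 0\<close>; half
      the gap to \<open>\<sigma> (Suc m)\<close> makes \<open>e < \<sigma> (Suc m)\<close>
      strict.\<close>
    define \<delta> where "\<delta> = min ((\<sigma> (Suc m) - \<sigma> m) / 2) (h / (c + 1))"
    have "0 < \<delta>" using h c \<sigma>[of m] by (simp add: \<delta>_def)
    then obtain e H g where x: "\<sigma> m < e" "e \<le> \<sigma> m + \<delta>" "branch \<alpha> (\<sigma> m) e H g"
      using climb[of m] unfolding climbable_def by blast
    have "c * (e - \<sigma> m) \<le> (c + 1) * (h / (c + 1))"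
      using x c by (intro mult_mono) (auto simp: \<delta>_def)
    then have "c * (e - \<sigma> m) \<le> h" using c by simp
    then have "Y g 0 t \<le> h" if "0 \<le> t" for t using x(3) that by (force simp: branch_def)
    moreover have "e < \<sigma> (Suc m)" using x(2) \<sigma>[of m] min.cobounded1[of "(\<sigma> (Suc m) - \<sigma> m) / 2" "h / (c + 1)"]
      unfolding \<delta>_def by argo
    ultimately show ?thesis using x by (intro exI[of _ "(e, H, g)"]) (auto simp: P_def)
  qed
  have "\<exists>x. \<forall>m. P m (x m) \<and> Q m (x m) (x (Suc m))"
  proof (rule dependent_nat_choice)
    show "\<exists>x. P 0 x" using ex[of 1 0] by auto
    fix x m assume "P m x"
    then have "0 < fst (snd x)" by (simp add: P_def branch_def)
    then show "\<exists>y. P (Suc m) y \<and> Q m x y" using ex[of "fst (snd x) / 2" "Suc m"] by (auto simp: Q_def)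
  qed
  then obtain x where x: "\<And>m. P m (x m)" "\<And>m. Q m (x m) (x (Suc m))" by blast
  define e where "e m = fst (x m)" for m
  define H where "H m = fst (snd (x m))" for m
  define g where "g m = snd (snd (x m))" for m
  have br: "\<sigma> m < e m" "e m < \<sigma> (Suc m)" "branch \<alpha> (\<sigma> m) (e m) (H m) (g m)" for m
    using x(1)[of m] by (auto simp: P_def e_def H_def g_def)
  have half: "Y (g (Suc m)) 0 t \<le> H m / 2" if "0 \<le> t" for m t
    using x(2)[of m] that by (auto simp: Q_def H_def g_def)
  have H: "0 < H m" "H (Suc m) \<le> H m" for m
  proof -
    show H0: "0 < H m" for m using br(3)[of m] by (simp add: branch_def)
    have "Y (g (Suc m)) 0 (max 0 (e (Suc m))) = H (Suc m)"
      using br(3)[of "Suc m"] by (simp add: branch_def)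
    then show "H (Suc m) \<le> H m" using half[of "max 0 (e (Suc m))" m] H0[of m] by simp
  qed
  have "Y (g m) 0 t \<le> H l / 2" if "l < m" "0 \<le> t" for l m t
  proof -
    obtain k where "m = Suc k" using \<open>l < m\<close> by (cases m) auto
    then have k: "m = Suc k" "l \<le> k" using that by auto
    have "H k \<le> H l" using lift_Suc_antimono_le[of H, OF H(2) k(2)] .
    then show ?thesis using half[OF that(2), of k] k by simp
  qed
  with br show thesis using that by blast
qed

end

section \<open>From branches to solutions\<close>

lemma powr_in_smallo_id:
  assumes "0 < (q::real)"
  shows "(\<lambda>\<delta>. c * \<bar>\<delta>\<bar> powr (1 + q)) \<in> o[at_right 0](\<lambda>\<delta>. \<delta>)"
proof (rule smalloI_tendsto)
  have "((\<lambda>\<delta>::real. c * \<bar>\<delta>\<bar> powr q) \<longlongrightarrow> c * \<bar>0\<bar> powr q) (at_right 0)"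
    using assms by (intro tendsto_mult tendsto_const tendsto_powr' tendsto_rabs tendsto_ident_at) auto
  then have "((\<lambda>\<delta>::real. c * \<bar>\<delta>\<bar> powr q) \<longlongrightarrow> 0) (at_right 0)" by simp
  moreover have "\<forall>\<^sub>F \<delta>::real in at_right 0. c * \<bar>\<delta>\<bar> powr q = c * \<bar>\<delta>\<bar> powr (1 + q) / \<delta>"
    by (rule eventually_at_right_less[THEN eventually_mono]) (simp add: powr_add)
  ultimately show "((\<lambda>\<delta>. c * \<bar>\<delta>\<bar> powr (1 + q) / \<delta>) \<longlongrightarrow> 0) (at_right 0)"
    by (rule Lim_transform_eventually)
  show "\<forall>\<^sub>F \<delta>::real in at_right 0. \<delta> \<noteq> 0"
    by (rule eventually_at_right_less[THEN eventually_mono]) simp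
qed

lemma partial_deriv_const: "partial_deriv h (\<lambda>x. a) x = 0"
  by (simp add: partial_deriv_def)

definition clamp01 :: "real \<Rightarrow> real" where "clamp01 t = max 0 (min 1 t)"

lemma clamp01_eq [simp]: "0 \<le> t \<Longrightarrow> t \<le> 1 \<Longrightarrow> clamp01 t = t"
  by (simp add: clamp01_def)

lemma clamp01_range: "0 \<le> clamp01 t" "clamp01 t \<le> 1"
  by (auto simp: clamp01_def)

lemma clamp01_dist: "\<bar>clamp01 t - clamp01 s\<bar> \<le> \<bar>t - s\<bar>" "\<bar>clamp01 t - clamp01 s\<bar> \<le> 1"
  by (auto simp: clamp01_def max_def min_def)

text \<open>All branches are imposed on one \<open>f\<close>, so the Hoelder condition has to be
  checked between points of different branches as well. Two comparisons suffice: the clock bounds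
  changes of one \<open>u m\<close> in time, and the sixth coordinate separates branches of
  different height.\<close>

lemma infinitely_many_path_solutions:
  fixes w :: "real \<Rightarrow> real ^ 6" and a :: "6 \<Rightarrow> 6 \<Rightarrow> real \<Rightarrow> real \<Rightarrow> real" and \<sigma> :: "nat \<Rightarrow> real"
  assumes \<epsilon>: "0 < \<epsilon>" "\<epsilon> < 1" and \<alpha>: "2 - \<epsilon> < \<alpha>" "\<alpha> < 2" and w0: "w 0 = 0"
    and climbing: "climbing (\<lambda>t. w (clamp01 t) $ 6) c q K"
    and bdd: "\<And>t. 0 \<le> t \<Longrightarrow> t \<le> 1 \<Longrightarrow> norm (w t) \<le> c"
    and climb: "\<And>m. climbing.climbable (\<lambda>t. w (clamp01 t) $ 6) c K \<alpha> (\<sigma> m)"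
    and \<sigma>: "0 \<le> \<sigma> 0" "\<And>m. \<sigma> m < \<sigma> (Suc m)" "\<And>m. \<sigma> m < 1"
    and sep: "\<And>s t. \<sigma> 0 \<le> s \<Longrightarrow> s < t \<Longrightarrow> t \<le> 1 \<Longrightarrow>
      (\<And>i. i \<noteq> 6 \<Longrightarrow> \<bar>w t $ i - w s $ i\<bar> < (t - s) powr (1 / \<alpha>)) \<Longrightarrow> K \<inter> {s<..<t} = {}"
  shows "\<exists>f :: real ^ 6 \<Rightarrow> real. compact (closure {x. f x \<noteq> 0}) \<and> C_2_minus \<epsilon> f \<and>
    infinite {y \<in> extensional {0..1}. is_path_solution w a (last_coord_system f) 1 0 y}"
proof -
  define B where "B = (\<lambda>t. w (clamp01 t) $ 6)"
  interpret climbing B c q K using climbing by (simp add: B_def)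
  obtain e H g where e: "\<And>m. \<sigma> m < e m" "\<And>m. e m < \<sigma> (Suc m)"
    and br: "\<And>m. branch \<alpha> (\<sigma> m) (e m) (H m) (g m)"
    and half: "\<And>l m t. l < m \<Longrightarrow> 0 \<le> t \<Longrightarrow> Y (g m) 0 t \<le> H l / 2"
    using branches[of \<alpha> \<sigma>] climb \<sigma>(2) unfolding B_def by metis
  define u where "u m t = U (g m) 0 t" for m t
  define y where "y m t = Y (g m) 0 t" for m t
  have \<alpha>0: "0 < \<alpha>" using \<epsilon> \<alpha> by linarith
  have g: "adm (g m)" and H: "0 < H m" for m using br by (auto simp: branch_def)
  have before: "u m t = 0" "y m t = 0" if "0 \<le> t" "t \<le> \<sigma> m" for m t
    using br[of m] that by (auto simp: branch_def u_def y_def)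
  have after: "u m t = 0" "y m t = H m" if "0 \<le> t" "e m \<le> t" for m t
    using br[of m] that by (auto simp: branch_def u_def y_def)
  have u_le: "\<bar>u m t\<bar> \<le> y m t powr \<alpha>" and y0: "0 \<le> y m t" if "0 \<le> t" for m t
    using br[of m] that by (auto simp: branch_def u_def y_def)
  have \<sigma>_mono: "\<sigma> l \<le> \<sigma> m" if "l \<le> m" for l m
    using lift_Suc_mono_le[of \<sigma>, OF less_imp_le[OF \<sigma>(2)] that] .
  define p where "p x = (\<chi> i. if i = 6 then y (fst x) (snd x) else w (snd x) $ i)" for x :: "nat \<times> real"
  have p6: "p x $ 6 = y (fst x) (snd x)" and pi: "i \<noteq> 6 \<Longrightarrow> p x $ i = w (snd x) $ i" for x i
    by (auto simp: p_def)
  have coord: "\<bar>p x $ i - p z $ i\<bar> \<le> dist (p x) (p z)" for x z i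
    using component_le_norm_cart[of "p x - p z" i] by (simp add: dist_norm)
  \<comment> \<open>Only the first five coordinates enter, so the two points may lie on any branches
    \<open>j\<close> and \<open>k\<close>.\<close>
  have close: "\<bar>u m t - u m s\<bar> \<le> dist (p (j, s)) (p (k, t)) powr \<alpha>"
    if st: "\<sigma> 0 \<le> s" "s < t" "t \<le> 1" for m j k s t
  proof -
    have diff: "u m t - u m s = U (g m) s t"
      using U_add[OF g, of 0 s t m] st \<sigma> by (simp add: u_def)
    show ?thesis
    proof (cases "\<forall>i. i \<noteq> 6 \<longrightarrow> \<bar>w t $ i - w s $ i\<bar> < (t - s) powr (1 / \<alpha>)")
      case True
      then have "K \<inter> {s<..<t} = {}" using sep st by blast
      then show ?thesis using U_eq_0_of_disjoint[OF g] diff by simp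
    next
      case False
      then obtain i where i: "i \<noteq> 6" "(t - s) powr (1 / \<alpha>) \<le> \<bar>w t $ i - w s $ i\<bar>" by force
      have "\<bar>w t $ i - w s $ i\<bar> \<le> dist (p (j, s)) (p (k, t))"
        using coord[of "(j, s)" i "(k, t)"] i by (simp add: pi)
      then have "((t - s) powr (1 / \<alpha>)) powr \<alpha> \<le> dist (p (j, s)) (p (k, t)) powr \<alpha>"
        using i \<alpha>0 by (intro powr_mono2) auto
      moreover have "((t - s) powr (1 / \<alpha>)) powr \<alpha> = t - s" using st \<alpha>0 by (simp add: powr_powr)
      ultimately show ?thesis using U_abs_le[OF g, of s t m] st diff by simp
    qed
  qed
  have close': "\<bar>u m t - u m s\<bar> \<le> dist (p (j, s)) (p (k, t)) powr \<alpha>"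
    if "\<sigma> 0 \<le> s" "\<sigma> 0 \<le> t" "s \<le> 1" "t \<le> 1" for m j k s t
    using close[of s t m j k] close[of t s m k j] that
    by (cases s t rule: linorder_cases) (auto simp: abs_minus_commute dist_commute)
  \<comment> \<open>If \<open>u m s = 0\<close>, the clock bounds \<open>u m t - u m s\<close>.
    Otherwise branch \<open>m\<close> is active at \<open>s\<close>, and branch \<open>l\<close> is
    then either finished, at height \<open>H l \<ge> 2 * y m t\<close>, or not yet started, at
    height 0: the gap in the sixth coordinate is at least \<open>y m t\<close>, and
    \<open>\<bar>u m t\<bar> \<le> y m t powr \<alpha>\<close>.\<close>
  have cross: "\<bar>u m t\<bar> \<le> dist (p (m, t)) (p (l, s)) powr \<alpha>"
    if "l \<noteq> m" and t: "0 \<le> t" "t \<le> 1" and s: "0 \<le> s" "s \<le> 1" for m l s t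
  proof (cases "u m t = 0")
    case False
    have gap: ?thesis if "y m t \<le> \<bar>y m t - y l s\<bar>"
    proof -
      have "y m t \<le> dist (p (m, t)) (p (l, s))" using that coord[of "(m, t)" 6 "(l, s)"] by (simp add: p6)
      then have "y m t powr \<alpha> \<le> dist (p (m, t)) (p (l, s)) powr \<alpha>"
        using y0 t \<alpha>0 by (intro powr_mono2) auto
      then show ?thesis using u_le[OF t(1), of m] by linarith
    qed
    have tm: "\<sigma> m < t" using before[OF t(1), of m] False by force
    consider "s < \<sigma> 0" | "\<sigma> 0 \<le> s" "u m s = 0" | "\<sigma> 0 \<le> s" "u m s \<noteq> 0" by linarith
    then show ?thesis
    proof cases
      case 1
      then have "y l s = 0" using \<sigma>_mono[of 0 l] s by (intro before) auto
      then show ?thesis using gap by simp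
    next
      case 2
      then show ?thesis using close'[of s t m l m] t s tm \<sigma>_mono[of 0 m] by (simp add: dist_commute)
    next
      case 3
      have sm: "\<sigma> m < s" "s < e m" using before[OF s(1), of m] after[OF s(1), of m] 3 by force+
      show ?thesis
      proof (cases "l < m")
        case True
        then have "e l \<le> s" using e(2)[of l] \<sigma>_mono[of "Suc l" m] sm by simp
        then have "y l s = H l" using s by (intro after)
        then show ?thesis using gap half[OF True t(1)] y0[OF t(1), of m] by (simp add: y_def)
      next
        case False
        then have "s \<le> \<sigma> l" using e(2)[of m] \<sigma>_mono[of "Suc m" l] sm \<open>l \<noteq> m\<close> by simp
        then have "y l s = 0" using s by (intro before)
        then show ?thesis using gap by simp
      qed
    qed
  qed simp
  define I where "I = (UNIV :: nat set) \<times> {0..1::real}"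
  define F where "F x = u (fst x) (snd x)" for x :: "nat \<times> real"
  have holder: "\<bar>F x - F z\<bar> \<le> 2 * dist (p x) (p z) powr \<alpha>" if "x \<in> I" "z \<in> I" for x z
  proof -
    obtain m t l s where xz: "x = (m, t)" "z = (l, s)" by (metis prod.exhaust)
    have t: "0 \<le> t" "t \<le> 1" and s: "0 \<le> s" "s \<le> 1" using that xz by (auto simp: I_def)
    show ?thesis
    proof (cases "l = m")
      case False
      then show ?thesis
        using cross[OF False t s] cross[OF False[symmetric] s t]
        by (simp add: F_def xz dist_commute)
    next
      case True
      \<comment> \<open>Before \<open>\<sigma> 0\<close> nothing is assumed on close pairs, but
        there every branch is still at 0 and the height of the other point decides.\<close>
      have early: "\<bar>u m t\<bar> \<le> dist (p (m, t)) (p (m, s)) powr \<alpha>"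
        if "s < \<sigma> 0" and t: "0 \<le> t" "t \<le> 1" and s: "0 \<le> s" "s \<le> 1" for s t
      proof -
        have "y m s = 0" using that \<sigma>_mono[of 0 m] by (intro before) auto
        then have "y m t \<le> dist (p (m, t)) (p (m, s))" using coord[of "(m, t)" 6 "(m, s)"] by (simp add: p6)
        then have "y m t powr \<alpha> \<le> dist (p (m, t)) (p (m, s)) powr \<alpha>"
          using y0 t \<alpha>0 by (intro powr_mono2) auto
        then show ?thesis using u_le[OF t(1), of m] by linarith
      qed
      have z: "r < \<sigma> 0 \<Longrightarrow> 0 \<le> r \<Longrightarrow> u m r = 0" for r using \<sigma>_mono[of 0 m] by (intro before) auto
      consider "s < \<sigma> 0" | "t < \<sigma> 0" | "\<sigma> 0 \<le> s" "\<sigma> 0 \<le> t" by linarith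
      then have "\<bar>u m t - u m s\<bar> \<le> dist (p (m, t)) (p (m, s)) powr \<alpha>"
      proof cases
        case 1
        then show ?thesis using early[OF 1 t s] z[OF 1 s(1)] by simp
      next
        case 2
        then show ?thesis using early[OF 2 s t] z[OF 2 t(1)] by (simp add: dist_commute)
      next
        case 3
        then show ?thesis using close'[of s t m m m] s t by (simp add: dist_commute)
      qed
      moreover have "0 \<le> dist (p (m, t)) (p (m, s)) powr \<alpha>" by simp
      ultimately show ?thesis unfolding F_def xz True fst_conv snd_conv by linarith
    qed
  qed
  have F_bdd: "\<bar>F x\<bar> \<le> 1" if "x \<in> I" for x
    using U_abs_le[OF g, of 0 "snd x" "fst x"] that by (auto simp: F_def u_def I_def)
  have p_bdd: "norm (p x) \<le> 6 * c" if "x \<in> I" for x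
  proof -
    have x: "0 \<le> snd x" "snd x \<le> 1" using that by (auto simp: I_def)
    have "\<bar>p x $ k - 0 $ k\<bar> \<le> c" for k
    proof (cases "k = 6")
      case True
      have "\<bar>Y (g (fst x)) 0 (snd x)\<bar> \<le> c * (snd x - 0)" using x by (intro Y_abs_le g)
      also have "\<dots> \<le> c * 1" using x c by (intro mult_left_mono) auto
      finally show ?thesis using True by (simp add: p6 y_def)
    next
      case False
      then show ?thesis using component_le_norm_cart[of "w (snd x)" k] bdd[OF x] by (simp add: pi)
    qed
    from dist_le_cart[OF this] show ?thesis by simp
  qed
  obtain f where f: "compact (closure {x. f x \<noteq> 0})" "C_2_minus \<epsilon> f"
    "\<And>x. x \<in> I \<Longrightarrow> f (p x) = F x" "\<And>x h. x \<in> I \<Longrightarrow> partial_deriv h f (p x) = 0"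
    using whitney_flat_extension[of \<epsilon> \<alpha> 2 I p "6 * c" F 1,
        OF \<epsilon>(1) \<alpha>(1) \<epsilon>(2) \<alpha>(2) _ p_bdd F_bdd holder] zero_le_numeral by blast
  \<comment> \<open>Restriction makes the solutions extensional, so that distinct ones differ on
    [0, 1].\<close>
  define sol where "sol m = restrict (\<lambda>t. p (m, t)) {0..1}" for m
  have sol: "is_path_solution w a (last_coord_system f) 1 0 (sol m)" for m
    unfolding is_path_solution_def
  proof (intro conjI exI allI impI)
    show "sol m 0 = 0"
      using before(2)[of 0 m] \<sigma>_mono[of 0 m] \<sigma>(1) by (simp add: sol_def p_def w0 vec_eq_iff)
    show "continuous_on {0..1} (\<lambda>t::real. t)" by simp
    show "strict_mono_on {0..1} (\<lambda>t::real. t)" by (simp add: strict_mono_on_def)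
    show "(\<lambda>\<delta>. c * \<bar>\<delta>\<bar> powr (1 + q)) \<in> o[at_right 0](\<lambda>\<delta>. \<delta>)" by (rule powr_in_smallo_id[OF q])
    show "0 \<le> c * \<bar>\<delta>\<bar> powr (1 + q)" for \<delta> :: real using c by simp
    fix i :: 6 and s t :: real assume st: "0 \<le> s \<and> s < t \<and> t \<le> 1"
    then have ms: "(m, s) \<in> I" and sol_eq: "sol m s = p (m, s)" "sol m t = p (m, t)"
      by (auto simp: I_def sol_def)
    have pd: "partial_deriv h (last_coord_system f i j) (p (m, s)) = 0" for h j
      using f(4)[OF ms, of h]
      by (cases "i = j"; cases "i = 6") (simp_all add: last_coord_system_def partial_deriv_const)
    have sum: "(\<Sum>j\<in>UNIV. last_coord_system f i j (p (m, s)) * (w t $ j - w s $ j))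
        = last_coord_system f i i (p (m, s)) * (w t $ i - w s $ i)"
      by (subst sum.remove[of _ i]) (auto simp: last_coord_system_def intro!: sum.neutral)
    have "\<bar>p (m, t) $ i - p (m, s) $ i - last_coord_system f i i (p (m, s)) * (w t $ i - w s $ i)\<bar>
        \<le> c * \<bar>t - s\<bar> powr (1 + q)"
    proof (cases "i = 6")
      case True
      have "y m t = y m s + u m s * (B t - B s) + Y (g m) s t"
        unfolding u_def y_def using st by (intro Y_add g) auto
      moreover have "last_coord_system f i i (p (m, s)) = u m s"
        using f(3)[OF ms] True by (simp add: last_coord_system_def F_def)
      moreover have "w t $ i - w s $ i = B t - B s" using st True by (simp add: B_def)
      ultimately have "p (m, t) $ i - p (m, s) $ i - last_coord_system f i i (p (m, s)) * (w t $ i - w s $ i)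
          = Y (g m) s t"
        using True by (simp add: p6)
      then show ?thesis using Y_abs_le_powr[OF g, of s t m] st by simp
    next
      case False
      then show ?thesis using c by (simp add: last_coord_system_def pi)
    qed
    then show "\<bar>sol m t $ i - sol m s $ i
        - (\<Sum>j\<in>UNIV. last_coord_system f i j (sol m s) * (w t $ j - w s $ j))
        - (\<Sum>h\<in>UNIV. \<Sum>r\<in>UNIV. \<Sum>j\<in>UNIV. last_coord_system f h r (sol m s)
            * partial_deriv h (last_coord_system f i j) (sol m s) * a r j s t)\<bar>
        \<le> c * \<bar>t - s\<bar> powr (1 + q)"
      by (simp only: sol_eq sum pd) simp
  qed
  \<comment> \<open>The solutions are told apart by their heights at time 1.\<close>
  have "H m < H l" if "l < m" for l m
  proof -
    have "y m 1 = H m" using e(2)[of m] \<sigma>(3)[of "Suc m"] by (intro after) auto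
    then show ?thesis using half[OF that, of 1] H[of l] by (simp add: y_def)
  qed
  then have "inj H" by (metis injI less_irrefl nat_neq_iff)
  moreover have "sol m 1 $ 6 = H m" for m
    using e(2)[of m] \<sigma>(3)[of "Suc m"] after(2)[of 1 m] by (simp add: sol_def p6)
  ultimately have "inj sol" by (metis (no_types, lifting) injD injI)
  then have "infinite (range sol)" by (rule range_inj_infinite)
  moreover have "range sol \<subseteq> {y \<in> extensional {0..1}. is_path_solution w a (last_coord_system f) 1 0 y}"
    using sol by (auto simp: sol_def)
  ultimately have "infinite {y \<in> extensional {0..1}. is_path_solution w a (last_coord_system f) 1 0 y}"
    using infinite_super by blast
  then show ?thesis using f(1,2) by blast
qed

section \<open>Close pairs on a Brownian path\<close>

lemma prod_Basis_cart:
  fixes f :: "'n::finite \<Rightarrow> real \<Rightarrow> ennreal" and x :: "real ^ 'n"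
  defines "idx \<equiv> \<lambda>b :: real ^ 'n. THE i. b = axis i 1"
  shows "(\<Prod>b\<in>Basis. f (idx b) (x \<bullet> b)) = (\<Prod>i\<in>UNIV. f i (x $ i))"
    and "(\<Prod>b\<in>(Basis :: (real ^ 'n) set). c (idx b)) = (\<Prod>i\<in>UNIV. c i :: ennreal)"
proof -
  have idx: "idx (axis i 1) = i" for i by (auto simp: idx_def axis_eq_axis)
  have B: "(Basis :: (real ^ 'n) set) = range (\<lambda>i. axis i 1)" by (auto simp: Basis_vec_def)
  have inj: "inj (\<lambda>i. axis i 1 :: real ^ 'n)" by (auto simp: inj_def axis_eq_axis)
  show "(\<Prod>b\<in>Basis. f (idx b) (x \<bullet> b)) = (\<Prod>i\<in>UNIV. f i (x $ i))"
    unfolding B by (subst prod.reindex[OF inj]) (simp add: idx inner_axis)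
  show "(\<Prod>b\<in>(Basis :: (real ^ 'n) set). c (idx b)) = (\<Prod>i\<in>UNIV. c i)"
    unfolding B by (subst prod.reindex[OF inj]) (simp add: idx)
qed

lemma nn_integral_lborel_cart_prod:
  fixes f :: "'n::finite \<Rightarrow> real \<Rightarrow> ennreal"
  assumes [measurable]: "\<And>i. f i \<in> borel_measurable borel"
  shows "(\<integral>\<^sup>+ x. (\<Prod>i\<in>UNIV. f i (x $ i)) \<partial>lborel) = (\<Prod>i\<in>UNIV. \<integral>\<^sup>+ y. f i y \<partial>lborel)"
proof -
  define idx where "idx = (\<lambda>b :: real ^ 'n. THE i. b = axis i 1)"
  have "(\<integral>\<^sup>+ x. (\<Prod>i\<in>UNIV. f i (x $ i)) \<partial>lborel)
      = (\<integral>\<^sup>+ x. (\<Prod>b\<in>Basis. f (idx b) (x \<bullet> b)) \<partial>lborel)"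
    unfolding idx_def by (simp only: prod_Basis_cart)
  also have "\<dots> = (\<Prod>b\<in>Basis. \<integral>\<^sup>+ y. f (idx b) y \<partial>lborel)"
    by (rule nn_integral_lborel_prod) auto
  also have "\<dots> = (\<Prod>i\<in>UNIV. \<integral>\<^sup>+ y. f i y \<partial>lborel)"
    unfolding idx_def by (rule prod_Basis_cart(2))
  finally show ?thesis .
qed

lemma normal_density_le: "0 < \<sigma> \<Longrightarrow> normal_density 0 \<sigma> x \<le> 1 / (2 * \<sigma>)"
proof -
  assume \<sigma>: "0 < \<sigma>"
  have "(2 * \<sigma>)\<^sup>2 \<le> 2 * pi * \<sigma>\<^sup>2"
    using pi_ge_two by (simp add: power2_eq_square mult_right_mono)
  then have "2 * \<sigma> \<le> sqrt (2 * pi * \<sigma>\<^sup>2)" by (rule real_le_rsqrt)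
  then have "1 / sqrt (2 * pi * \<sigma>\<^sup>2) \<le> 1 / (2 * \<sigma>)" using \<sigma> by (intro divide_left_mono) auto
  moreover have "exp (- (x - 0)\<^sup>2 / (2 * \<sigma>\<^sup>2)) \<le> 1" by simp
  ultimately have "1 / sqrt (2 * pi * \<sigma>\<^sup>2) * exp (- (x - 0)\<^sup>2 / (2 * \<sigma>\<^sup>2)) \<le> 1 / (2 * \<sigma>) * 1"
    using \<sigma> by (intro mult_mono) auto
  then show ?thesis by (simp add: normal_density_def)
qed

lemma normal_interval_le:
  assumes "0 < \<sigma>" "0 \<le> r"
  shows "(\<integral>\<^sup>+ y. ennreal (normal_density 0 \<sigma> y) * indicator {-r..r} y \<partial>lborel) \<le> ennreal (r / \<sigma>)"
proof -
  have "(\<integral>\<^sup>+ y. ennreal (normal_density 0 \<sigma> y) * indicator {-r..r} y \<partial>lborel)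
      \<le> (\<integral>\<^sup>+ y. ennreal (1 / (2 * \<sigma>)) * indicator {-r..r} y \<partial>lborel)"
    using normal_density_le[OF assms(1)] by (intro nn_integral_mono mult_right_mono ennreal_leI) auto
  also have "\<dots> = ennreal (1 / (2 * \<sigma>)) * ennreal (2 * r)"
    using assms by (subst nn_integral_cmult_indicator) auto
  also have "\<dots> = ennreal (r / \<sigma>)" using assms by (simp add: ennreal_mult[symmetric])
  finally show ?thesis .
qed

lemma nn_integral_normal_density: "0 < \<sigma> \<Longrightarrow> (\<integral>\<^sup>+ y. ennreal (normal_density 0 \<sigma> y) \<partial>lborel) = 1"
  using prob_space.emeasure_space_1[OF prob_space_normal_density[of \<sigma> 0]]
  by (simp add: emeasure_density)

lemma borel_measurable_vec_nth' [measurable]: "(\<lambda>x :: real ^ 'n::finite. x $ i) \<in> borel_measurable borel"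
  by (intro borel_measurable_continuous_onI continuous_on_component continuous_on_id)

context standard_brownian_motion
begin

lemma increment_box_measurable:
  assumes "0 \<le> s" "0 \<le> t"
  shows "{\<omega> \<in> space M. \<forall>i\<in>S. \<bar>W t \<omega> $ i - W s \<omega> $ i\<bar> \<le> r} \<in> events"
proof -
  note [measurable] = measurable_at[OF assms(1)] measurable_at[OF assms(2)]
  have "(\<lambda>\<omega>. W t \<omega> $ i) \<in> borel_measurable M" "(\<lambda>\<omega>. W s \<omega> $ i) \<in> borel_measurable M" for i
    by measurable
  note [measurable] = this
  show ?thesis by measurable
qed

text \<open>The coordinates in \<open>S\<close> contribute a factor \<open>r / \<sigma>\<close>
  each, the density bound \<open>1 / (2 * \<sigma>)\<close> times the length \<open>2 * r\<close>;
  the others integrate to 1.\<close>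

lemma increment_box_prob:
  assumes s: "0 \<le> s" "s < t" and r: "0 \<le> r"
  shows "prob {\<omega> \<in> space M. \<forall>i\<in>S. \<bar>W t \<omega> $ i - W s \<omega> $ i\<bar> \<le> r} \<le> (r / sqrt (t - s)) ^ card S"
proof -
  define \<sigma> where "\<sigma> = sqrt (t - s)"
  have \<sigma>: "0 < \<sigma>" using s by (simp add: \<sigma>_def)
  define box where "box = {x :: real ^ 'd. \<forall>i\<in>S. \<bar>x $ i\<bar> \<le> r}"
  have box: "box \<in> sets lborel" unfolding box_def by measurable
  define \<phi> where "\<phi> i y = ennreal (normal_density 0 \<sigma> y) * (if i \<in> S then indicator {-r..r} y else 1)"
    for i :: 'd and y
  have eq: "ennreal (\<Prod>i\<in>UNIV. normal_density 0 \<sigma> (x $ i)) * indicator box x = (\<Prod>i\<in>UNIV. \<phi> i (x $ i))"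
    for x :: "real ^ 'd"
  proof -
    have "indicator box x = (\<Prod>i\<in>UNIV. if i \<in> S then indicator {-r..r} (x $ i) else (1 :: ennreal))"
    proof (cases "x \<in> box")
      case True
      then show ?thesis by (intro prod.neutral[symmetric, THEN trans[rotated]])
          (auto simp: box_def indicator_def abs_le_iff minus_le_iff)
    next
      case False
      then obtain i where "i \<in> S" "\<not> \<bar>x $ i\<bar> \<le> r" by (auto simp: box_def)
      then have "(\<Prod>i\<in>UNIV. if i \<in> S then indicator {-r..r} (x $ i) else (1 :: ennreal)) = 0"
        by (intro prod_zero) (auto intro!: exI[of _ i] simp: indicator_def)
      then show ?thesis using False by simp
    qed
    then show ?thesis by (simp add: \<phi>_def prod.distrib prod_ennreal)
  qed
  have "emeasure M ((\<lambda>\<omega>. W t \<omega> - W s \<omega>) -` box \<inter> space M)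
      = (\<integral>\<^sup>+ x. ennreal (\<Prod>i\<in>UNIV. normal_density 0 \<sigma> (x $ i)) * indicator box x \<partial>lborel)"
    unfolding \<sigma>_def by (rule distributed_emeasure[OF normal_increments[OF s] box])
  also have "\<dots> = (\<Prod>i\<in>UNIV. \<integral>\<^sup>+ y. \<phi> i y \<partial>lborel)"
    unfolding eq by (rule nn_integral_lborel_cart_prod) (simp add: \<phi>_def)
  also have "\<dots> \<le> (\<Prod>i\<in>UNIV. if i \<in> S then ennreal (r / \<sigma>) else 1)"
    using normal_interval_le[OF \<sigma> r] nn_integral_normal_density[OF \<sigma>]
    by (intro prod_mono_ennreal) (auto simp: \<phi>_def)
  also have "\<dots> = ennreal (r / \<sigma>) ^ card S"
    by (subst prod.If_cases) (auto simp: prod.If_cases)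
  also have "\<dots> = ennreal ((r / \<sigma>) ^ card S)" using r \<sigma> by (simp add: ennreal_power)
  finally have "emeasure M ((\<lambda>\<omega>. W t \<omega> - W s \<omega>) -` box \<inter> space M) \<le> ennreal ((r / \<sigma>) ^ card S)" .
  moreover have "(\<lambda>\<omega>. W t \<omega> - W s \<omega>) -` box \<inter> space M
      = {\<omega> \<in> space M. \<forall>i\<in>S. \<bar>W t \<omega> $ i - W s \<omega> $ i\<bar> \<le> r}"
    by (auto simp: box_def)
  ultimately show ?thesis using r \<sigma> by (simp add: emeasure_eq_measure \<sigma>_def)
qed

end

text \<open>Markov's inequality for the number of occurring events, which tolerates any dependence
  between them; neighbouring cells do involve the same stretches of the path.\<close>

lemma (in prob_space) prob_many_le:
  assumes E: "\<And>k. k < N \<Longrightarrow> E k \<in> events" and \<pi>: "\<And>k. k < N \<Longrightarrow> prob (E k) \<le> \<pi>" and N: "0 < N"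
  defines "A \<equiv> {\<omega> \<in> space M. N \<le> 2 * card {k. k < N \<and> \<omega> \<in> E k}}"
  shows "A \<in> events" and "prob A \<le> 2 * \<pi>"
proof -
  define u where "u \<omega> = (\<Sum>k<N. indicator (E k) \<omega> :: ennreal)" for \<omega>
  have u [measurable]: "u \<in> borel_measurable M" unfolding u_def using E by measurable
  have card: "u \<omega> = of_nat (card {k. k < N \<and> \<omega> \<in> E k})" for \<omega>
  proof -
    have "u \<omega> = (\<Sum>k\<in>{k. k < N \<and> \<omega> \<in> E k}. 1)"
      unfolding u_def by (rule sum.mono_neutral_cong_right) auto
    then show ?thesis by simp
  qed
  have "(1 \<le> ennreal (2 / N) * u \<omega>) \<longleftrightarrow> N \<le> 2 * card {k. k < N \<and> \<omega> \<in> E k}" for \<omega>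
  proof -
    have "ennreal (2 / N) * u \<omega> = ennreal (2 / N * card {k. k < N \<and> \<omega> \<in> E k})"
      unfolding card ennreal_of_nat_eq_real_of_nat by (rule ennreal_mult[symmetric]) auto
    then have "(1 \<le> ennreal (2 / N) * u \<omega>) \<longleftrightarrow> 1 \<le> 2 / N * card {k. k < N \<and> \<omega> \<in> E k}"
      by simp
    also have "\<dots> \<longleftrightarrow> real N \<le> real (2 * card {k. k < N \<and> \<omega> \<in> E k})"
      using N by (simp add: field_simps)
    finally show ?thesis by (simp only: of_nat_le_iff)
  qed
  then have A: "A = {\<omega> \<in> space M. 1 \<le> ennreal (2 / N) * u \<omega>}"
    unfolding A_def by auto
  show "A \<in> events" unfolding A by measurable
  have "0 \<le> \<pi>" using \<pi>[OF N] measure_nonneg[of M "E 0"] by linarith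
  have "emeasure M A \<le> ennreal (2 / N) * (\<integral>\<^sup>+ \<omega>. u \<omega> * indicator (space M) \<omega> \<partial>M)"
    unfolding A by (rule nn_integral_Markov_inequality) auto
  also have "(\<integral>\<^sup>+ \<omega>. u \<omega> * indicator (space M) \<omega> \<partial>M) = (\<integral>\<^sup>+ \<omega>. u \<omega> \<partial>M)"
    by (intro nn_integral_cong) auto
  also have "\<dots> = (\<Sum>k<N. emeasure M (E k))"
    unfolding u_def using E by (subst nn_integral_sum) auto
  also have "\<dots> \<le> (\<Sum>k<N. ennreal \<pi>)"
    using \<pi> by (intro sum_mono) (auto simp: emeasure_eq_measure intro: ennreal_leI)
  also have "\<dots> = ennreal (N * \<pi>)"
    using \<open>0 \<le> \<pi>\<close> by (simp add: ennreal_of_nat_eq_real_of_nat ennreal_mult)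
  also have "ennreal (2 / N) * ennreal (N * \<pi>) = ennreal (2 * \<pi>)"
    using N \<open>0 \<le> \<pi>\<close> by (subst ennreal_mult[symmetric]) auto
  finally have "emeasure M A \<le> ennreal (2 * \<pi>)" by (simp add: mult_left_mono)
  then show "prob A \<le> 2 * \<pi>" using \<open>0 \<le> \<pi>\<close> by (simp add: emeasure_eq_measure)
qed

section \<open>Close pairs at one dyadic scale\<close>

locale brownian6 = standard_brownian_motion M W
  for M :: "'a measure" and W :: "real \<Rightarrow> 'a \<Rightarrow> real ^ 6" +
  fixes \<delta> :: real
  assumes \<delta>: "0 < \<delta>"
begin

text \<open>A mesh of width about \<open>2 powr (- (1 + x) * j)\<close> must be so fine that a path
  of exponent just below 1/2 moves at most \<open>\<rho> j\<close> in one step, which asks for x > 2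
  \<delta>, and so coarse that the number of pairs, about \<open>2 powr (2 * x * j)\<close>, does
  not outweigh \<open>2 powr (- 5 * \<delta> * j)\<close>, which asks for 2 x < 5 \<delta>. The
  choice 9 \<delta> / 4 is the midpoint.\<close>

definition depth :: "nat \<Rightarrow> nat" where "depth j = nat \<lceil>9 * \<delta> * j / 4\<rceil>"

definition mesh :: "nat \<Rightarrow> nat" where "mesh j = j + 2 + depth j"

definition \<rho> :: "nat \<Rightarrow> real" where "\<rho> j = 2 powr (- (1/2 + \<delta>) * j)"

definition \<kappa> :: real where "\<kappa> = 2 powr (- \<delta> / 2)"

lemma \<kappa>: "0 < \<kappa>" "\<kappa> < 1"
  using \<delta> powr_less_mono[of "- \<delta> / 2" 0 2] by (auto simp: \<kappa>_def)

text \<open>A block of length \<open>1 / 2 ^ j\<close> has \<open>4 * 2 ^ depth j\<close> mesh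
  steps; the pairs range over block \<open>k\<close> and its two neighbours and are at least a
  quarter block apart. The lower bound for \<open>a\<close> is written additively to avoid truncated
  subtraction.\<close>

definition grid_pairs :: "nat \<Rightarrow> nat \<Rightarrow> (nat \<times> nat) set" where
  "grid_pairs j k = {(a, b). 4 * k * 2 ^ depth j \<le> a + 4 * 2 ^ depth j
     \<and> b \<le> 4 * (k + 2) * 2 ^ depth j \<and> a + 2 ^ depth j \<le> b}"

text \<open>The tolerance \<open>3 * \<rho> j\<close> is \<open>\<rho> j\<close> for the pair itself
  and \<open>\<rho> j\<close> for rounding each endpoint to the mesh.\<close>

definition pair_event :: "nat \<Rightarrow> nat \<times> nat \<Rightarrow> 'a set" where
  "pair_event j ab = {\<omega> \<in> space M. \<forall>i\<in>- {6}.
     \<bar>W (real (snd ab) / 2 ^ mesh j) \<omega> $ i - W (real (fst ab) / 2 ^ mesh j) \<omega> $ i\<bar> \<le> 3 * \<rho> j}"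

text \<open>Near the dyadic block \<open>[k/2^j, (k+1)/2^j]\<close> two mesh points at distance about \<open>2^(-j)\<close> have
  images that are atypically close in the first five coordinates.\<close>

definition Z :: "nat \<Rightarrow> nat \<Rightarrow> 'a set" where
  "Z j k = (\<Union>ab\<in>grid_pairs j k. pair_event j ab)"

lemma grid_pairs:
  shows "finite (grid_pairs j k)" and "real (card (grid_pairs j k)) \<le> 169 * 4 ^ depth j"
proof -
  define m :: nat where "m = 2 ^ depth j"
  define A where "A = {4 * k * m - 4 * m..4 * (k + 2) * m}"
  have sub: "grid_pairs j k \<subseteq> A \<times> A"
    unfolding grid_pairs_def A_def m_def[symmetric] by auto
  then show "finite (grid_pairs j k)" by (rule finite_subset) (simp add: A_def)
  have m: "1 \<le> m" by (simp add: m_def)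
  have "card A \<le> 12 * m + 1"
  proof (cases k)
    case 0
    then show ?thesis by (simp add: A_def)
  next
    case (Suc k')
    then show ?thesis by (simp add: A_def algebra_simps)
  qed
  then have "card A \<le> 13 * m" using m by linarith
  have "card (grid_pairs j k) \<le> card (A \<times> A)" using sub by (intro card_mono) (auto simp: A_def)
  also have "\<dots> \<le> (13 * m) * (13 * m)"
    unfolding card_cartesian_product using \<open>card A \<le> 13 * m\<close> by (intro mult_mono) auto
  also have "\<dots> = 169 * (m * m)" by simp
  also have "m * m = 4 ^ depth j" by (simp add: m_def power_mult_distrib[symmetric])
  finally have "real (card (grid_pairs j k)) \<le> real (169 * 4 ^ depth j)" by (simp only: of_nat_le_iff)
  then show "real (card (grid_pairs j k)) \<le> 169 * 4 ^ depth j" by simp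
qed

lemma Z_event [measurable]: "Z j k \<in> events"
  unfolding Z_def pair_event_def
  by (intro sets.finite_UN grid_pairs increment_box_measurable) auto

text \<open>\<open>169\<close> counts mesh pairs, \<open>4\<close> pays for rounding up
  \<open>depth\<close>, and \<open>6\<close> compares \<open>3 * \<rho> j\<close> with a standard
  deviation of at least \<open>2 powr (- j / 2) / 2\<close>, once per coordinate.\<close>

definition C0 :: real where "C0 = 169 * 4 * 6 ^ 5"

lemma pair_event_prob:
  assumes "ab \<in> grid_pairs j k"
  shows "prob (pair_event j ab) \<le> (6 * 2 powr (- \<delta> * j)) ^ 5"
proof -
  obtain a b where ab: "ab = (a, b)" "a + 2 ^ depth j \<le> b" using assms by (auto simp: grid_pairs_def)
  have "real a + 2 ^ depth j \<le> real b"
    using ab(2) of_nat_le_iff[where ?'a=real, of "a + 2 ^ depth j" b] by simp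
  then have "2 ^ depth j / 2 ^ mesh j \<le> (real b - real a) / 2 ^ mesh j"
    by (intro divide_right_mono) auto
  moreover have "(2::real) ^ depth j / 2 ^ mesh j = 1 / 2 ^ (j + 2)"
    by (simp add: mesh_def power_add)
  ultimately have gap: "1 / 2 ^ (j + 2) \<le> b / 2 ^ mesh j - a / 2 ^ mesh j"
    by (simp add: diff_divide_distrib)
  have pos: "(0::real) < 1 / 2 ^ (j + 2)" by simp
  have lt: "a / 2 ^ mesh j < b / 2 ^ mesh j" using gap pos by linarith
  have "prob (pair_event j ab) \<le> (3 * \<rho> j / sqrt (b / 2 ^ mesh j - a / 2 ^ mesh j)) ^ card (- {6 :: 6})"
    unfolding pair_event_def ab fst_conv snd_conv
    using lt by (intro increment_box_prob) (auto simp: \<rho>_def)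
  also have "card (- {6 :: 6}) = 5" by (simp add: Compl_eq_Diff_UNIV card_Diff_subset)
  also have "(3 * \<rho> j / sqrt (b / 2 ^ mesh j - a / 2 ^ mesh j)) ^ 5 \<le> (6 * 2 powr (- \<delta> * j)) ^ 5"
  proof (rule power_mono)
    have "3 * \<rho> j / sqrt (b / 2 ^ mesh j - a / 2 ^ mesh j) \<le> 3 * \<rho> j / sqrt (1 / 2 ^ (j + 2))"
    proof (rule divide_left_mono)
      show "sqrt (1 / 2 ^ (j + 2)) \<le> sqrt (b / 2 ^ mesh j - a / 2 ^ mesh j)"
        using gap by (rule real_sqrt_le_mono)
      show "0 < sqrt (b / 2 ^ mesh j - a / 2 ^ mesh j) * sqrt (1 / 2 ^ (j + 2))"
        using lt by (intro mult_pos_pos) auto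
    qed (simp add: \<rho>_def)
    also have "sqrt (1 / 2 ^ (j + 2)) = 2 powr (- real j / 2) / 2"
    proof -
      have "(2 powr (- real j / 2) / 2)\<^sup>2 = 1 / 2 ^ (j + 2)"
      proof -
        have "(2 powr (- real j / 2))\<^sup>2 = 2 powr (- real j)"
          unfolding power2_eq_square by (subst powr_add[symmetric]) simp
        then show ?thesis by (simp add: power_divide powr_minus_divide powr_realpow power_add)
      qed
      then show ?thesis by (rule real_sqrt_unique) simp
    qed
    also have "3 * \<rho> j / (2 powr (- real j / 2) / 2) = 6 * (\<rho> j / 2 powr (- real j / 2))" by simp
    also have "\<rho> j / 2 powr (- real j / 2) = 2 powr (- \<delta> * j)"
      unfolding \<rho>_def by (subst powr_diff[symmetric]) (simp add: algebra_simps)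
    finally show "3 * \<rho> j / sqrt (b / 2 ^ mesh j - a / 2 ^ mesh j) \<le> 6 * 2 powr (- \<delta> * j)" .
  qed (use lt in \<open>auto simp: \<rho>_def\<close>)
  finally show ?thesis .
qed

text \<open>The five coordinates contribute \<open>2^(-5\<delta>j)\<close> and the number of mesh pairs is about
  \<open>2^(9\<delta>j/2)\<close>; in four dimensions this would fail.\<close>

lemma Z_prob: "prob (Z j k) \<le> C0 * \<kappa> ^ j"
proof -
  have "prob (Z j k) \<le> (\<Sum>ab\<in>grid_pairs j k. prob (pair_event j ab))"
    unfolding Z_def pair_event_def
    by (intro finite_measure_subadditive_finite grid_pairs) (auto intro!: increment_box_measurable)
  also have "\<dots> \<le> (\<Sum>ab\<in>grid_pairs j k. (6 * 2 powr (- \<delta> * j)) ^ 5)"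
    by (intro sum_mono pair_event_prob)
  also have "\<dots> = card (grid_pairs j k) * (6 * 2 powr (- \<delta> * j)) ^ 5" by simp
  also have "\<dots> \<le> (169 * 4 ^ depth j) * (6 * 2 powr (- \<delta> * j)) ^ 5"
    by (intro mult_right_mono grid_pairs) auto
  also have "(6 * 2 powr (- \<delta> * j)) ^ 5 = 6 ^ 5 * 2 powr (- 5 * \<delta> * j)"
    by (simp add: power_mult_distrib powr_power mult_ac)
  also have "(169 * 4 ^ depth j) * (6 ^ 5 * 2 powr (- 5 * \<delta> * j))
      \<le> (169 * (4 * 2 powr (9 * \<delta> * j / 2))) * (6 ^ 5 * 2 powr (- 5 * \<delta> * j))"
  proof (intro mult_right_mono mult_left_mono)
    have "0 \<le> 9 * \<delta> * j / 4" using \<delta> by simp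
    then have "real (depth j) \<le> 9 * \<delta> * j / 4 + 1" unfolding depth_def by linarith
    then have "2 powr (2 * real (depth j)) \<le> 2 powr (2 + 9 * \<delta> * j / 2)" by (intro powr_mono) auto
    moreover have "(4::real) ^ depth j = 2 powr (2 * real (depth j))"
    proof -
      have "(4::real) ^ depth j = (2 ^ 2) ^ depth j" by simp
      also have "\<dots> = 2 ^ (2 * depth j)" by (rule power_mult[symmetric])
      also have "\<dots> = 2 powr (2 * real (depth j))" by (simp add: powr_realpow[symmetric])
      finally show ?thesis .
    qed
    moreover have "2 powr (2 + 9 * \<delta> * j / 2) = 4 * 2 powr (9 * \<delta> * j / 2)" by (simp add: powr_add)
    ultimately show "(4::real) ^ depth j \<le> 4 * 2 powr (9 * \<delta> * j / 2)" by simp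
  qed auto
  also have "\<dots> = C0 * (2 powr (9 * \<delta> * j / 2) * 2 powr (- 5 * \<delta> * j))" by (simp add: C0_def)
  also have "2 powr (9 * \<delta> * j / 2) * 2 powr (- 5 * \<delta> * j) = 2 powr (- \<delta> / 2 * j)"
    by (subst powr_add[symmetric]) (simp add: algebra_simps)
  also have "\<dots> = \<kappa> ^ j" by (simp add: \<kappa>_def powr_power mult.commute)
  finally show ?thesis .
qed

text \<open>Both endpoints are rounded down to the mesh; a gap of more than
  \<open>2 * 2 ^ depth j\<close> steps survives as at least \<open>2 ^ depth j\<close>. The block is
  that of an arbitrary time \<open>x\<close> between the endpoints, so that a close pair is charged
  to the very times that it removes from \<open>K\<close>.\<close>

lemma close_pair_in_Z:
  assumes \<omega>: "\<omega> \<in> space M"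
    and holder: "\<And>s t i. 0 \<le> s \<Longrightarrow> s \<le> t \<Longrightarrow> t \<le> 1 \<Longrightarrow> \<bar>W t \<omega> $ i - W s \<omega> $ i\<bar> \<le> c * (t - s) powr q"
    and c: "0 \<le> c" and q: "0 < q" and fine: "c * (1 / 2 ^ mesh j) powr q \<le> \<rho> j"
    and st: "0 \<le> s" "t \<le> 1" "1 / 2 ^ Suc j < t - s" "t - s \<le> 1 / 2 ^ j"
    and close: "\<And>i. i \<noteq> 6 \<Longrightarrow> \<bar>W t \<omega> $ i - W s \<omega> $ i\<bar> < (t - s) powr (1/2 + \<delta>)"
    and x: "s < x" "x < t"
  shows "\<omega> \<in> Z j (nat \<lfloor>x * 2 ^ j\<rfloor>)"
proof -
  define k where "k = nat \<lfloor>x * 2 ^ j\<rfloor>"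
  define R :: real where "R = 2 ^ mesh j"
  define m :: real where "m = 2 ^ depth j"
  have R: "0 < R" and m: "1 \<le> m" by (auto simp: R_def m_def)
  have Rm: "R = 4 * m * 2 ^ j" by (simp add: R_def m_def mesh_def power_add)
  define a where "a = nat \<lfloor>s * R\<rfloor>"
  define b where "b = nat \<lfloor>t * R\<rfloor>"
  have t0: "0 \<le> t" and x0: "0 \<le> x" using st x by linarith+
  have fl: "real (nat \<lfloor>y\<rfloor>) \<le> y \<and> y < real (nat \<lfloor>y\<rfloor>) + 1" if "0 \<le> y" for y :: real
    using that by linarith
  have a: "a \<le> s * R" "s * R < real a + 1" and b: "b \<le> t * R" "t * R < real b + 1"
    and k: "k \<le> x * 2 ^ j" "x * 2 ^ j < real k + 1"
  proof -
    have "0 \<le> s * R" "0 \<le> t * R" "0 \<le> x * 2 ^ j" using st t0 x0 R by auto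
    then show "a \<le> s * R" "s * R < real a + 1" "b \<le> t * R" "t * R < real b + 1" "k \<le> x * 2 ^ j" "x * 2 ^ j < real k + 1"
      unfolding a_def b_def k_def by (simp_all only: fl)
  qed
  have j1: "(1 / 2 ^ j) * R = 4 * m" "(1 / 2 ^ Suc j) * R = 2 * m" using Rm by auto
  have tsR: "2 * m < (t - s) * R" "(t - s) * R \<le> 4 * m"
    using mult_strict_right_mono[OF st(3) R] mult_right_mono[OF st(4), of R] R unfolding j1 by auto
  have xR: "x * R = 4 * m * (x * 2 ^ j)" by (simp add: Rm)
  have kx: "4 * m * k \<le> x * R" "x * R < 4 * m * (real k + 1)"
    unfolding xR using k m by (auto intro!: mult_left_mono mult_strict_left_mono)
  have sx: "s * R < x * R" "x * R < t * R" using x R by auto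
  have tsR': "t * R - s * R \<le> 4 * m" "2 * m < t * R - s * R" using tsR by (auto simp: left_diff_distrib)
  have A1: "4 * k * 2 ^ depth j \<le> a + 4 * 2 ^ depth j"
  proof -
    have "4 * m * k < real a + 1 + 4 * m" using kx sx tsR' a by linarith
    then have "real (4 * k * 2 ^ depth j) < real (a + 4 * 2 ^ depth j + 1)" by (simp add: m_def mult_ac)
    then show ?thesis by (simp only: of_nat_less_iff)
  qed
  have A2: "b \<le> 4 * (k + 2) * 2 ^ depth j"
  proof -
    have "b \<le> 4 * m * (real k + 1) + 4 * m" using kx sx tsR' b by linarith
    then have "real b \<le> real (4 * (k + 2) * 2 ^ depth j)" by (simp add: m_def algebra_simps)
    then show ?thesis by (simp only: of_nat_le_iff)
  qed
  have A3: "a + 2 ^ depth j \<le> b"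
  proof -
    have "real a + m < real b + 1" using tsR' a b m by linarith
    then have "real (a + 2 ^ depth j) < real (b + 1)" by (simp add: m_def)
    then show ?thesis by (simp only: of_nat_less_iff)
  qed
  have ab: "(a, b) \<in> grid_pairs j k" using A1 A2 A3 by (simp add: grid_pairs_def)
  have near: "\<bar>W u \<omega> $ i - W (v / R) \<omega> $ i\<bar> \<le> \<rho> j"
    if u: "0 \<le> u" "u \<le> 1" and v: "0 \<le> v" "v \<le> u * R" "u * R < v + 1" for u v i
  proof -
    have "u - v / R = (u * R - v) / R" using R by (simp add: field_simps)
    also have "\<dots> \<le> 1 / R" using v R by (intro divide_right_mono) auto
    finally have vu: "v / R \<le> u" "u - v / R \<le> 1 / R" using v R by (auto simp: field_simps)
    have "\<bar>W u \<omega> $ i - W (v / R) \<omega> $ i\<bar> \<le> c * (u - v / R) powr q"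
      using u v R vu by (intro holder) auto
    also have "\<dots> \<le> c * (1 / R) powr q" using vu c q by (intro mult_left_mono powr_mono2) auto
    also have "\<dots> \<le> \<rho> j" using fine by (simp add: R_def)
    finally show ?thesis .
  qed
  have "\<bar>W (b / R) \<omega> $ i - W (a / R) \<omega> $ i\<bar> \<le> 3 * \<rho> j" if i: "i \<noteq> 6" for i
  proof -
    have "(t - s) powr (1/2 + \<delta>) \<le> (1 / 2 ^ j) powr (1/2 + \<delta>)"
    proof (rule powr_mono2)
      show "0 \<le> t - s" using x by linarith
    qed (use st \<delta> in auto)
    also have "\<dots> = \<rho> j"
      by (simp add: \<rho>_def powr_divide powr_minus_divide powr_realpow[symmetric] powr_powr mult.commute
          flip: minus_add_distrib)
    finally have "\<bar>W t \<omega> $ i - W s \<omega> $ i\<bar> \<le> \<rho> j" using close[OF i] by linarith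
    moreover have "\<bar>W t \<omega> $ i - W (b / R) \<omega> $ i\<bar> \<le> \<rho> j"
      using t0 st b by (intro near) auto
    moreover have "\<bar>W s \<omega> $ i - W (a / R) \<omega> $ i\<bar> \<le> \<rho> j"
      using st x a by (intro near) auto
    ultimately show ?thesis by linarith
  qed
  then have "\<omega> \<in> pair_event j (a, b)" using \<omega> by (simp add: pair_event_def R_def)
  then show ?thesis using ab by (auto simp: Z_def k_def)
qed

text \<open>For a path with the Hoelder bound and \<open>n\<close> large,
  \<open>\<omega> \<in> V n x\<close> holds as soon as \<open>x\<close> lies inside a close pair of
  times in [0, 1] at distance at most \<open>1 / 2 ^ n\<close>.\<close>

definition V :: "nat \<Rightarrow> real \<Rightarrow> 'a set" where
  "V n x = (\<Union>j\<in>{n..}. Z j (nat \<lfloor>x * 2 ^ j\<rfloor>))"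

definition C1 :: real where "C1 = C0 / (1 - \<kappa>)"

lemma C01: "0 \<le> C0" "0 \<le> C1"
  using \<kappa> by (auto simp: C0_def C1_def)

lemma V_prob: "V n x \<in> events" "prob (V n x) \<le> C1 * \<kappa> ^ n"
proof -
  have V: "V n x = (\<Union>i. Z (i + n) (nat \<lfloor>x * 2 ^ (i + n)\<rfloor>))"
  proof -
    have "{n..} = range (\<lambda>i. i + n)"
      using le_Suc_ex[of n] by (auto simp: image_iff add.commute)
    then show ?thesis by (simp add: V_def image_image)
  qed
  show "V n x \<in> events" unfolding V by measurable
  have s: "summable (\<lambda>i. C0 * \<kappa> ^ (i + n))"
    using \<kappa> by (intro summable_mult summable_ignore_initial_segment[of "\<lambda>i. \<kappa> ^ i"] summable_geometric) auto
  have s': "summable (\<lambda>i. prob (Z (i + n) (nat \<lfloor>x * 2 ^ (i + n)\<rfloor>)))"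
    by (rule summable_comparison_test'[OF s]) (simp add: Z_prob)
  have "prob (V n x) \<le> (\<Sum>i. prob (Z (i + n) (nat \<lfloor>x * 2 ^ (i + n)\<rfloor>)))"
    unfolding V by (rule finite_measure_subadditive_countably[OF _ s']) auto
  also have "\<dots> \<le> (\<Sum>i. C0 * \<kappa> ^ (i + n))" by (rule suminf_le[OF Z_prob s' s])
  also have "\<dots> = (\<Sum>i. (C0 * \<kappa> ^ n) * \<kappa> ^ i)" by (simp add: power_add mult_ac)
  also have "\<dots> = C1 * \<kappa> ^ n"
    using \<kappa> by (subst suminf_mult) (auto simp: C1_def suminf_geometric intro!: summable_geometric)
  finally show "prob (V n x) \<le> C1 * \<kappa> ^ n" .
qed

lemma V_section: "\<omega> \<in> space M \<Longrightarrow> {x. \<omega> \<in> V n x} \<in> sets borel"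
proof -
  assume "\<omega> \<in> space M"
  have "{x. \<omega> \<in> V n x} = (\<Union>j\<in>{n..}. \<Union>k\<in>{k. \<omega> \<in> Z j k}. {x. nat \<lfloor>x * 2 ^ j\<rfloor> = k})"
    by (auto simp: V_def)
  also have "\<dots> \<in> sets borel"
    by (intro sets.countable_UN'' countableI_type) measurable
  finally show ?thesis .
qed

definition bad_window :: "nat \<Rightarrow> real \<Rightarrow> real \<Rightarrow> 'a set" where
  "bad_window n a l = {\<omega> \<in> space M. ennreal (l / 2) \<le> emeasure lborel ({x. \<omega> \<in> V n x} \<inter> {a..a + l})}"

text \<open>Fubini bounds the expected length of the exceptional times in the window by
  \<open>C1 * \<kappa> ^ n * l\<close>, and Markov's inequality does the rest. Joint measurability
  comes from writing \<open>Q\<close> as a countable union of rectangles.\<close>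

lemma bad_window:
  assumes l: "0 < l"
  shows "bad_window n a l \<in> events" and "prob (bad_window n a l) \<le> 2 * C1 * \<kappa> ^ n"
proof -
  define Q where "Q = {z \<in> space (lborel \<Otimes>\<^sub>M M). snd z \<in> V n (fst z) \<and> fst z \<in> {a..a + l}}"
  have "Q = (\<Union>j\<in>{n..}. \<Union>k. ({x. nat \<lfloor>x * 2 ^ j\<rfloor> = k} \<inter> {a..a + l}) \<times> Z j k)"
    using sets.sets_into_space[OF Z_event] by (auto simp: Q_def V_def space_pair_measure)
  also have "\<dots> \<in> sets (lborel \<Otimes>\<^sub>M M)"
    by (intro sets.countable_UN'' countableI_type pair_measureI Z_event) measurable
  finally have Q [measurable]: "Q \<in> sets (lborel \<Otimes>\<^sub>M M)" .
  define u where "u \<omega> = (\<integral>\<^sup>+ x. indicator Q (x, \<omega>) \<partial>lborel)" for \<omega>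
  interpret P: pair_sigma_finite lborel M ..
  have [measurable]: "u \<in> borel_measurable M" unfolding u_def by measurable
  have u: "u \<omega> = emeasure lborel ({x. \<omega> \<in> V n x} \<inter> {a..a + l})" if \<omega>: "\<omega> \<in> space M" for \<omega>
  proof -
    have "u \<omega> = (\<integral>\<^sup>+ x. indicator ({x. \<omega> \<in> V n x} \<inter> {a..a + l}) x \<partial>lborel)"
      unfolding u_def using \<omega>
      by (intro nn_integral_cong) (auto simp: Q_def space_pair_measure indicator_def)
    also have "\<dots> = emeasure lborel ({x. \<omega> \<in> V n x} \<inter> {a..a + l})"
      using V_section[OF \<omega>, of n] by (intro nn_integral_indicator) auto
    finally show ?thesis .
  qed
  have eq: "bad_window n a l = {\<omega> \<in> space M. 1 \<le> ennreal (2 / l) * u \<omega>}"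
  proof -
    have "ennreal (l / 2) \<le> y \<longleftrightarrow> 1 \<le> ennreal (2 / l) * y" for y
    proof -
      have 1: "ennreal (2 / l) * ennreal (l / 2) = 1"
        using l by (subst ennreal_mult[symmetric]) auto
      have 2: "ennreal (l / 2) * (ennreal (2 / l) * y) = y"
      proof -
        have "ennreal (l / 2) * (ennreal (2 / l) * y) = (ennreal (2 / l) * ennreal (l / 2)) * y"
          by (simp only: mult_ac)
        then show ?thesis by (simp only: 1 mult_1_left)
      qed
      show ?thesis
      proof
        assume "ennreal (l / 2) \<le> y"
        then have "ennreal (2 / l) * ennreal (l / 2) \<le> ennreal (2 / l) * y" by (rule mult_left_mono) simp
        then show "1 \<le> ennreal (2 / l) * y" by (simp add: 1)
      next
        assume "1 \<le> ennreal (2 / l) * y"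
        then have "ennreal (l / 2) * 1 \<le> ennreal (l / 2) * (ennreal (2 / l) * y)"
          by (rule mult_left_mono) simp
        then show "ennreal (l / 2) \<le> y" by (simp add: 2)
      qed
    qed
    then show ?thesis unfolding bad_window_def by (intro Collect_cong conj_cong refl) (simp only: u)
  qed
  show "bad_window n a l \<in> events" unfolding eq by measurable
  have K: "0 \<le> C1 * \<kappa> ^ n" using C01 \<kappa> by simp
  have "emeasure M (bad_window n a l) \<le> ennreal (2 / l) * (\<integral>\<^sup>+ \<omega>. u \<omega> * indicator (space M) \<omega> \<partial>M)"
    unfolding eq by (rule nn_integral_Markov_inequality) auto
  also have "(\<integral>\<^sup>+ \<omega>. u \<omega> * indicator (space M) \<omega> \<partial>M) = (\<integral>\<^sup>+ \<omega>. u \<omega> \<partial>M)"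
    by (intro nn_integral_cong) auto
  also have "\<dots> = (\<integral>\<^sup>+ x. (\<integral>\<^sup>+ \<omega>. indicator Q (x, \<omega>) \<partial>M) \<partial>lborel)"
    unfolding u_def by (rule P.Fubini) measurable
  also have "\<dots> \<le> (\<integral>\<^sup>+ x. ennreal (C1 * \<kappa> ^ n) * indicator {a..a + l} x \<partial>lborel)"
  proof (rule nn_integral_mono)
    fix x
    have "(\<integral>\<^sup>+ \<omega>. indicator Q (x, \<omega>) \<partial>M) \<le> (\<integral>\<^sup>+ \<omega>. indicator (V n x) \<omega> * indicator {a..a + l} x \<partial>M)"
      by (intro nn_integral_mono) (auto simp: Q_def indicator_def)
    also have "\<dots> = emeasure M (V n x) * indicator {a..a + l} x"
      using V_prob(1) by (subst nn_integral_multc) auto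
    also have "\<dots> \<le> ennreal (C1 * \<kappa> ^ n) * indicator {a..a + l} x"
      using V_prob(2)[of n x] by (intro mult_right_mono) (auto simp: emeasure_eq_measure intro: ennreal_leI)
    finally show "(\<integral>\<^sup>+ \<omega>. indicator Q (x, \<omega>) \<partial>M) \<le> ennreal (C1 * \<kappa> ^ n) * indicator {a..a + l} x" .
  qed
  also have "\<dots> = ennreal (C1 * \<kappa> ^ n) * ennreal l"
    using l by (subst nn_integral_cmult_indicator) auto
  also have "ennreal (2 / l) * (ennreal (C1 * \<kappa> ^ n) * ennreal l) = ennreal (2 * C1 * \<kappa> ^ n)"
    using l K by (simp add: ennreal_mult[symmetric])
  finally have "emeasure M (bad_window n a l) \<le> ennreal (2 * C1 * \<kappa> ^ n)"
    by (simp add: mult_left_mono)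
  then show "prob (bad_window n a l) \<le> 2 * C1 * \<kappa> ^ n" using K by (simp add: emeasure_eq_measure)
qed

end

section \<open>Almost every path admits climbing\<close>

lemma half_power_eq: "(1/2 :: real) ^ k = 2 powr (- real k)"
  by (simp add: powr_minus_divide powr_realpow power_one_over)

lemma eventually_two_powr_le_1:
  fixes c x :: real
  assumes "0 < x"
  shows "\<forall>\<^sub>F n in sequentially. c * 2 powr (- x * real n) \<le> 1"
proof -
  have "2 powr (- x) < (1::real)" using assms powr_less_mono[of "- x" 0 2] by simp
  then have "(\<lambda>n. (2 powr (- x)) ^ n) \<longlonglongrightarrow> (0::real)" by (intro LIMSEQ_power_zero) simp
  then have "(\<lambda>n. c * (2 powr (- x)) ^ n) \<longlonglongrightarrow> c * 0" by (intro tendsto_mult tendsto_const)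
  then have "\<forall>\<^sub>F n in sequentially. c * (2 powr (- x)) ^ n < 1" by (rule order_tendstoD) simp
  then show ?thesis by eventually_elim (simp add: powr_power mult.commute)
qed

lemma dyadic_scale:
  fixes y :: real
  assumes "0 < y" "y \<le> (1/2) ^ m"
  obtains j where "m \<le> j" "(1/2) ^ Suc j < y" "y \<le> (1/2) ^ j"
proof -
  define n where "n = (LEAST n. (1/2) ^ n < y)"
  obtain n' where "(1/2) ^ n' < y" using real_arch_pow_inv[of y "1/2"] assms by auto
  then have n: "(1/2) ^ n < y" "\<And>k. (1/2) ^ k < y \<Longrightarrow> n \<le> k"
    unfolding n_def by (auto intro: LeastI Least_le)
  have "m < n"
  proof (rule ccontr)
    assume "\<not> m < n"
    then have "(1/2::real) ^ m \<le> (1/2) ^ n" by (intro power_decreasing) auto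
    then show False using n(1) assms(2) by linarith
  qed
  then obtain j where j: "n = Suc j" "m \<le> j" by (cases n) auto
  then have "y \<le> (1/2) ^ j" using n(2)[of j] by fastforce
  then show thesis using that[of j] j n(1) by simp
qed

section \<open>Cells after a branching time and their failure probabilities\<close>

locale brownian6_cells = brownian6 M W \<delta>
  for M :: "'a measure" and W :: "real \<Rightarrow> 'a \<Rightarrow> real ^ 6" and \<delta> +
  fixes A :: nat
  assumes A: "3 \<le> A"
begin

text \<open>The increment over a cell has typical size \<open>sqrt (h n) = (1/2) ^ (A * n)\<close>;
  the extra \<open>(1/2) ^ n\<close> in \<open>D\<close> makes a smaller one improbable. The bump
  width \<open>l n = h n * (1/2) ^ (4 * n)\<close> satisfies
  \<open>sqrt (l n) = D n * (1/2) ^ n\<close>, so that over it a path of exponent close to 1/2 moves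
  much less than \<open>D n\<close>.\<close>

definition h :: "nat \<Rightarrow> real" where "h n = (1/2) ^ (2 * A * n)"
definition l :: "nat \<Rightarrow> real" where "l n = (1/2) ^ ((2 * A + 4) * n)"
definition D :: "nat \<Rightarrow> real" where "D n = (1/2) ^ ((A + 1) * n)"
definition cells :: "nat \<Rightarrow> nat" where "cells n = 2 ^ (2 * A * n - Suc n)"

definition cell_start :: "real \<Rightarrow> nat \<Rightarrow> nat \<Rightarrow> real" where
  "cell_start s n k = s + (1/2) ^ Suc n + k * h n"

text \<open>Quantifying over the singleton \<open>{6}\<close> gives the last event the form of
  \<open>increment_box_prob\<close>.\<close>

definition bad_cell :: "real \<Rightarrow> nat \<Rightarrow> nat \<Rightarrow> 'a set" where
  "bad_cell s n k = bad_window n (cell_start s n k) (l n)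
     \<union> bad_window n (cell_start s n k + h n - l n) (l n)
     \<union> {\<omega> \<in> space M. \<forall>i\<in>{6}. \<bar>W (cell_start s n k + h n) \<omega> $ i - W (cell_start s n k) \<omega> $ i\<bar> \<le> D n}"

definition crowded :: "real \<Rightarrow> nat \<Rightarrow> 'a set" where
  "crowded s n = {\<omega> \<in> space M. cells n \<le> 2 * card {k. k < cells n \<and> \<omega> \<in> bad_cell s n k}}"

lemma hlD_pos: "0 < h n" "0 < l n" "0 < D n"
  by (simp_all add: h_def l_def D_def)

text \<open>For \<open>n = 0\<close> the exponent in \<open>cells\<close> is truncated and the
  identity fails.\<close>

lemma cells_h: "1 \<le> n \<Longrightarrow> cells n * h n = (1/2) ^ Suc n"
proof -
  assume n: "1 \<le> n"
  have "2 * n \<le> 2 * A * n" using A by simp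
  then have "Suc n \<le> 2 * A * n" using n by linarith
  then have "2 * A * n = (2 * A * n - Suc n) + Suc n" by simp
  then have "h n = (1/2) ^ (2 * A * n - Suc n) * (1/2) ^ Suc n"
    unfolding h_def by (metis power_add)
  then show ?thesis by (simp add: cells_def power_one_over)
qed

lemma bad_cell:
  assumes s: "0 \<le> s"
  shows "bad_cell s n k \<in> events" and "prob (bad_cell s n k) \<le> 4 * C1 * \<kappa> ^ n + (1/2) ^ n"
proof -
  let ?a = "cell_start s n k"
  have a: "0 \<le> ?a" using s hlD_pos[of n] by (simp add: cell_start_def)
  let ?E = "{\<omega> \<in> space M. \<forall>i\<in>{6}. \<bar>W (?a + h n) \<omega> $ i - W ?a \<omega> $ i\<bar> \<le> D n}"
  note w = bad_window[OF hlD_pos(2)[of n]]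
  have E: "?E \<in> events" using a hlD_pos[of n] by (intro increment_box_measurable) auto
  show "bad_cell s n k \<in> events" unfolding bad_cell_def using w(1) E by blast
  have "prob ?E \<le> (D n / sqrt (?a + h n - ?a)) ^ card {6 :: 6}"
    using a hlD_pos[of n] by (intro increment_box_prob) auto
  also have "\<dots> = D n / sqrt (h n)" by simp
  also have "sqrt (h n) = (1/2) ^ (A * n)"
    by (rule real_sqrt_unique) (simp_all add: h_def power_mult[symmetric] mult_ac)
  also have "D n / (1/2) ^ (A * n) = (1/2) ^ n" by (simp add: D_def power_add add_mult_distrib)
  finally have "prob ?E \<le> (1/2) ^ n" .
  moreover have "prob (bad_cell s n k) \<le> prob (bad_window n ?a (l n) \<union> bad_window n (?a + h n - l n) (l n)) + prob ?E"
    unfolding bad_cell_def by (intro measure_Un_le w E sets.Un)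
  moreover have "prob (bad_window n ?a (l n) \<union> bad_window n (?a + h n - l n) (l n))
      \<le> prob (bad_window n ?a (l n)) + prob (bad_window n (?a + h n - l n) (l n))"
    by (intro measure_Un_le w)
  ultimately show "prob (bad_cell s n k) \<le> 4 * C1 * \<kappa> ^ n + (1/2) ^ n"
    using w(2)[of n ?a] w(2)[of n "?a + h n - l n"] by linarith
qed

text \<open>A union bound over the exponentially many cells would be useless. The probability that
  half of them are bad, however, decays geometrically in \<open>n\<close>, so the Borel-Cantelli
  lemma applies.\<close>

lemma eventually_not_crowded:
  assumes s: "0 \<le> s"
  shows "AE \<omega> in M. \<forall>\<^sub>F n in sequentially. \<omega> \<notin> crowded s n"
proof -
  have c: "0 < cells n" for n by (simp add: cells_def)
  note cr = prob_many_le[of "cells n" "bad_cell s n" "4 * C1 * \<kappa> ^ n + (1/2) ^ n" for n,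
      OF bad_cell[OF s] c, folded crowded_def]
  have "summable (\<lambda>n. 2 * (4 * C1 * \<kappa> ^ n + (1/2) ^ n))"
    using \<kappa> by (intro summable_mult summable_add summable_geometric) auto
  then have "summable (\<lambda>n. prob (crowded s n))"
    by (rule summable_comparison_test') (use cr(2) in simp)
  then have "AE \<omega> in M. \<forall>\<^sub>F n in sequentially. \<omega> \<in> space M - crowded s n"
    by (intro borel_cantelli_AE1 cr(1)) (auto simp: emeasure_eq_measure)
  then show ?thesis by eventually_elim (erule eventually_mono, blast)
qed

text \<open>Block \<open>2^j - 2^(j-i)\<close> at scale \<open>2^(-j)\<close> starts at the branching time \<open>1 - 2^(-i)\<close>.\<close>

lemma eventually_not_Z:
  "AE \<omega> in M. \<forall>\<^sub>F j in sequentially. \<forall>i\<in>{1..j}. \<omega> \<notin> Z j (2 ^ j - 2 ^ (j - i))"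
proof -
  define E where "E j = (\<Union>i\<in>{1..j}. Z j (2 ^ j - 2 ^ (j - i)))" for j
  have E: "E j \<in> events" for j unfolding E_def by (intro sets.finite_UN) auto
  have le: "prob (E j) \<le> C0 * (real (Suc j) * \<kappa> ^ j)" for j
  proof -
    have "prob (E j) \<le> (\<Sum>i\<in>{1..j}. prob (Z j (2 ^ j - 2 ^ (j - i))))"
      unfolding E_def by (intro finite_measure_subadditive_finite) auto
    also have "\<dots> \<le> (\<Sum>i\<in>{1..j}. C0 * \<kappa> ^ j)" by (intro sum_mono Z_prob)
    also have "\<dots> = real j * (C0 * \<kappa> ^ j)" by simp
    also have "\<dots> \<le> real (Suc j) * (C0 * \<kappa> ^ j)" using C01 \<kappa> by (intro mult_right_mono) auto
    finally show ?thesis by (simp add: mult_ac)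
  qed
  have sum: "summable (\<lambda>j. C0 * (real (Suc j) * \<kappa> ^ j))"
    using \<kappa> by (intro summable_mult sums_summable[OF geometric_deriv_sums]) auto
  have "summable (\<lambda>j. prob (E j))" by (rule summable_comparison_test'[OF sum]) (simp only: real_norm_def abs_of_nonneg[OF measure_nonneg] le)
  then have "AE \<omega> in M. \<forall>\<^sub>F j in sequentially. \<omega> \<in> space M - E j"
    by (intro borel_cantelli_AE1 E) (auto simp: emeasure_eq_measure)
  then show ?thesis by eventually_elim (erule eventually_mono, auto simp: E_def)
qed

section \<open>Balance of gains, dips and bump heights\<close>

definition G :: "nat \<Rightarrow> real" where "G n = (1/2) ^ ((A + 6) * n) / 16"

lemma G_eq: "1 \<le> n \<Longrightarrow> cells n / 2 * (l n * D n / 4) = G n"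
proof -
  assume "1 \<le> n"
  then have "cells n * h n = (1/2) ^ Suc n" by (rule cells_h)
  moreover have "l n * D n = h n * (1/2) ^ ((A + 5) * n)"
    by (simp add: l_def D_def h_def power_add[symmetric] algebra_simps)
  moreover have "cells n / 2 * (l n * D n / 4) = (cells n * h n) * (1/2) ^ ((A + 5) * n) / 8"
    using \<open>l n * D n = h n * (1/2) ^ ((A + 5) * n)\<close> by simp
  ultimately have "cells n / 2 * (l n * D n / 4) = (1/2) ^ (Suc n + (A + 5) * n) / 8"
    by (simp only: power_add)
  moreover have "Suc n + (A + 5) * n = Suc ((A + 6) * n)" by (simp add: algebra_simps)
  ultimately show ?thesis by (simp add: G_def)
qed

text \<open>A comparison of powers of \<open>(1/2) ^ n\<close>. The dip \<open>c * l n\<close> is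
  negligible against \<open>G (Suc n)\<close> because 2 A + 4 > A + 6, that is A \<ge> 3. The last
  inequality compares 2 A + 4 with \<alpha> (A + 6); the ratio of 2 A + 4 to A + 6 tends to 2, which
  is why every \<alpha> < 2 can be reached.\<close>

lemma eventually_scales:
  fixes q \<alpha> c :: real
  assumes q: "real A + 1 < (2 * real A + 4) * q" and \<alpha>: "0 < \<alpha>" "\<alpha> * (real A + 6) < 2 * real A + 4"
  shows "\<forall>\<^sub>F n in sequentially. 4 * c * l n powr q \<le> D n \<and> 0 \<le> G (Suc n) - c * l n
    \<and> l n \<le> (G (Suc n) - c * l n) powr \<alpha>"
proof -
  have e1: "\<forall>\<^sub>F n in sequentially. 4 * c * 2 powr (- ((2 * real A + 4) * q - (real A + 1)) * real n) \<le> 1"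
    by (rule eventually_two_powr_le_1) (use q in simp)
  have e2: "\<forall>\<^sub>F n in sequentially. 32 * c * 2 ^ (A + 6) * 2 powr (- (real A - 2) * real n) \<le> 1"
    by (rule eventually_two_powr_le_1) (use A in simp)
  have e3: "\<forall>\<^sub>F n in sequentially. 2 powr (\<alpha> * (real A + 11)) * 2 powr (- (2 * real A + 4 - \<alpha> * (real A + 6)) * real n) \<le> 1"
    by (rule eventually_two_powr_le_1) (use \<alpha> in simp)
  from e1 e2 e3 show ?thesis
  proof eventually_elim
    case (elim n)
    have D: "D n = 2 powr (- (real A + 1) * real n)" and l: "l n = 2 powr (- (2 * real A + 4) * real n)"
      unfolding D_def l_def half_power_eq by (simp_all add: algebra_simps)
    have "4 * c * l n powr q = 4 * c * 2 powr (- ((2 * real A + 4) * q - (real A + 1)) * real n) * D n"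
      unfolding D l powr_powr mult.assoc by (subst powr_add[symmetric]) (simp add: algebra_simps)
    also have "\<dots> \<le> 1 * D n" using elim(1) less_imp_le[OF hlD_pos(3)] by (rule mult_right_mono)
    finally have 1: "4 * c * l n powr q \<le> D n" by simp
    \<comment> \<open>In the exponent \<open>5\<close> collects the factor \<open>1/16\<close> of
      \<open>G\<close> and the halving, and the shift to \<open>Suc n\<close> adds
      \<open>A + 6\<close>.\<close>
    have GS: "G (Suc n) / 2 = 2 powr (- (real A + 11) - (real A + 6) * real n)"
    proof -
      have "G (Suc n) / 2 = (1/2) ^ ((A + 6) * Suc n) * (1/2) ^ 5" by (simp add: G_def power_one_over)
      also have "\<dots> = (1/2) ^ ((A + 6) * Suc n + 5)" by (rule power_add[symmetric])
      also have "\<dots> = 2 powr (- (real A + 11) - (real A + 6) * real n)"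
        unfolding half_power_eq by (simp add: algebra_simps)
      finally show ?thesis .
    qed
    have "c * l n = (32 * c * 2 ^ (A + 6) * 2 powr (- (real A - 2) * real n)) * (G (Suc n) / 2)"
    proof -
      have "32 * (2::real) ^ (A + 6) = 2 powr (real A + 11)"
      proof -
        have "32 * (2::real) ^ (A + 6) = 2 ^ (A + 11)" by (simp add: power_add)
        then show ?thesis by (simp add: powr_realpow[symmetric])
      qed
      then have "(32 * c * 2 ^ (A + 6) * 2 powr (- (real A - 2) * real n)) * (G (Suc n) / 2)
          = c * (2 powr (real A + 11) * 2 powr (- (real A - 2) * real n) * 2 powr (- (real A + 11) - (real A + 6) * real n))"
        unfolding GS by (simp add: mult_ac)
      also have "\<dots> = c * l n" unfolding l by (simp add: powr_add[symmetric] algebra_simps)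
      finally show ?thesis by (rule sym)
    qed
    also have "\<dots> \<le> 1 * (G (Suc n) / 2)"
      using elim(2) by (intro mult_right_mono) (auto simp: G_def)
    finally have 2: "G (Suc n) / 2 \<le> G (Suc n) - c * l n" by simp
    have G0: "0 \<le> G (Suc n)" by (simp add: G_def)
    have "l n = (2 powr (\<alpha> * (real A + 11)) * 2 powr (- (2 * real A + 4 - \<alpha> * (real A + 6)) * real n)) * (G (Suc n) / 2) powr \<alpha>"
      unfolding GS l powr_powr by (simp add: powr_add[symmetric] algebra_simps)
    also have "\<dots> \<le> 1 * (G (Suc n) / 2) powr \<alpha>" using elim(3) by (intro mult_right_mono) auto
    also have "\<dots> \<le> (G (Suc n) - c * l n) powr \<alpha>"
      using 2 G0 \<alpha> by (simp add: powr_mono2)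
    finally show ?case using 1 2 G0 by auto
  qed
qed

lemma eventually_fine:
  assumes q: "1/2 + \<delta> < (1 + 9 * \<delta> / 4) * q" "0 < q" and c: "0 \<le> c"
  shows "\<forall>\<^sub>F j in sequentially. c * (1 / 2 ^ mesh j) powr q \<le> \<rho> j"
proof -
  have "\<forall>\<^sub>F j in sequentially. c * 2 powr (- ((1 + 9 * \<delta> / 4) * q - (1/2 + \<delta>)) * real j) \<le> 1"
    by (rule eventually_two_powr_le_1) (use q in simp)
  then show ?thesis
  proof eventually_elim
    case (elim j)
    have "9 * \<delta> * j / 4 \<le> depth j" unfolding depth_def using \<delta> by linarith
    then have m: "(1 + 9 * \<delta> / 4) * j \<le> mesh j" unfolding mesh_def by (simp add: algebra_simps)
    have "(1 / 2 ^ mesh j) powr q = 2 powr (- (q * mesh j))"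
      using half_power_eq[of "mesh j"] by (simp add: power_one_over powr_powr mult.commute)
    also have "\<dots> \<le> 2 powr (- (q * ((1 + 9 * \<delta> / 4) * j)))"
      using m q by (intro powr_mono) (auto intro: mult_left_mono)
    also have "\<dots> = 2 powr (- ((1 + 9 * \<delta> / 4) * q - (1/2 + \<delta>)) * real j) * \<rho> j"
      unfolding \<rho>_def by (subst powr_add[symmetric]) (simp add: algebra_simps)
    finally have "c * (1 / 2 ^ mesh j) powr q
        \<le> c * (2 powr (- ((1 + 9 * \<delta> / 4) * q - (1/2 + \<delta>)) * real j) * \<rho> j)"
      using c by (rule mult_left_mono)
    also have "\<dots> = (c * 2 powr (- ((1 + 9 * \<delta> / 4) * q - (1/2 + \<delta>)) * real j)) * \<rho> j" by simp
    also have "\<dots> \<le> 1 * \<rho> j" using elim by (intro mult_right_mono) (auto simp: \<rho>_def)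
    finally show ?case by simp
  qed
qed

end

section \<open>Assembly along a fixed path\<close>

context brownian6_cells
begin

text \<open>A single path is considered, with \<open>holder\<close>, \<open>notZ\<close> and
  \<open>sparse\<close> as its almost sure properties; what remains is deterministic.\<close>

lemma path_climbs:
  fixes q c \<epsilon> :: real
  defines "\<alpha> \<equiv> 1 / (1/2 + \<delta>)"
  assumes \<omega>: "\<omega> \<in> space M" and W0: "W 0 \<omega> = 0"
    and holder: "\<And>s t. 0 \<le> s \<Longrightarrow> s \<le> t \<Longrightarrow> t \<le> 1 \<Longrightarrow> norm (W t \<omega> - W s \<omega>) \<le> c * (t - s) powr q"
    and q_bounds: "0 < q" "1/2 + \<delta> < (1 + 9 * \<delta> / 4) * q" "real A + 1 < (2 * real A + 4) * q"
    and \<epsilon>: "0 < \<epsilon>" "\<epsilon> < 1" "2 - \<epsilon> < \<alpha>" and A\<alpha>: "\<alpha> * (real A + 6) < 2 * real A + 4"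
    and notZ: "\<forall>\<^sub>F j in sequentially. \<forall>i\<in>{1..j}. \<omega> \<notin> Z j (2 ^ j - 2 ^ (j - i))"
    and sparse: "\<And>m. \<forall>\<^sub>F n in sequentially. \<omega> \<notin> crowded (1 - (1/2) ^ m) n"
  shows "\<exists>f :: real ^ 6 \<Rightarrow> real. compact (closure {x. f x \<noteq> 0}) \<and> C_2_minus \<epsilon> f \<and>
    infinite {y \<in> extensional {0..1}. is_path_solution (\<lambda>t. W t \<omega>) a (last_coord_system f) 1 0 y}"
proof -
  define w where "w t = W t \<omega>" for t
  have \<alpha>: "0 < \<alpha>" "\<alpha> < 2" and \<alpha>': "1 / \<alpha> = 1/2 + \<delta>"
    using \<delta> by (auto simp: \<alpha>_def field_simps)
  have "norm (W 1 \<omega> - W 0 \<omega>) \<le> c * (1 - 0) powr q" by (rule holder) auto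
  from order.trans[OF norm_ge_zero this] have c: "0 \<le> c" by simp
  have comp: "\<bar>W t \<omega> $ i - W s \<omega> $ i\<bar> \<le> c * (t - s) powr q"
    if "0 \<le> s" "s \<le> t" "t \<le> 1" for s t i
    using component_le_norm_cart[of "W t \<omega> - W s \<omega>" i] holder[OF that] by simp
  have "\<forall>\<^sub>F j in sequentially. c * (1 / 2 ^ mesh j) powr q \<le> \<rho> j"
    by (rule eventually_fine[OF q_bounds(2,1) c])
  with notZ have "\<forall>\<^sub>F j in sequentially. (\<forall>i\<in>{1..j}. \<omega> \<notin> Z j (2 ^ j - 2 ^ (j - i)))
      \<and> c * (1 / 2 ^ mesh j) powr q \<le> \<rho> j" by (rule eventually_conj)
  then obtain j1 where j1: "\<And>j i. j1 \<le> j \<Longrightarrow> i \<in> {1..j} \<Longrightarrow> \<omega> \<notin> Z j (2 ^ j - 2 ^ (j - i))"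
    and fine: "\<And>j. j1 \<le> j \<Longrightarrow> c * (1 / 2 ^ mesh j) powr q \<le> \<rho> j"
    unfolding eventually_sequentially by blast
  \<comment> \<open>Times after \<open>\<sigma> 0\<close> are at distance at most
    \<open>(1/2) ^ m0\<close>, so only scales \<open>j \<ge> j1\<close> occur, where the excluded
    blocks and the mesh estimate are available. \<open>m0 \<ge> 1\<close> keeps the index of the
    excluded block in \<open>{1..j}\<close>.\<close>
  define m0 where "m0 = max 1 j1"
  define \<sigma> where "\<sigma> m = 1 - (1/2 :: real) ^ (m0 + m)" for m
  define bad where "bad s t \<longleftrightarrow> \<sigma> 0 \<le> s \<and> s < t \<and> t \<le> 1
    \<and> (\<forall>i. i \<noteq> 6 \<longrightarrow> \<bar>w t $ i - w s $ i\<bar> < (t - s) powr (1 / \<alpha>))" for s t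
  \<comment> \<open>Removing whole open intervals, even over an uncountable family of pairs, leaves
    a closed and hence Borel set.\<close>
  define K where "K = - (\<Union>z\<in>{z. bad (fst z) (snd z)}. {fst z<..<snd z})"
  have "closed K" unfolding K_def by (intro closed_Compl open_UN) auto
  then have K: "K \<in> sets borel" by (rule borel_closed)
  define B where "B = (\<lambda>t. w (clamp01 t) $ 6)"
  have Bc: "\<bar>B t - B s\<bar> \<le> c * \<bar>clamp01 t - clamp01 s\<bar> powr q" for s t
  proof (cases "clamp01 s \<le> clamp01 t")
    case True
    then show ?thesis using comp[of "clamp01 s" "clamp01 t" 6] clamp01_range by (simp add: B_def w_def)
  next
    case False
    then show ?thesis using comp[of "clamp01 t" "clamp01 s" 6] clamp01_range
      by (simp add: B_def w_def abs_minus_commute)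
  qed
  interpret climbing B c q K
  proof
    show "\<bar>B t - B s\<bar> \<le> c * \<bar>t - s\<bar> powr q" for t s
    proof -
      have "c * \<bar>clamp01 t - clamp01 s\<bar> powr q \<le> c * \<bar>t - s\<bar> powr q"
        using c q_bounds clamp01_dist by (intro mult_left_mono powr_mono2) auto
      then show ?thesis using Bc[of t s] by linarith
    qed
    show "\<bar>B t - B s\<bar> \<le> c" for t s
    proof -
      have "c * \<bar>clamp01 t - clamp01 s\<bar> powr q \<le> c * 1 powr q"
        using c q_bounds clamp01_dist by (intro mult_left_mono powr_mono2) auto
      then show ?thesis using Bc[of t s] by simp
    qed
  qed (use q_bounds K in auto)
  \<comment> \<open>A bad pair around \<open>x\<close> has some scale \<open>j\<close>. If
    \<open>j \<ge> n\<close>, it is counted in \<open>V n x\<close>. If \<open>j < n\<close>, then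
    \<open>x\<close> lies in a special block of scale \<open>j\<close>, the one starting at
    \<open>1 - (1/2) ^ m\<close> or, for \<open>j < m\<close>, the last one before 1, and
    \<open>notZ\<close> excludes close pairs there.\<close>
  have bad_V: "\<omega> \<in> V n x"
    if M: "m0 \<le> m" "m < n" and x: "1 - (1/2) ^ m < x" "x \<le> 1 - (1/2) ^ m + (1/2) ^ n" and xK: "x \<notin> K"
    for m n x
  proof -
    obtain s t where st: "bad s t" "s < x" "x < t" using xK by (auto simp: K_def)
    have "t - s \<le> (1/2) ^ m0" using st(1) by (simp add: bad_def \<sigma>_def)
    then obtain j where j: "m0 \<le> j" "(1/2) ^ Suc j < t - s" "t - s \<le> (1/2) ^ j"
      using dyadic_scale[of "t - s" m0] st by auto
    have j': "j1 \<le> j" "1 \<le> j" using j(1) by (auto simp: m0_def)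
    have "(1/2::real) ^ m0 \<le> 1" by (simp add: power_le_one)
    then have s0: "0 \<le> s" using st(1) by (simp add: bad_def \<sigma>_def)
    have inZ: "\<omega> \<in> Z j (nat \<lfloor>x * 2 ^ j\<rfloor>)"
      using st j s0
      by (intro close_pair_in_Z[OF \<omega> comp c q_bounds(1) fine[OF j'(1)], of s t x])
        (auto simp: bad_def w_def \<alpha>' power_one_over)
    have "n \<le> j"
    proof (rule ccontr)
      assume "\<not> n \<le> j"
      then have jn: "j < n" by simp
      have p2: "(1/2::real) ^ k * 2 ^ k = 1" for k by (simp add: power_mult_distrib[symmetric])
      have "(1/2::real) ^ n \<le> (1/2) ^ Suc j" "(1/2::real) ^ n \<le> (1/2) ^ Suc m"
        using jn M by (auto intro!: power_decreasing simp del: power_Suc)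
      then have x1: "x < 1 - (1/2) ^ m + (1/2) ^ j" "x < 1"
        using x(2) zero_less_power[of "1/2::real" j] zero_less_power[of "1/2::real" m]
        unfolding power_Suc by linarith+
      have "x * 2 ^ j < (1 - (1/2) ^ m + (1/2) ^ j) * 2 ^ j" using x1 by simp
      then have hi: "x * 2 ^ j < 2 ^ j - (1/2) ^ m * 2 ^ j + 1"
        by (simp only: left_diff_distrib distrib_right mult_1_left p2)
      have "(1 - (1/2) ^ m) * 2 ^ j < x * 2 ^ j" using x by simp
      then have lo: "2 ^ j - (1/2) ^ m * 2 ^ j < x * 2 ^ j" by (simp add: left_diff_distrib)
      \<comment> \<open>\<open>i\<close> is the smaller of \<open>m\<close> and \<open>j\<close>:
        for \<open>j < m\<close> the time \<open>1 - (1/2) ^ m\<close> is no multiple of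
        \<open>(1/2) ^ j\<close>, and the block just before 1 belongs to
        \<open>i = j\<close>.\<close>
      obtain i where i: "i \<in> {1..j}" "nat \<lfloor>x * 2 ^ j\<rfloor> = 2 ^ j - 2 ^ (j - i)"
      proof (cases "m \<le> j")
        case True
        have "(1/2::real) ^ m * 2 ^ j = (1/2) ^ m * 2 ^ m * 2 ^ (j - m)"
          using True by (simp add: mult.assoc power_add[symmetric])
        then have pm: "(1/2::real) ^ m * 2 ^ j = 2 ^ (j - m)" by (simp add: p2)
        have le: "(2::nat) ^ (j - m) \<le> 2 ^ j" by (rule power_increasing) auto
        have "\<lfloor>x * 2 ^ j\<rfloor> = int (2 ^ j - 2 ^ (j - m))"
          using hi lo le unfolding pm by (intro floor_unique) (auto simp: of_nat_diff)
        then have "nat \<lfloor>x * 2 ^ j\<rfloor> = 2 ^ j - 2 ^ (j - m)" by (simp only: nat_int)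
        then show thesis by (rule that[rotated]) (use True M(1) in \<open>simp add: m0_def\<close>)
      next
        case False
        have "(1/2::real) ^ m \<le> (1/2) ^ j" using False by (intro power_decreasing) auto
        then have "(1/2::real) ^ m * 2 ^ j \<le> (1/2) ^ j * 2 ^ j" by (rule mult_right_mono) simp
        then have "(1/2::real) ^ m * 2 ^ j \<le> 1" by (simp only: p2)
        then have "2 ^ j - 1 < x * 2 ^ j" using lo by linarith
        moreover have "x * 2 ^ j < 2 ^ j" using x1 by simp
        moreover have "(1::nat) \<le> 2 ^ j" by simp
        ultimately have "\<lfloor>x * 2 ^ j\<rfloor> = int (2 ^ j - 1)" by (intro floor_unique) (auto simp: of_nat_diff)
        then have "nat \<lfloor>x * 2 ^ j\<rfloor> = 2 ^ j - 2 ^ (j - j)" by (simp only: nat_int) simp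
        then show thesis by (rule that[rotated]) (use j'(2) in simp)
      qed
      then show False using inZ j1[OF j'(1) i(1)] by simp
    qed
    then show ?thesis using inZ by (auto simp: V_def)
  qed
  have good: "good_cell (cell_start s n k) (h n) (l n) (D n)"
    if s: "s = 1 - (1/2) ^ m" and m: "m0 \<le> m" "m < n" and k: "k < cells n"
      and nb: "\<omega> \<notin> bad_cell s n k" for s m n k
  proof -
    define u where "u = cell_start s n k"
    have n1: "1 \<le> n" using m by simp
    have "(1/2::real) ^ m \<le> 1" by (simp add: power_le_one)
    then have s0: "0 \<le> s" by (simp add: s)
    have u0: "s < u" using hlD_pos[of n] by (simp add: u_def cell_start_def add_pos_nonneg)
    have "real (Suc k) * h n \<le> cells n * h n" using k hlD_pos[of n] by (intro mult_right_mono) auto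
    then have "u + h n \<le> s + (1/2) ^ Suc n + cells n * h n"
      by (simp add: u_def cell_start_def algebra_simps)
    then have uh: "u + h n \<le> s + (1/2) ^ n" using cells_h[OF n1] by simp
    have "(1/2::real) ^ n \<le> (1/2) ^ m" using m by (intro power_decreasing) auto
    then have uh1: "u + h n \<le> 1" using uh unfolding s by linarith
    have lh: "2 * l n \<le> h n"
    proof -
      have "l n = h n * (1/2) ^ (4 * n)" by (simp add: l_def h_def power_add[symmetric] algebra_simps)
      moreover have "(1/2::real) ^ (4 * n) \<le> (1/2) ^ 1" using n1 by (intro power_decreasing) auto
      ultimately show ?thesis using hlD_pos[of n] mult_left_mono[of "(1/2) ^ (4 * n)" "1/2" "h n"] by simp
    qed
    have window: "l n / 2 \<le> measure lborel (K \<inter> {v..v + l n})"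
      if v: "u \<le> v" "v + l n \<le> u + h n" and nv: "\<omega> \<notin> bad_window n v (l n)" for v
    proof -
      let ?I = "{v..v + l n}"
      have sub: "?I - K \<subseteq> {x. \<omega> \<in> V n x} \<inter> ?I"
        using bad_V[OF m] u0 uh v s by auto
      have "emeasure lborel ({x. \<omega> \<in> V n x} \<inter> ?I) < ennreal (l n / 2)"
        using nv \<omega> by (auto simp: bad_window_def not_le)
      moreover have "emeasure lborel (?I - K) \<le> emeasure lborel ({x. \<omega> \<in> V n x} \<inter> ?I)"
        using sub V_section[OF \<omega>] by (intro emeasure_mono) auto
      ultimately have "emeasure lborel (?I - K) < ennreal (l n / 2)" by (rule le_less_trans[rotated])
      then have 1: "measure lborel (?I - K) \<le> l n / 2"
        unfolding measure_def using hlD_pos[of n] by (intro enn2real_leI) auto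
      have fin: "emeasure lborel (?I \<inter> X) \<noteq> \<infinity>" for X
      proof -
        have "emeasure lborel (?I \<inter> X) \<le> emeasure lborel ?I" by (intro emeasure_mono) auto
        also have "\<dots> < \<infinity>" by (simp add: emeasure_lborel_Icc_eq)
        finally show ?thesis by simp
      qed
      have "measure lborel ((?I \<inter> K) \<union> (?I - K)) = measure lborel (?I \<inter> K) + measure lborel (?I - K)"
        using fin[of K] fin[of "- K"] K by (intro measure_Union) (auto simp: Diff_eq)
      moreover have "(?I \<inter> K) \<union> (?I - K) = ?I" by blast
      moreover have "measure lborel ?I = l n" using hlD_pos[of n] by simp
      ultimately show ?thesis using 1 by (simp add: Int_commute)
    qed
    have b: "\<omega> \<notin> bad_window n u (l n)" "\<omega> \<notin> bad_window n (u + h n - l n) (l n)"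
      "D n < \<bar>W (u + h n) \<omega> $ 6 - W u \<omega> $ 6\<bar>"
      using nb \<omega> by (auto simp: bad_cell_def u_def not_le)
    have "B (u + h n) = W (u + h n) \<omega> $ 6" "B u = W u \<omega> $ 6"
      using u0 s0 uh1 hlD_pos[of n] by (simp_all add: B_def w_def)
    then show ?thesis
      unfolding good_cell_def u_def[symmetric]
      using window[of u] window[of "u + h n - l n"] b lh hlD_pos[of n] by auto
  qed
  have climb: "climbable \<alpha> (\<sigma> m)" for m
  proof -
    define s where "s = \<sigma> m"
    have s: "s = 1 - (1/2) ^ (m0 + m)" by (simp add: s_def \<sigma>_def)
    have "\<forall>\<^sub>F n in sequentially. \<omega> \<notin> crowded s n" using sparse[of "m0 + m"] by (simp add: s)
    moreover have "\<forall>\<^sub>F n in sequentially. m0 + m < n" by (rule eventually_gt_at_top)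
    ultimately have "\<forall>\<^sub>F n in sequentially. \<omega> \<notin> crowded s n \<and> m0 + m < n
        \<and> 4 * c * l n powr q \<le> D n \<and> 0 \<le> G (Suc n) - c * l n \<and> l n \<le> (G (Suc n) - c * l n) powr \<alpha>"
      using eventually_scales[OF q_bounds(3) \<alpha>(1) A\<alpha>, of c] by eventually_elim auto
    then obtain n1 where n1: "\<And>n. n1 \<le> n \<Longrightarrow> \<omega> \<notin> crowded s n \<and> m0 + m < n
        \<and> 4 * c * l n powr q \<le> D n \<and> 0 \<le> G (Suc n) - c * l n \<and> l n \<le> (G (Suc n) - c * l n) powr \<alpha>"
      unfolding eventually_sequentially by blast
    have "climbable \<alpha> s"
    proof (rule climbableI[where l=l and G=G and ?n1.0=n1])
      fix n assume n: "n1 \<le> n"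
      have n': "m0 + m < n" "1 \<le> n" using n1[OF n] by auto
      let ?u = "s + (1/2) ^ Suc n"
      have end_eq: "?u + cells n * h n = s + (1/2) ^ n" using cells_h[OF n'(2)] by simp
      let ?good = "{k. k < cells n \<and> good_cell (?u + k * h n) (h n) (l n) (D n)}"
      let ?bad = "{k. k < cells n \<and> \<omega> \<in> bad_cell s n k}"
      have "{..<cells n} \<subseteq> ?good \<union> ?bad"
        using good[OF s _ n'(1)] by (auto simp: cell_start_def)
      then have "card {..<cells n} \<le> card (?good \<union> ?bad)" by (intro card_mono) auto
      also have "\<dots> \<le> card ?good + card ?bad" by (rule card_Un_le)
      finally have "cells n \<le> card ?good + card ?bad" by simp
      moreover have "2 * card ?bad < cells n" using n1[OF n] \<omega> by (auto simp: crowded_def)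
      ultimately have "real (cells n) / 2 \<le> card ?good" by linarith
      then have "real (cells n) / 2 * (l n * D n / 4) \<le> card ?good * (l n * D n / 4)"
        using hlD_pos[of n] by (intro mult_right_mono) auto
      then have gain: "G n \<le> card ?good * (l n * D n / 4)" by (simp only: G_eq[OF n'(2)])
      have lh: "2 * l n < h n"
      proof -
        have "l n = h n * (1/2) ^ (4 * n)" by (simp add: l_def h_def power_add[symmetric] algebra_simps)
        moreover have "(1/2::real) ^ (4 * n) \<le> (1/2) ^ 2" using n' by (intro power_decreasing) auto
        ultimately show ?thesis using hlD_pos[of n] mult_left_mono[of "(1/2) ^ (4 * n)" "1/4" "h n"]
          by (simp add: power2_eq_square)
      qed
      have "4 * c * l n powr q \<le> D n" using n1[OF n] by simp
      from climb_block[OF hlD_pos(2) lh this hlD_pos(3), of ?u "cells n"]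
      obtain g where g: "adm g \<and> U g ?u (s + (1/2) ^ n) = 0
        \<and> card ?good * (l n * D n / 4) \<le> Y g ?u (s + (1/2) ^ n)
        \<and> (\<forall>t. ?u \<le> t \<and> t \<le> s + (1/2) ^ n \<longrightarrow> \<bar>U g ?u t\<bar> \<le> l n \<and> - (c * l n) \<le> Y g ?u t)"
        unfolding end_eq ..
      show "\<exists>g. adm g \<and> U g ?u (s + (1/2) ^ n) = 0 \<and> G n \<le> Y g ?u (s + (1/2) ^ n)
        \<and> (\<forall>t. ?u \<le> t \<and> t \<le> s + (1/2) ^ n \<longrightarrow> \<bar>U g ?u t\<bar> \<le> l n \<and> - (c * l n) \<le> Y g ?u t)"
      proof (intro exI[of _ g] conjI)
        show "G n \<le> Y g ?u (s + (1/2) ^ n)" using gain g by linarith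
      qed (use g in blast)+
    next
      fix n show "0 < G n" by (simp add: G_def)
    next
      fix n assume "n1 \<le> n"
      then show "0 \<le> G (Suc n) - c * l n \<and> l n \<le> (G (Suc n) - c * l n) powr \<alpha>" using n1 by blast
    next
      show "0 \<le> s" by (simp add: s power_le_one)
    qed (rule \<alpha>(1))
    then show ?thesis by (simp add: s_def)
  qed
  have "\<exists>f :: real ^ 6 \<Rightarrow> real. compact (closure {x. f x \<noteq> 0}) \<and> C_2_minus \<epsilon> f \<and>
      infinite {y \<in> extensional {0..1}. is_path_solution w a (last_coord_system f) 1 0 y}"
  proof (rule infinitely_many_path_solutions[OF \<epsilon>(1,2,3) \<alpha>(2)])
    show "w 0 = 0" by (simp add: w_def W0)
    show "climbing (\<lambda>t. w (clamp01 t) $ 6) c q K"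
      using climbing_axioms by (simp add: B_def)
    show "climbing.climbable (\<lambda>t. w (clamp01 t) $ 6) c K \<alpha> (\<sigma> m)" for m
      using climb by (simp add: B_def)
    show "norm (w t) \<le> c" if "0 \<le> t" "t \<le> 1" for t
    proof -
      have "norm (W t \<omega> - W 0 \<omega>) \<le> c * (t - 0) powr q" using that by (intro holder) auto
      also have "\<dots> \<le> c * 1 powr q" using that c q by (intro mult_left_mono powr_mono2) auto
      finally show ?thesis by (simp add: w_def W0)
    qed
    show "0 \<le> \<sigma> 0" by (simp add: \<sigma>_def power_le_one)
    show "\<sigma> m < \<sigma> (Suc m)" "\<sigma> m < 1" for m by (simp_all add: \<sigma>_def)
    show "K \<inter> {s<..<t} = {}" if "\<sigma> 0 \<le> s" "s < t" "t \<le> 1"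
      "\<And>i. i \<noteq> 6 \<Longrightarrow> \<bar>w t $ i - w s $ i\<bar> < (t - s) powr (1 / \<alpha>)" for s t
    proof -
      have "bad s t" using that by (simp add: bad_def)
      then show ?thesis by (force simp: K_def)
    qed
  qed
  then show ?thesis by (simp add: w_def[abs_def])
qed

end

theorem theorem4p8:
  fixes M :: "'a measure"
    and W :: "real \<Rightarrow> 'a \<Rightarrow> real ^ 6"
    and A :: "6 \<Rightarrow> 6 \<Rightarrow> real \<Rightarrow> real \<Rightarrow> 'a \<Rightarrow> real"
    and \<epsilon> :: real
  assumes "0 < \<epsilon>" and "\<epsilon> < 1"
    and "standard_brownian_motion M W"
    and "iterated_ito_version M W A"
  shows "AE \<omega> in M. \<exists>f :: real ^ 6 \<Rightarrow> real.
    compact (closure {x. f x \<noteq> 0}) \<and> C_2_minus \<epsilon> f \<and>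
    (\<exists>T>0. infinite {y \<in> extensional {0..T}.
       is_path_solution (\<lambda>t. W t \<omega>) (\<lambda>r j s t. A r j s t \<omega>) (last_coord_system f) T 0 y})"
proof -
  \<comment> \<open>Strictly between 2 - \<epsilon> and 2: the lower margin pays for the extension,
    the upper one for the rarity of close pairs and for the climb.\<close>
  define \<alpha> where "\<alpha> = 2 - \<epsilon> / 2"
  define \<delta> where "\<delta> = 1 / \<alpha> - 1 / 2"
  \<comment> \<open>\<open>8 \<le> N * (2 - \<alpha>)\<close> is enough for
    \<open>N\<alpha>\<close>, which amounts to \<open>6 * \<alpha> - 4 < N * (2 - \<alpha>)\<close>,
    as \<alpha> < 2.\<close>
  define N where "N = nat \<lceil>8 / (2 - \<alpha>)\<rceil>"
  have \<alpha>: "1 < \<alpha>" "\<alpha> < 2" "2 - \<epsilon> < \<alpha>" using assms by (auto simp: \<alpha>_def)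
  have \<delta>: "0 < \<delta>" using \<alpha> by (simp add: \<delta>_def field_simps)
  have \<alpha>\<delta>: "1 / (1/2 + \<delta>) = \<alpha>" by (simp add: \<delta>_def)
  have "8 / (2 - \<alpha>) \<le> N" unfolding N_def by linarith
  then have N8: "8 \<le> N * (2 - \<alpha>)" using \<alpha> by (simp add: field_simps)
  have "real N * (2 - \<alpha>) \<le> real N * 1" using \<alpha> by (intro mult_left_mono) auto
  then have N: "8 \<le> real N" using N8 by linarith
  have N\<alpha>: "\<alpha> * (real N + 6) < 2 * real N + 4"
    using N8 \<alpha> by (simp add: algebra_simps)
  interpret standard_brownian_motion M W by fact
  interpret brownian6_cells M W \<delta> N
    by unfold_locales (use \<delta> N in auto)
  \<comment> \<open>Both lower bounds for the Hoelder exponent \<open>q\<close> are below 1/2, the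
    first because 2 \<delta> < 9 \<delta> / 4 and the second because N + 1 < N + 2, so an exponent
    available for Brownian paths fits in between.\<close>
  define b where "b = max ((1/2 + \<delta>) / (1 + 9 * \<delta> / 4)) ((real N + 1) / (2 * real N + 4))"
  have "b < 1 / 2" unfolding b_def max_less_iff_conj using \<delta> N by (auto simp: field_simps)
  then obtain q where q: "b < q" "q < 1 / 2" using dense by blast
  have bq: "(1/2 + \<delta>) / (1 + 9 * \<delta> / 4) < q" "(real N + 1) / (2 * real N + 4) < q"
    using q by (auto simp: b_def)
  then have q': "1/2 + \<delta> < (1 + 9 * \<delta> / 4) * q" "real N + 1 < (2 * real N + 4) * q"
    using \<delta> by (auto simp: pos_divide_less_eq mult.commute)
  have q0: "0 < q" using bq(2) by (rule le_less_trans[rotated]) simp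
  have p: "1 / q > 2" using q q0 by (simp add: field_simps)
  have "AE \<omega> in M. \<forall>m. \<forall>\<^sub>F n in sequentially. \<omega> \<notin> crowded (1 - (1/2) ^ m) n"
    unfolding AE_all_countable by (intro allI eventually_not_crowded) (simp add: power_le_one)
  moreover have "AE \<omega> in M. \<forall>p>2. \<forall>a\<ge>0. \<forall>b. \<exists>c. \<forall>s t. a \<le> s \<and> s \<le> t \<and> t \<le> b \<longrightarrow>
      norm (W t \<omega> - W s \<omega>) \<le> c * (t - s) powr (1 / p)"
    using assms(4)[unfolded iterated_ito_version_def, THEN conjunct2]
    by eventually_elim (drule conjunct2, meson)
  ultimately show ?thesis
    using started_at_0 eventually_not_Z AE_space
  proof eventually_elim
    case (elim \<omega>)
    obtain c where c: "\<forall>s t. 0 \<le> s \<and> s \<le> t \<and> t \<le> 1 \<longrightarrow> norm (W t \<omega> - W s \<omega>) \<le> c * (t - s) powr (1 / (1 / q))"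
      using elim(2)[rule_format, OF p, of 0 1] by auto
    have "\<exists>f :: real ^ 6 \<Rightarrow> real. compact (closure {x. f x \<noteq> 0}) \<and> C_2_minus \<epsilon> f \<and>
      infinite {y \<in> extensional {0..1}.
        is_path_solution (\<lambda>t. W t \<omega>) (\<lambda>r j s t. A r j s t \<omega>) (last_coord_system f) 1 0 y}"
      using c q0 q' assms(1,2) \<alpha> N\<alpha> elim by (intro path_climbs[of \<omega> c q]) (auto simp: \<alpha>\<delta>)
    then show ?case by (meson zero_less_one)
  qed
qed

end
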